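(* Let $p$ be any monotone decreasing probability mass function on $\mathbb N$ and let $X_1,X_2,\dots$ be i.i.d. with mass function $p$. For any $2\le k<\infty$, as $n\to\infty$, $$n^{k/2}R_k(p,\widehat p_n)\to E[\|Y\|_k^k],$$ $$n^{k/2}R_k(p,\widehat p_n^R)\to E[\|Y\|_k^k],$$ $$n^{k/2}R_k(p,\widehat p_n^G)\to E[\|Y^G\|_k^k]\le E[\|Y\|_k^k],$$ and for $k=\infty$ the same statements hold with $n^{k/2}$ replaced by $n^{1/2}$ and $\|\cdot\|_k^k$ replaced by $\|\cdot\|_\infty$. The inequality in the last line is strict if $p$ is not strictly monotone. The statements also hold for $k=1$ under the additional hypothesis that $\sum_{x\ge0}\sqrt{p_x}<\infty$.
   Context: $\mathbb N=\{0,1,2,\dots\}$. $p$ is monotone decreasing if $p_x\ge p_{x+1}$ for all $x\in\mathbb N$; it is called strictly monotone here if it is strictly decreasing on its support, i.e. $p_x>p_{x+1}$ for every $x$ with $p_x>0$. The empirical estimator is $\widehat p_{n,x}=n^{-1}\#\{i\le n:X_i=x\}$. For a finite vector $w=(w_0,\dots,w_m)$, $\mathrm{rear}(w)$ is the vector of entries of $w$ sorted in nonincreasing order, and $\mathrm{gren}(w)$ is the vector of the $m+1$ left slopes, at $j=0,\dots,m$, of the least concave majorant of the points $\{(j,\sum_{i=0}^jw_i):j=-1,0,\dots,m\}$ (empty sum $=0$). For a vector indexed by $r,\dots,s$ these are defined in the same way after shifting indices. The rearrangement estimator is $\widehat p_n^R=\mathrm{rear}(\widehat p_n)$ and the Grenander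 estimator (MLE) is $\widehat p_n^G=\mathrm{gren}(\widehat p_n)$; both operators are applied to the finite vector $(\widehat p_{n,x})_{0\le x\le\max_{i\le n}X_i}$, and the results are extended by $0$ to $\mathbb N$. Risk: $R_k(p,\widetilde p_n)=E_p\left[\sum_{x\ge0}|\widetilde p_{n,x}-p_x|^k\right]$ for $1\le k<\infty$, and $R_\infty(p,\widetilde p_n)=E_p\left[\sup_{x\ge0}|\widetilde p_{n,x}-p_x|\right]$. $\|v\|_k=(\sum_{x\ge0}|v_x|^k)^{1/k}$ for $k<\infty$, $\|v\|_\infty=\sup_{x\ge0}|v_x|$. $Y=(Y_x)_{x\in\mathbb N}$ is the mean-zero Gaussian process in $\ell_2$ with $\mathrm{cov}(Y_x,Y_{x'})=p_x\delta_{x,x'}-p_xp_{x'}$. $Y^G$ is obtained from $Y$ by setting $(Y^G_r,\dots,Y^G_s)=\mathrm{gren}(Y_r,\dots,Y_s)$ for all $r<s$ with $p_{r-1}>p_r=\dots=p_s>p_{s+1}$ (convention $p_{-1}=+\infty$), and $Y^G_x=Y_x$ for all other $x$. *)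

theory Defs
  imports "HOL-Probability.Probability" "HOL-Library.More_List"
begin

section \<open>Rearrangement and Grenander operators\<close>

definition rear :: "real list \<Rightarrow> real list" where
  "rear w = rev (sort w)"

text \<open>The least concave majorant of a finite set of points, on the interval spanned by their
  abscissae; outside that interval the value is meaningless.\<close>

definition least_concave_majorant :: "(real \<times> real) set \<Rightarrow> real \<Rightarrow> real" where
  "least_concave_majorant P t =
     Inf {g t | g. concave_on (convex hull (fst ` P)) g \<and> (\<forall>(a, b) \<in> P. b \<le> g a)}"

text \<open>For \<open>w = (w\<^sub>0, \<dots>, w\<^sub>m)\<close> these are the points \<open>(j, w\<^sub>0 + \<dots> + w\<^sub>j)\<close> for
  \<open>j = -1, \<dots>, m\<close>; here \<open>i = j + 1\<close> is the number of summands.\<close>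

definition cumsum_points :: "real list \<Rightarrow> (real \<times> real) set" where
  "cumsum_points w = {(real i - 1, sum_list (take i w)) | i. i \<le> length w}"

definition gren :: "real list \<Rightarrow> real list" where
  "gren w = map (\<lambda>j. vector_derivative (least_concave_majorant (cumsum_points w)) (at_left (real j)))
              [0..<length w]"


section \<open>The three estimators\<close>

text \<open>Estimators are functions of the sample \<open>xs 1, \<dots>, xs n\<close>; the value \<open>xs 0\<close> is not used.
  Only \<open>n \<ge> 1\<close> is meaningful.\<close>

definition empirical :: "nat \<Rightarrow> (nat \<Rightarrow> nat) \<Rightarrow> nat \<Rightarrow> real" where
  "empirical n xs x = real (card {i \<in> {1..n}. xs i = x}) / real n"

definition empirical_vector :: "nat \<Rightarrow> (nat \<Rightarrow> nat) \<Rightarrow> real list" where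
  "empirical_vector n xs = map (empirical n xs) [0..<Suc (Max (xs ` {1..n}))]"

definition rearrangement_estimator :: "nat \<Rightarrow> (nat \<Rightarrow> nat) \<Rightarrow> nat \<Rightarrow> real" where
  "rearrangement_estimator n xs = nth_default 0 (rear (empirical_vector n xs))"

definition grenander_estimator :: "nat \<Rightarrow> (nat \<Rightarrow> nat) \<Rightarrow> nat \<Rightarrow> real" where
  "grenander_estimator n xs = nth_default 0 (gren (empirical_vector n xs))"


section \<open>Norms and risks, with values in \<open>[0, \<infinity>]\<close>\<close>

definition ennreal_powr :: "ennreal \<Rightarrow> real \<Rightarrow> ennreal" where \<comment> \<open>meant for positive exponents\<close>
  "ennreal_powr a r = (if a = \<infinity> then \<infinity> else ennreal (enn2real a powr r))"

definition lk_norm :: "real \<Rightarrow> (nat \<Rightarrow> real) \<Rightarrow> ennreal" where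
  "lk_norm k v = ennreal_powr (\<Sum>x. ennreal (\<bar>v x\<bar> powr k)) (1 / k)"

definition sup_norm :: "(nat \<Rightarrow> real) \<Rightarrow> ennreal" where
  "sup_norm v = (SUP x. ennreal \<bar>v x\<bar>)"

definition risk :: "real \<Rightarrow> 'a measure \<Rightarrow> nat pmf \<Rightarrow> ('a \<Rightarrow> nat \<Rightarrow> real) \<Rightarrow> ennreal" where
  "risk k M p est = (\<integral>\<^sup>+\<omega>. (\<Sum>x. ennreal (\<bar>est \<omega> x - pmf p x\<bar> powr k)) \<partial>M)"

definition sup_risk :: "'a measure \<Rightarrow> nat pmf \<Rightarrow> ('a \<Rightarrow> nat \<Rightarrow> real) \<Rightarrow> ennreal" where
  "sup_risk M p est = (\<integral>\<^sup>+\<omega>. (SUP x. ennreal \<bar>est \<omega> x - pmf p x\<bar>) \<partial>M)"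


section \<open>The mass function and the limit processes\<close>

definition strictly_monotone :: "nat pmf \<Rightarrow> bool" where
  "strictly_monotone p \<longleftrightarrow> (\<forall>x. pmf p x > 0 \<longrightarrow> pmf p x > pmf p (x + 1))"

definition iid_sample :: "'a measure \<Rightarrow> nat pmf \<Rightarrow> (nat \<Rightarrow> 'a \<Rightarrow> nat) \<Rightarrow> bool" where
  "iid_sample M p X \<longleftrightarrow>
     prob_space.indep_vars M (\<lambda>_. count_space UNIV) X {1..} \<and>
     (\<forall>i\<ge>1. distr M (count_space UNIV) (X i) = measure_pmf p)"

text \<open>A real Gaussian variable, where a degenerate (almost surely constant) one is allowed.\<close>

definition gaussian_var :: "'b measure \<Rightarrow> ('b \<Rightarrow> real) \<Rightarrow> bool" where
  "gaussian_var N Z \<longleftrightarrow> Z \<in> borel_measurable N \<and>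
     ((\<exists>c. AE \<omega> in N. Z \<omega> = c) \<or>
      (\<exists>\<mu> \<sigma>. \<sigma> > 0 \<and> distributed N lborel Z (normal_density \<mu> \<sigma>)))"

definition gaussian_process :: "'b measure \<Rightarrow> (nat \<Rightarrow> 'b \<Rightarrow> real) \<Rightarrow> bool" where
  "gaussian_process N Y \<longleftrightarrow>
     (\<forall>J a. finite J \<longrightarrow> gaussian_var N (\<lambda>\<omega>. \<Sum>x\<in>J. a x * Y x \<omega>))"

definition covar :: "'b measure \<Rightarrow> ('b \<Rightarrow> real) \<Rightarrow> ('b \<Rightarrow> real) \<Rightarrow> real" where
  "covar N U V = (\<integral>\<omega>. (U \<omega> - (\<integral>\<omega>'. U \<omega>' \<partial>N)) * (V \<omega> - (\<integral>\<omega>'. V \<omega>' \<partial>N)) \<partial>N)"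

definition limit_process :: "'b measure \<Rightarrow> nat pmf \<Rightarrow> (nat \<Rightarrow> 'b \<Rightarrow> real) \<Rightarrow> bool" where
  "limit_process N p Y \<longleftrightarrow>
     gaussian_process N Y \<and>
     (AE \<omega> in N. summable (\<lambda>x. (Y x \<omega>)\<^sup>2)) \<and>
     (\<forall>x. (\<integral>\<omega>. Y x \<omega> \<partial>N) = 0) \<and>
     (\<forall>x x'. covar N (Y x) (Y x') = (if x = x' then pmf p x else 0) - pmf p x * pmf p x')"

text \<open>\<open>{r..s}\<close> is a maximal interval of constancy of \<open>p\<close> with at least two points.
  The case \<open>r = 0\<close> is the convention \<open>p\<^sub>-\<^sub>1 = \<infinity>\<close>.\<close>

definition flat_block :: "nat pmf \<Rightarrow> nat \<Rightarrow> nat \<Rightarrow> bool" where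
  "flat_block p r s \<longleftrightarrow> r < s \<and> (r = 0 \<or> pmf p (r - 1) > pmf p r) \<and>
     (\<forall>x\<in>{r..s}. pmf p x = pmf p r) \<and> pmf p s > pmf p (s + 1)"

text \<open>The block containing \<open>x\<close> is unique if it exists, so \<open>THE\<close> is meaningful.\<close>

definition grenander_process :: "nat pmf \<Rightarrow> (nat \<Rightarrow> real) \<Rightarrow> nat \<Rightarrow> real" where
  "grenander_process p y x =
     (if \<exists>r s. flat_block p r s \<and> x \<in> {r..s}
      then (let (r, s) = (THE (r, s). flat_block p r s \<and> x \<in> {r..s})
            in gren (map y [r..<Suc s]) ! (x - r))
      else y x)"

end

theory Submission
  imports Defs
begin

text \<open>Write \<open>V\<^sub>n = \<surd>n (empirical - p)\<close>. The exponential moment of a centred binomial variable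
  gives \<open>E (cosh V\<^sub>n\<^sub>,\<^sub>x - 1) \<le> 2 p\<^sub>x\<close>, so all absolute moments of order \<open>r \<ge> 2\<close> are bounded by
  \<open>C\<^sub>r p\<^sub>x\<close> uniformly in \<open>n\<close> and the loss carried by \<open>x \<ge> m\<close> is uniformly small; for \<open>r = 1\<close> the bound
  is \<open>C \<surd>p\<^sub>x\<close>. Rearrangement and Grenander operator are contractions towards a decreasing \<open>p\<close> for
  every convex loss, which passes these bounds on to the other two estimators. If \<open>p\<close> drops at \<open>m\<close>
  and the empirical frequencies are uniformly close to \<open>p\<close>, both operators act separately on the
  intervals of constancy below \<open>m\<close>: the rearrangement only permutes errors there, and the Grenander
  errors are \<open>V\<^sub>n\<^sup>G\<close>. What remains is a finite-dimensional Lipschitz functional of \<open>V\<^sub>n\<close>, to which the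
  central limit theorem applies.

  The Grenander loss is strictly smaller with positive probability: on an interval of constancy
  \<open>{r..s}\<close> the difference \<open>Y\<^sub>r - Y\<^sub>s\<close> is an unbounded Gaussian variable independent of
  \<open>Y\<^sub>r + Y\<^sub>s\<close> and of the other coordinates, and when it is very negative the interval is averaged out.\<close>

section \<open>Antitone regression and the Grenander operator\<close>

text \<open>The central limit theorem enters only for real i.i.d. sums. It gives the characteristic
  functions of linear combinations of finitely many coordinates, and a density argument based on
  bounded second moments upgrades these to means of Lipschitz functionals. The same argument, with a
  constant sequence, yields equality of finite-dimensional laws in the strictness proof; with
  truncated powers it carries the moment bounds over to the Gaussian limit.

  Regression is described by the weak notion \<open>pooled\<close>, because the limit map acts block
  by block and its values may increase from one block to the next; contraction and Lipschitz bounds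
  then ask for monotonicity only where the cumulative sums differ.

  Losses and risks take values in [0, \<infinity>], so approximation is phrased by one-sided
  inequalities with an additive error.

  For a strict supremum loss the fitted process must be bounded in all coordinates at once. The
  event is therefore built for finitely many coordinates, with a lower bound on its probability that
  does not depend on their number.\<close>

text \<open>The optimality conditions of isotonic regression: the cumulative sums of \<open>g\<close> lie above those of
  \<open>w\<close>, and \<open>g\<close> may change only where the two meet.\<close>

definition pooled :: "nat \<Rightarrow> nat \<Rightarrow> (nat \<Rightarrow> real) \<Rightarrow> (nat \<Rightarrow> real) \<Rightarrow> bool" where
  "pooled a b w g \<longleftrightarrow> sum w {a..<b} = sum g {a..<b} \<and>
     (\<forall>j. a < j \<and> j < b \<longrightarrow> sum w {a..<j} \<le> sum g {a..<j} \<and>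
        (sum w {a..<j} \<noteq> sum g {a..<j} \<longrightarrow> g j = g (j - 1)))"

definition antitone_fit :: "nat \<Rightarrow> nat \<Rightarrow> (nat \<Rightarrow> real) \<Rightarrow> (nat \<Rightarrow> real) \<Rightarrow> bool" where
  "antitone_fit a b w g \<longleftrightarrow> pooled a b w g \<and> (\<forall>j. a < j \<and> j < b \<longrightarrow> g j \<le> g (j - 1))"

lemma pooledD:
  assumes "pooled a b w g"
  shows "sum w {a..<b} = sum g {a..<b}"
    and "a \<le> j \<Longrightarrow> j \<le> b \<Longrightarrow> sum w {a..<j} \<le> sum g {a..<j}"
    and "a < j \<Longrightarrow> j < b \<Longrightarrow> sum w {a..<j} \<noteq> sum g {a..<j} \<Longrightarrow> g j = g (j - 1)"
proof -
  show "sum w {a..<j} \<le> sum g {a..<j}" if "a \<le> j" "j \<le> b"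
    using assms that unfolding pooled_def by (cases "a = j \<or> j = b") auto
qed (use assms in \<open>auto simp: pooled_def\<close>)

lemma pooled_cong:
  assumes "\<And>x. a \<le> x \<Longrightarrow> x < b \<Longrightarrow> w x = w' x" "\<And>x. a \<le> x \<Longrightarrow> x < b \<Longrightarrow> g x = g' x"
  shows "pooled a b w g \<longleftrightarrow> pooled a b w' g'"
proof -
  have "sum w {a..<j} = sum w' {a..<j}" "sum g {a..<j} = sum g' {a..<j}" if "j \<le> b" for j
    using assms that by (auto intro!: sum.cong)
  moreover have "g j = g' j" "g (j - 1) = g' (j - 1)" if "a < j" "j < b" for j
    using assms(2)[of j] assms(2)[of "j - 1"] that by auto
  ultimately show ?thesis unfolding pooled_def by auto
qed

lemma antitone_fit_cong:
  assumes "\<And>x. a \<le> x \<Longrightarrow> x < b \<Longrightarrow> w x = w' x" "\<And>x. a \<le> x \<Longrightarrow> x < b \<Longrightarrow> g x = g' x"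
  shows "antitone_fit a b w g \<longleftrightarrow> antitone_fit a b w' g'"
proof -
  have "g j = g' j" "g (j - 1) = g' (j - 1)" if "a < j" "j < b" for j
    using assms(2)[of j] assms(2)[of "j - 1"] that by auto
  then show ?thesis unfolding antitone_fit_def using pooled_cong[OF assms] by auto
qed

lemma pooled_refl [simp]: "pooled a b w w" by (auto simp: pooled_def)

text \<open>At \<open>b\<close> the two cumulative sums meet, so beyond \<open>b\<close> their
  difference is the one started at \<open>b\<close>, and the jump of \<open>g\<close> at
  \<open>b\<close> is unrestricted.\<close>

lemma pooled_append:
  assumes "pooled a b w g" "pooled b c w g" "a \<le> b" "b \<le> c"
  shows "pooled a c w g"
proof -
  have s: "sum f {a..<j} = sum f {a..<b} + sum f {b..<j}" if "b \<le> j" for f :: "nat \<Rightarrow> real" and j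
    using that assms(3) by (simp add: sum.atLeastLessThan_concat)
  show ?thesis unfolding pooled_def
  proof (intro conjI allI impI)
    show "sum w {a..<c} = sum g {a..<c}"
      using pooledD(1)[OF assms(1)] pooledD(1)[OF assms(2)] s[of c] assms by simp
    fix j assume j: "a < j \<and> j < c"
    show "sum w {a..<j} \<le> sum g {a..<j}"
      using pooledD(2)[OF assms(1), of j] pooledD(2)[OF assms(2), of j] pooledD(1)[OF assms(1)] s[of j] j
      by (cases "j \<le> b") auto
    assume ne: "sum w {a..<j} \<noteq> sum g {a..<j}"
    show "g j = g (j - 1)"
      using pooledD(3)[OF assms(1), of j] pooledD(3)[OF assms(2), of j] pooledD(1)[OF assms(1)] s[of j] j ne
      by (cases j b rule: linorder_cases) auto
  qed
qed

lemma antitone_fit_append: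
  assumes "antitone_fit a b w g" "antitone_fit b c w g" "a \<le> b" "b \<le> c" "a < b \<Longrightarrow> b < c \<Longrightarrow> g b \<le> g (b - 1)"
  shows "antitone_fit a c w g"
proof -
  have "g j \<le> g (j - 1)" if "a < j" "j < c" for j
    using assms that by (cases j b rule: linorder_cases) (auto simp: antitone_fit_def)
  then show ?thesis using assms pooled_append[of a b w g c] by (auto simp: antitone_fit_def)
qed

text \<open>Abel summation: with \<open>D j\<close> the difference of the cumulative sums, the sum
  equals minus the sum of \<open>D j * (c j - c (j - 1))\<close>, because \<open>D\<close> vanishes
  at both ends. Since \<open>D j \<le> 0\<close>, only increments of \<open>c\<close> at indices
  with \<open>D j \<noteq> 0\<close> have to be nonnegative.\<close>

lemma pooled_abel:
  assumes p: "pooled a b w g"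
    and c: "\<And>j. a < j \<Longrightarrow> j < b \<Longrightarrow> sum w {a..<j} \<noteq> sum g {a..<j} \<Longrightarrow> c (j - 1) \<le> c j"
  shows "(\<Sum>x\<in>{a..<b}. (w x - g x) * c x) \<ge> 0"
proof (cases "a < b")
  case True
  \<comment> \<open>The right-hand side is the boundary term of the partial summation; it vanishes
    at \<open>j = b\<close>.\<close>
  have "j \<le> b \<longrightarrow> (\<Sum>x\<in>{a..<j}. (w x - g x) * c x) \<ge> (sum w {a..<j} - sum g {a..<j}) * c (j - 1)"
    if "Suc a \<le> j" for j
    using that
  proof (induction j rule: nat_induct_at_least)
    case (Suc j)
    show ?case
    proof
      assume j: "Suc j \<le> b"
      let ?D = "sum w {a..<j} - sum g {a..<j}"
      have "?D \<le> 0" using pooledD(2)[OF p, of j] j Suc by simp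
      moreover have "?D \<noteq> 0 \<Longrightarrow> c (j - 1) \<le> c j" using c[of j] j Suc by simp
      ultimately have "?D * c j \<le> ?D * c (j - 1)"
        by (cases "sum w {a..<j} = sum g {a..<j}") (auto intro: mult_left_mono_neg)
      moreover have "(\<Sum>x\<in>{a..<j}. (w x - g x) * c x) \<ge> ?D * c (j - 1)" using Suc j by simp
      ultimately show "(\<Sum>x\<in>{a..<Suc j}. (w x - g x) * c x)
          \<ge> (sum w {a..<Suc j} - sum g {a..<Suc j}) * c (Suc j - 1)"
        using Suc by (simp add: algebra_simps)
    qed
  qed (simp add: algebra_simps)
  from this[of b] True pooledD(1)[OF p] show ?thesis by simp
qed simp

text \<open>Monotonicity of the subgradient selection comes for free: add the two subgradient inequalities
  between \<open>x\<close> and \<open>y\<close>.\<close>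

lemma convex_subgradient:
  fixes \<phi> :: "real \<Rightarrow> real"
  assumes "convex_on UNIV \<phi>"
  obtains d where "\<And>x y. \<phi> x + d x * (y - x) \<le> \<phi> y" "mono d"
proof -
  \<comment> \<open>The right derivative, written as the infimum of the difference quotients to the
    right.\<close>
  define d where "d x = Inf ((\<lambda>t. (\<phi> x - \<phi> t) / (x - t)) ` ({x<..} \<inter> UNIV))" for x
  have *: "\<phi> x + d x * (y - x) \<le> \<phi> y" for x y
    using convex_le_Inf_differential[OF assms, of x y] by (simp add: d_def)
  have "mono d"
  proof (rule monoI)
    fix x y :: real assume "x \<le> y"
    show "d x \<le> d y"
    proof (cases "x = y")
      case False
      have "(d y - d x) * (y - x) \<ge> 0" using *[of x y] *[of y x] by (simp add: algebra_simps)
      with False \<open>x \<le> y\<close> show ?thesis by (simp add: zero_le_mult_iff)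
    qed simp
  qed
  with * that show ?thesis by blast
qed

text \<open>Summation by parts against \<open>d (g - q)\<close>, where \<open>d\<close> is a monotone subgradient of \<open>\<phi>\<close>.\<close>

lemma pooled_contract:
  assumes p: "pooled a b w g" and conv: "convex_on UNIV \<phi>"
    and q: "\<And>j. a < j \<Longrightarrow> j < b \<Longrightarrow> q j \<le> q (j - 1)"
  shows "(\<Sum>x\<in>{a..<b}. \<phi> (g x - q x)) \<le> (\<Sum>x\<in>{a..<b}. \<phi> (w x - q x :: real))"
proof -
  obtain d where d: "\<And>x y. \<phi> x + d x * (y - x) \<le> \<phi> y" "mono d"
    using convex_subgradient[OF conv] by blast
  have "0 \<le> (\<Sum>x\<in>{a..<b}. (w x - g x) * d (g x - q x))"
  proof (rule pooled_abel[OF p])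
    fix j assume j: "a < j" "j < b" "sum w {a..<j} \<noteq> sum g {a..<j}"
    \<comment> \<open>Where the cumulative sums differ, \<open>g\<close> stays constant while
      \<open>q\<close> can only fall, so \<open>g - q\<close> does not fall.\<close>
    then have "g (j - 1) - q (j - 1) \<le> g j - q j" using pooledD(3)[OF p j] q[OF j(1,2)] by simp
    then show "d (g (j - 1) - q (j - 1)) \<le> d (g j - q j)" using d(2) by (auto dest: monoD)
  qed
  also have "\<dots> \<le> (\<Sum>x\<in>{a..<b}. \<phi> (w x - q x) - \<phi> (g x - q x))"
  proof (rule sum_mono)
    fix x show "(w x - g x) * d (g x - q x) \<le> \<phi> (w x - q x) - \<phi> (g x - q x)"
      using d(1)[of "g x - q x" "w x - q x"] by (simp add: algebra_simps)
  qed
  finally show ?thesis by (simp add: sum_subtractf)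
qed

section \<open>Pointwise bounds and Lipschitz continuity of antitone fits\<close>

lemma convex_on_max0: "convex_on UNIV f \<Longrightarrow> convex_on UNIV (\<lambda>t. max (0::real) (f t))"
proof (rule convex_onI)
  fix t x y :: 'a and u :: real assume f: "convex_on UNIV f" and u: "0 < u" "u < 1"
  have "f ((1 - u) *\<^sub>R x + u *\<^sub>R y) \<le> (1 - u) * f x + u * f y"
    using convex_onD[OF f, of u x y] u by auto
  also have "\<dots> \<le> (1 - u) * max 0 (f x) + u * max 0 (f y)"
    using u by (intro add_mono mult_left_mono) auto
  finally show "max 0 (f ((1 - u) *\<^sub>R x + u *\<^sub>R y)) \<le> (1 - u) * max 0 (f x) + u * max 0 (f y)"
    using u by simp
qed (auto)

text \<open>Excess functions turn comparisons of convex sums into pointwise bounds: the total excess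
  over \<open>c\<close> is zero exactly if no entry exceeds \<open>c\<close>.\<close>

lemma convex_excess: "convex_on UNIV (\<lambda>t::real. max 0 (t - c))" "convex_on UNIV (\<lambda>t::real. max 0 (c - t))"
  "convex_on UNIV (\<lambda>t::real. max 0 (\<bar>t\<bar> - c))"
proof -
  show "convex_on UNIV (\<lambda>t::real. max 0 (t - c))"
    by (rule convex_on_max0) (auto intro!: convex_onI simp: algebra_simps)
  show "convex_on UNIV (\<lambda>t::real. max 0 (c - t))"
    by (rule convex_on_max0) (auto intro!: convex_onI simp: algebra_simps)
  show "convex_on UNIV (\<lambda>t::real. max 0 (\<bar>t\<bar> - c))"
  proof (rule convex_on_max0, rule convex_onI)
    fix t x y :: real assume t: "0 < t" "t < 1"
    have "\<bar>(1 - t) * x + t * y\<bar> \<le> \<bar>(1 - t) * x\<bar> + \<bar>t * y\<bar>" by (rule abs_triangle_ineq)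
    also have "\<dots> = (1 - t) * \<bar>x\<bar> + t * \<bar>y\<bar>" using t by (simp add: abs_mult)
    finally show "\<bar>(1 - t) *\<^sub>R x + t *\<^sub>R y\<bar> - c \<le> (1 - t) * (\<bar>x\<bar> - c) + t * (\<bar>y\<bar> - c)"
      by (simp add: algebra_simps)
  qed auto
qed

lemma sum_excess_le_zero:
  fixes f g :: "nat \<Rightarrow> real"
  assumes "(\<Sum>x\<in>A. max 0 (f x)) \<le> (\<Sum>x\<in>A. max 0 (g x))" "\<And>x. x \<in> A \<Longrightarrow> g x \<le> 0" "finite A" "y \<in> A"
  shows "f y \<le> 0"
proof -
  have "(\<Sum>x\<in>A. max 0 (g x)) = 0" using assms(2) by (intro sum.neutral) auto
  then have "max 0 (f y) \<le> 0"
    using member_le_sum[OF assms(4), of "\<lambda>x. max 0 (f x)"] assms by auto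
  then show ?thesis by simp
qed

lemma pooled_bounds:
  assumes p: "pooled a b w g" and x: "a \<le> x" "x < b"
  shows "(\<And>y. a \<le> y \<Longrightarrow> y < b \<Longrightarrow> w y \<le> c) \<Longrightarrow> g x \<le> c"
    and "(\<And>y. a \<le> y \<Longrightarrow> y < b \<Longrightarrow> c \<le> w y) \<Longrightarrow> c \<le> g x"
proof -
  assume "\<And>y. a \<le> y \<Longrightarrow> y < b \<Longrightarrow> w y \<le> c"
  then show "g x \<le> c"
    using sum_excess_le_zero[of "\<lambda>t. g t - c" "{a..<b}" "\<lambda>t. w t - c" x]
      pooled_contract[OF p convex_excess(1)[of c], of "\<lambda>_. 0"] x by auto
next
  assume "\<And>y. a \<le> y \<Longrightarrow> y < b \<Longrightarrow> c \<le> w y"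
  then show "c \<le> g x"
    using sum_excess_le_zero[of "\<lambda>t. c - g t" "{a..<b}" "\<lambda>t. c - w t" x]
      pooled_contract[OF p convex_excess(2)[of c], of "\<lambda>_. 0"] x by auto
qed

text \<open>Nonexpansiveness of a projection: \<open>w - g\<close> has nonnegative inner product
  with \<open>g - g'\<close>, and \<open>w' - g'\<close> with \<open>g' - g\<close>, hence the
  squared distance of the fits is at most the inner product of \<open>w - w'\<close> and
  \<open>g - g'\<close>. Each fit must decrease only where the cumulative sums of the other pair
  differ, which also covers fits that rise from one block to the next.\<close>

lemma pooled_lipschitz:
  assumes p: "pooled a b w g" "pooled a b w' g'"
    and m: "\<And>j. a < j \<Longrightarrow> j < b \<Longrightarrow> sum w {a..<j} \<noteq> sum g {a..<j} \<Longrightarrow> g' j \<le> g' (j - 1)"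
      "\<And>j. a < j \<Longrightarrow> j < b \<Longrightarrow> sum w' {a..<j} \<noteq> sum g' {a..<j} \<Longrightarrow> g j \<le> g (j - 1)"
    and x: "a \<le> x" "x < b"
  shows "\<bar>g x - g' x\<bar> \<le> (\<Sum>y\<in>{a..<b}. \<bar>w y - w' y\<bar>)"
proof -
  let ?A = "{a..<b}"
  have 1: "0 \<le> (\<Sum>x\<in>?A. (w x - g x) * (g x - g' x))"
  proof (rule pooled_abel[OF p(1)])
    fix j assume j: "a < j" "j < b" "sum w {a..<j} \<noteq> sum g {a..<j}"
    show "g (j - 1) - g' (j - 1) \<le> g j - g' j" using pooledD(3)[OF p(1) j] m(1)[OF j] by simp
  qed
  have 2: "0 \<le> (\<Sum>x\<in>?A. (w' x - g' x) * (g' x - g x))"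
  proof (rule pooled_abel[OF p(2)])
    fix j assume j: "a < j" "j < b" "sum w' {a..<j} \<noteq> sum g' {a..<j}"
    show "g' (j - 1) - g (j - 1) \<le> g' j - g j" using pooledD(3)[OF p(2) j] m(2)[OF j] by simp
  qed
  have "(\<Sum>x\<in>?A. (g x - g' x)\<^sup>2)
      = (\<Sum>x\<in>?A. (w x - w' x) * (g x - g' x)) - (\<Sum>x\<in>?A. (w x - g x) * (g x - g' x))
        - (\<Sum>x\<in>?A. (w' x - g' x) * (g' x - g x))"
    unfolding sum_subtractf[symmetric] by (intro sum.cong) (auto simp: algebra_simps power2_eq_square)
  with 1 2 have l2: "(\<Sum>x\<in>?A. (g x - g' x)\<^sup>2) \<le> (\<Sum>x\<in>?A. (w x - w' x) * (g x - g' x))" by linarith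
  \<comment> \<open>The inner product is bounded by the l1 distance of the data times the sup
    distance \<open>d\<close> of the fits; as \<open>d\<close> squared is below the left-hand side,
    one factor \<open>d\<close> cancels.\<close>
  define d where "d = Max ((\<lambda>x. \<bar>g x - g' x\<bar>) ` ?A)"
  have fin: "finite ((\<lambda>x. \<bar>g x - g' x\<bar>) ` ?A)" "(\<lambda>x. \<bar>g x - g' x\<bar>) ` ?A \<noteq> {}" using x by auto
  have dge: "\<bar>g y - g' y\<bar> \<le> d" if "y \<in> ?A" for y unfolding d_def using fin that by (intro Max_ge) auto
  obtain y where y: "y \<in> ?A" "d = \<bar>g y - g' y\<bar>" using Max_in[OF fin] unfolding d_def by auto
  have "d\<^sup>2 = (g y - g' y)\<^sup>2" using y by simp
  also have "\<dots> \<le> (\<Sum>x\<in>?A. (g x - g' x)\<^sup>2)" using y by (intro member_le_sum) auto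
  also note l2
  also have "(\<Sum>x\<in>?A. (w x - w' x) * (g x - g' x)) \<le> (\<Sum>x\<in>?A. \<bar>w x - w' x\<bar> * d)"
  proof (rule sum_mono)
    fix x assume "x \<in> ?A"
    have "(w x - w' x) * (g x - g' x) \<le> \<bar>w x - w' x\<bar> * \<bar>g x - g' x\<bar>"
      by (metis abs_ge_self abs_mult)
    also have "\<dots> \<le> \<bar>w x - w' x\<bar> * d" using dge \<open>x \<in> ?A\<close> by (intro mult_left_mono) auto
    finally show "(w x - w' x) * (g x - g' x) \<le> \<bar>w x - w' x\<bar> * d" .
  qed
  finally have "d * d \<le> (\<Sum>x\<in>?A. \<bar>w x - w' x\<bar>) * d" by (simp add: power2_eq_square sum_distrib_right)
  moreover have "0 \<le> d" using y by simp
  ultimately have "d \<le> (\<Sum>x\<in>?A. \<bar>w x - w' x\<bar>)"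
    by (cases "d = 0") (auto intro: sum_nonneg mult_right_le_imp_le)
  with dge[of x] x show ?thesis by simp
qed

lemma antitone_fit_lipschitz:
  assumes "antitone_fit a b w g" "antitone_fit a b w' g'" "a \<le> x" "x < b"
  shows "\<bar>g x - g' x\<bar> \<le> (\<Sum>y\<in>{a..<b}. \<bar>w y - w' y\<bar>)"
  using assms by (intro pooled_lipschitz) (auto simp: antitone_fit_def)

lemma antitone_fit_unique:
  assumes "antitone_fit a b w g" "antitone_fit a b w g'" "a \<le> x" "x < b"
  shows "g x = g' x"
  using antitone_fit_lipschitz[OF assms] by simp

text \<open>The bounds \<open>l\<close> and \<open>u\<close> are the nearest contacts of the two
  cumulative sums around \<open>j\<close>; strictly between them \<open>g\<close> cannot
  change.\<close>

lemma pooled_group: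
  assumes p: "pooled a b w g" and j: "a \<le> j" "j < b"
  obtains l u where "a \<le> l" "l \<le> j" "j < u" "u \<le> b" "sum w {a..<l} = sum g {a..<l}"
    "sum w {a..<u} = sum g {a..<u}" "\<And>x. l \<le> x \<Longrightarrow> x < u \<Longrightarrow> g x = g j"
proof -
  let ?E = "\<lambda>i. sum w {a..<i} = sum g {a..<i}"
  define l where "l = Max {i\<in>{a..j}. ?E i}"
  have fl: "finite {i\<in>{a..j}. ?E i}" "{i\<in>{a..j}. ?E i} \<noteq> {}" using j by auto
  have l: "a \<le> l" "l \<le> j" "?E l" using Max_in[OF fl] by (auto simp: l_def)
  have lmax: "\<not> ?E i" if "l < i" "i \<le> j" for i
  proof
    assume "?E i"
    then have "i \<le> l" unfolding l_def using fl(1) that l(1) by (intro Max_ge) auto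
    then show False using that by simp
  qed
  define u where "u = (LEAST i. j < i \<and> i \<le> b \<and> ?E i)"
  have u: "j < u" "u \<le> b" "?E u"
    using LeastI[of "\<lambda>i. j < i \<and> i \<le> b \<and> ?E i" b] pooledD(1)[OF p] j by (auto simp: u_def)
  have umin: "\<not> ?E i" if "j < i" "i < u" for i
    using not_less_Least[of i "\<lambda>i. j < i \<and> i \<le> b \<and> ?E i"] that u by (auto simp: u_def)
  have step: "g i = g (i - 1)" if "l < i" "i < u" for i
    using pooledD(3)[OF p, of i] lmax[of i] umin[of i] that l u by (cases "i \<le> j") auto
  have gl: "x < u \<longrightarrow> g x = g l" if "l \<le> x" for x
    using that
  proof (induction x rule: nat_induct_at_least)
    case (Suc n) then show ?case using step[of "Suc n"] by auto
  qed simp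
  have "g x = g j" if "l \<le> x" "x < u" for x using gl[of x] gl[of j] that l u by simp
  with l u that show ?thesis by blast
qed

text \<open>The first level is the largest average \<open>\<alpha>\<close> of an initial segment,
  attained at \<open>e\<close>; the rest is fitted recursively from \<open>e\<close> on. Maximality
  puts the line of slope \<open>\<alpha>\<close> above all cumulative sums.\<close>

lemma antitone_fit_exists: "\<exists>g. antitone_fit a b w g"
proof (induction "b - a" arbitrary: a rule: less_induct)
  case less
  show ?case
  proof (cases "a < b")
    case False then show ?thesis by (intro exI[of _ w]) (auto simp: antitone_fit_def)
  next
    case True
    define av where "av e = sum w {a..<e} / real (e - a)" for e
    define \<alpha> where "\<alpha> = Max (av ` {a<..b})"
    have fin: "finite (av ` {a<..b})" "av ` {a<..b} \<noteq> {}" using True by auto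
    obtain e where e: "a < e" "e \<le> b" "av e = \<alpha>" using Max_in[OF fin] unfolding \<alpha>_def by auto
    have le: "sum w {a..<i} \<le> \<alpha> * (real i - real a)" if "a \<le> i" "i \<le> b" for i
    proof (cases "i = a")
      case False
      with that have "av i \<le> \<alpha>" unfolding \<alpha>_def using fin by (intro Max_ge) auto
      moreover have "sum w {a..<i} = av i * (real i - real a)"
        using that False by (simp add: av_def of_nat_diff)
      ultimately show ?thesis using that False by (simp add: mult_right_mono)
    qed simp
    have eqe: "sum w {a..<e} = \<alpha> * (real e - real a)"
      using e(1,2) by (simp add: e(3)[symmetric] av_def of_nat_diff)
    have "b - e < b - a" using e True by simp
    from less[OF this] obtain g' where g': "antitone_fit e b w g'" by blast
    define g where "g x = (if x < e then \<alpha> else g' x)" for x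
    have sg: "sum g {a..<i} = \<alpha> * (real i - real a)" if "a \<le> i" "i \<le> e" for i
    proof -
      have "sum g {a..<i} = (\<Sum>x\<in>{a..<i}. \<alpha>)" using that by (intro sum.cong) (auto simp: g_def)
      then show ?thesis using that by (simp add: of_nat_diff)
    qed
    have 1: "antitone_fit a e w g"
      unfolding antitone_fit_def pooled_def
    proof (intro conjI allI impI)
      show "sum w {a..<e} = sum g {a..<e}" using sg[of e] eqe e by simp
      fix j assume j: "a < j \<and> j < e"
      then show "sum w {a..<j} \<le> sum g {a..<j}" using sg[of j] le[of j] e by simp
      show "g j = g (j - 1)" "g j \<le> g (j - 1)" using j by (auto simp: g_def)
    qed
    have 2: "antitone_fit e b w g" using g' by (subst antitone_fit_cong[of e b w w g g']) (auto simp: g_def)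
    \<comment> \<open>The first group of the remainder has average \<open>g e\<close>. Its sum is a
      cumulative sum below the line of slope \<open>\<alpha>\<close> minus one on that line, so its
      average cannot exceed \<open>\<alpha>\<close>.\<close>
    have "g e \<le> \<alpha>" if eb: "e < b"
    proof -
      from 2 have p: "pooled e b w g" by (simp add: antitone_fit_def)
      obtain l u where u: "e \<le> l" "l \<le> e" "e < u" "u \<le> b" "sum w {e..<l} = sum g {e..<l}"
        "sum w {e..<u} = sum g {e..<u}" and gu: "\<And>x. l \<le> x \<Longrightarrow> x < u \<Longrightarrow> g x = g e"
        by (rule pooled_group[OF p order_refl eb], rule that)
      have "sum g {e..<u} = (\<Sum>x\<in>{e..<u}. g e)" using u by (intro sum.cong refl gu) auto
      then have "g e * (real u - real e) = sum w {e..<u}" using u by (simp add: of_nat_diff)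
      also have "\<dots> = sum w {a..<u} - sum w {a..<e}"
        using sum.atLeastLessThan_concat[of a e u w] e u by simp
      also have "\<dots> \<le> \<alpha> * (real u - real e)"
        using le[of u] eqe e u by (simp add: algebra_simps)
      finally show ?thesis using u(3) by simp
    qed
    then have "antitone_fit a b w g" using e by (intro antitone_fit_append[OF 1 2]) (auto simp: g_def)
    then show ?thesis by blast
  qed
qed

text \<open>The majorant is the piecewise linear interpolation of the cumulative sums of
  \<open>g\<close>. It is a concave majorant because \<open>g\<close> decreases, and the least one
  because its linear pieces are chords between points of the given set.\<close>

lemma least_concave_majorant_eq:
  assumes i: "antitone_fit 0 (length w) (nth w) g" and j: "j < length w" and t: "real j - 1 \<le> t" "t \<le> real j"
  shows "least_concave_majorant (cumsum_points w) t = sum g {..<j} + g j * (t - (real j - 1))"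
proof -
  let ?L = "length w"
  let ?line = "\<lambda>j t. sum g {..<j} + g j * (t - (real j - 1))"
  define H where "H = {-1..real ?L - 1}"
  have tk: "sum_list (take i w) = sum (nth w) {..<i}" if "i \<le> ?L" for i
    using that by (simp add: sum_list_sum_nth atLeast0LessThan min_def)
  have p: "pooled 0 ?L (nth w) g" using i by (simp add: antitone_fit_def)
  have fstP: "fst ` cumsum_points w = (\<lambda>i. real i - 1) ` {..?L}"
    by (force simp: cumsum_points_def image_iff)
  have hull: "convex hull (fst ` cumsum_points w) = H"
  proof
    show "convex hull (fst ` cumsum_points w) \<subseteq> H"
      unfolding fstP H_def by (rule hull_minimal) auto
    have "{-1, real ?L - 1} \<subseteq> fst ` cumsum_points w" unfolding fstP by force
    then have "convex hull {-1, real ?L - 1} \<subseteq> convex hull (fst ` cumsum_points w)" by (rule hull_mono)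
    moreover have "convex hull {-1, real ?L - 1} = H"
      unfolding segment_convex_hull[symmetric] closed_segment_eq_real_ivl H_def using j by auto
    ultimately show "H \<subseteq> convex hull (fst ` cumsum_points w)" by simp
  qed
  have anti: "g y \<le> g x" if "x \<le> y" "y < ?L" for x y
    using that
  proof (induction y rule: dec_induct)
    case (step n) then show ?case using i unfolding antitone_fit_def by fastforce
  qed simp
  have above: "sum g {..<i} \<le> ?line j (real i - 1)" if "j < ?L" "i \<le> ?L" for i j
  proof (cases "j \<le> i")
    case True
    have "sum g {j..<i} \<le> (\<Sum>x\<in>{j..<i}. g j)" using that by (intro sum_mono anti) auto
    moreover have "sum g {..<i} = sum g {..<j} + sum g {j..<i}"
      using sum.atLeastLessThan_concat[of 0 j i g] True by (simp add: atLeast0LessThan)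
    ultimately show ?thesis using True by (simp add: of_nat_diff algebra_simps)
  next
    case False
    have "(\<Sum>x\<in>{i..<j}. g j) \<le> sum g {i..<j}" using that by (intro sum_mono anti) auto
    moreover have "sum g {..<j} = sum g {..<i} + sum g {i..<j}"
      using sum.atLeastLessThan_concat[of 0 i j g] False by (simp add: atLeast0LessThan)
    ultimately show ?thesis using False by (simp add: of_nat_diff algebra_simps)
  qed
  \<comment> \<open>The interpolation as a minimum of affine functions, which makes its concavity
    immediate.\<close>
  define Gh where "Gh t = Min ((\<lambda>j. ?line j t) ` {..<?L})" for t
  have ne: "finite ((\<lambda>j. ?line j t) ` {..<?L})" "(\<lambda>j. ?line j t) ` {..<?L} \<noteq> {}" for t using j by auto
  have Gle: "Gh s \<le> ?line x s" if "x < ?L" for x s unfolding Gh_def using that ne[of s] by (intro Min_le) auto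
  have conc: "concave_on H Gh"
  proof -
    have "(1 - u) * Gh x + u * Gh y \<le> Gh ((1 - u) * x + u * y)" if "0 \<le> u" "u \<le> 1" for u x y
    proof -
      obtain k where k: "k < ?L" "Gh ((1 - u) * x + u * y) = ?line k ((1 - u) * x + u * y)"
        using Min_in[OF ne, of "(1 - u) * x + u * y"] unfolding Gh_def by auto
      have "(1 - u) * Gh x + u * Gh y \<le> (1 - u) * ?line k x + u * ?line k y"
        using that Gle[OF k(1)] by (intro add_mono mult_left_mono) auto
      also have "\<dots> = ?line k ((1 - u) * x + u * y)" by (simp add: algebra_simps)
      finally show ?thesis using k by simp
    qed
    then have "Gh (u * x + v * y) \<ge> u * Gh x + v * Gh y" if "0 \<le> u" "0 \<le> v" "u + v = 1" for u v x y
    proof -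
      have "u = 1 - v" "v \<le> 1" using that by auto
      with \<open>\<And>x y u. 0 \<le> u \<Longrightarrow> u \<le> 1 \<Longrightarrow> (1 - u) * Gh x + u * Gh y \<le> Gh ((1 - u) * x + u * y)\<close> that(2)
      show ?thesis by blast
    qed
    then show ?thesis unfolding concave_on_iff by (auto simp: H_def)
  qed
  have maj: "\<forall>(x, y)\<in>cumsum_points w. y \<le> Gh x"
  proof -
    have "sum_list (take i w) \<le> Gh (real i - 1)" if "i \<le> ?L" for i
    proof -
      obtain k where k: "k < ?L" "Gh (real i - 1) = ?line k (real i - 1)"
        using Min_in[OF ne, of "real i - 1"] unfolding Gh_def by auto
      then show ?thesis using above[of k i] pooledD(2)[OF p, of i] that
        by (simp add: tk atLeast0LessThan)
    qed
    then show ?thesis by (auto simp: cumsum_points_def)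
  qed
  have tH: "t \<in> H" using t j by (auto simp: H_def)
  \<comment> \<open>On the group around \<open>j\<close> the line is the chord between the two
    contacts \<open>l\<close> and \<open>u\<close>, where \<open>h\<close> lies above it; concavity
    of \<open>h\<close> does the rest.\<close>
  have lower: "?line j t \<le> h t"
    if h: "concave_on H h" "\<forall>(x, y)\<in>cumsum_points w. y \<le> h x" for h
  proof -
    obtain l u where lu: "0 \<le> l" "l \<le> j" "j < u" "u \<le> ?L" "sum (nth w) {..<l} = sum g {..<l}"
      "sum (nth w) {..<u} = sum g {..<u}" and glu: "\<And>x. l \<le> x \<Longrightarrow> x < u \<Longrightarrow> g x = g j"
      by (rule pooled_group[OF p le0 j, unfolded atLeast0LessThan], rule that)
    have hh: "sum (nth w) {..<i} \<le> h (real i - 1)" if "i \<le> ?L" for i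
    proof -
      have "(real i - 1, sum_list (take i w)) \<in> cumsum_points w"
        using that by (auto simp: cumsum_points_def)
      then show ?thesis using h(2) tk[OF that] by auto
    qed
    have sl: "sum g {..<i} = sum g {..<l} + g j * (real i - real l)" if "l \<le> i" "i \<le> u" for i
    proof -
      have "sum g {l..<i} = (\<Sum>x\<in>{l..<i}. g j)" using lu that by (intro sum.cong refl glu) auto
      moreover have "sum g {..<i} = sum g {..<l} + sum g {l..<i}"
        using sum.atLeastLessThan_concat[of 0 l i g] that by (simp add: atLeast0LessThan)
      ultimately show ?thesis using that by (simp add: of_nat_diff)
    qed
    define v where "v = (t - (real l - 1)) / (real u - real l)"
    have ul: "real u - real l > 0" using lu by simp
    have v: "0 \<le> v" "v \<le> 1" using t lu ul by (auto simp: v_def field_simps)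
    have tv: "v * (real u - real l) = t - (real l - 1)" using ul by (simp add: v_def)
    have teq: "t = (1 - v) * (real l - 1) + v * (real u - 1)"
      using tv by (simp add: algebra_simps)
    have "?line j t = sum g {..<l} + g j * (t - (real l - 1))"
      using sl[of j] lu by (simp add: algebra_simps)
    also have "\<dots> = sum g {..<l} + g j * (v * (real u - real l))"
      by (simp only: tv)
    also have "\<dots> = (1 - v) * sum g {..<l} + v * sum g {..<u}"
    proof -
      have su: "sum g {..<u} = sum g {..<l} + g j * (real u - real l)" using sl[of u] lu by simp
      show ?thesis unfolding su by (simp add: algebra_simps)
    qed
    also have "\<dots> \<le> (1 - v) * h (real l - 1) + v * h (real u - 1)"
      using hh[of l] hh[of u] lu v by (intro add_mono mult_left_mono) auto
    also have "\<dots> \<le> h ((1 - v) * (real l - 1) + v * (real u - 1))"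
    proof -
      have "real l - 1 \<in> H" "real u - 1 \<in> H" using lu by (auto simp: H_def)
      moreover have "0 \<le> 1 - v" "1 - v + v = 1" using v by auto
      ultimately show ?thesis using h(1) v(1) unfolding concave_on_iff real_scaleR_def by blast
    qed
    finally show ?thesis using teq by simp
  qed
  have "Gh t = ?line j t" using lower[OF conc maj] Gle[OF j, of t] by simp
  then show ?thesis
    unfolding least_concave_majorant_def hull
  proof (intro cInf_eq_minimum)
    show "?line j t \<in> {h t |h. concave_on H h \<and> (\<forall>(x, y)\<in>cumsum_points w. y \<le> h x)}"
      using \<open>Gh t = ?line j t\<close> conc maj by (intro CollectI exI[of _ Gh]) simp
    show "?line j t \<le> s" if "s \<in> {h t |h. concave_on H h \<and> (\<forall>(x, y)\<in>cumsum_points w. y \<le> h x)}" for s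
      using that lower by blast
  qed
qed

lemma gren_eq:
  assumes i: "antitone_fit 0 (length w) (nth w) g"
  shows "gren w = map g [0..<length w]"
proof -
  have "vector_derivative (least_concave_majorant (cumsum_points w)) (at_left (real j)) = g j"
    if j: "j < length w" for j
  proof -
    let ?line = "\<lambda>t. sum g {..<j} + g j * (t - (real j - 1))"
    have "(?line has_real_derivative g j) (at (real j) within {..real j})"
      by (auto intro!: derivative_eq_intros)
    then have "(?line has_vector_derivative g j) (at (real j) within {..real j})"
      by (simp add: has_real_derivative_iff_has_vector_derivative)
    \<comment> \<open>The majorant is known to be affine with slope \<open>g j\<close> on
      \<open>[j - 1, j]\<close> only, hence the one-sided derivative and the radius 1.\<close>
    then have "(least_concave_majorant (cumsum_points w) has_vector_derivative g j) (at (real j) within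
        {..real j})"
      by (rule has_vector_derivative_transform_within[where d = 1])
        (auto simp: least_concave_majorant_eq[OF i j] dist_real_def)
    then have "(least_concave_majorant (cumsum_points w) has_vector_derivative g j) (at_left (real j))"
      by (rule has_vector_derivative_within_subset) auto
    then show ?thesis
      by (intro vector_derivative_within) auto
  qed
  then show ?thesis by (auto simp: gren_def)
qed

section \<open>Intervals of constancy\<close>

lemma antitone_fit_shift:
  assumes "antitone_fit r b w g" "r \<le> b"
  shows "antitone_fit 0 (b - r) (\<lambda>i. w (i + r)) (\<lambda>i. g (i + r))"
proof -
  have s: "(\<Sum>i\<in>{0..<j}. f (i + r)) = sum f {r..<j + r}" for f :: "nat \<Rightarrow> real" and j
    using sum.shift_bounds_nat_ivl[of f 0 r j] by simp
  have p: "pooled r b w g" and d: "\<And>j. r < j \<Longrightarrow> j < b \<Longrightarrow> g j \<le> g (j - 1)"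
    using assms(1) by (auto simp: antitone_fit_def)
  show ?thesis unfolding antitone_fit_def pooled_def s
  proof (intro conjI allI impI)
    show "sum w {r..<b - r + r} = sum g {r..<b - r + r}" using pooledD(1)[OF p] assms by simp
    fix j assume j: "0 < j \<and> j < b - r"
    have jr: "j - 1 + r = j + r - 1" using j by simp
    show "sum w {r..<j + r} \<le> sum g {r..<j + r}" using pooledD(2)[OF p, of "j + r"] j by (simp add:
        less_diff_conv)
    show "g (j + r) \<le> g (j - 1 + r)" using d[of "j + r"] j unfolding jr by (simp add: less_diff_conv)
    show "g (j + r) = g (j - 1 + r)" if "sum w {r..<j + r} \<noteq> sum g {r..<j + r}"
      using pooledD(3)[OF p, of "j + r"] j that unfolding jr by (simp add: less_diff_conv)
  qed
qed

lemma summable_pmf_nat: "summable (pmf (p :: nat pmf))"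
proof (rule summableI_nonneg_bounded)
  show "sum (pmf p) {..<n} \<le> 1" for n
    by (simp add: measure_measure_pmf_finite[symmetric])
qed simp

lemma pmf_tendsto_zero: "pmf (p :: nat pmf) \<longlonglongrightarrow> 0"
  using summable_pmf_nat by (rule summable_LIMSEQ_zero)

text \<open>For decreasing \<open>p\<close> a cut starts an interval of constancy, so
  \<open>{..<m}\<close> is a union of complete intervals on which \<open>p\<close> is
  positive.\<close>

definition cut :: "nat pmf \<Rightarrow> nat \<Rightarrow> bool" where
  "cut p m \<longleftrightarrow> m = 0 \<or> pmf p m < pmf p (m - 1)"

text \<open>Where \<open>p\<close> vanishes the limit process is left unchanged, so every index there also separates.\<close>

definition weak_cut :: "nat pmf \<Rightarrow> nat \<Rightarrow> bool" where
  "weak_cut p m \<longleftrightarrow> cut p m \<or> pmf p m = 0"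

lemma flat_blockD:
  assumes "flat_block p r s"
  shows "r < s" "cut p r" "pmf p (s + 1) < pmf p s"
  using assms unfolding flat_block_def cut_def by blast+

lemma flat_block_const:
  assumes f: "flat_block p r s" and xy: "x \<in> {r..s}" "y \<in> {r..s}"
  shows "pmf p x = pmf p y"
proof -
  from f have c: "\<forall>x\<in>{r..s}. pmf p x = pmf p r" unfolding flat_block_def by blast
  show ?thesis using bspec[OF c xy(1)] bspec[OF c xy(2)] by (rule trans[OF _ sym])
qed

lemma flat_blockI:
  assumes "r < s" "cut p r" "pmf p (s + 1) < pmf p s" "\<And>x. r \<le> x \<Longrightarrow> x \<le> s \<Longrightarrow> pmf p x = pmf p r"
  shows "flat_block p r s"
  unfolding flat_block_def
proof (intro conjI ballI)
  show "r = 0 \<or> pmf p r < pmf p (r - 1)" using assms(2) by (simp only: cut_def)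
  show "pmf p x = pmf p r" if "x \<in> {r..s}" for x using assms(4)[of x] that by simp
qed (use assms(1,3) in auto)

lemma flat_block_unique:
  assumes "flat_block p r s" "x \<in> {r..s}" "flat_block p r' s'" "x \<in> {r'..s'}"
  shows "r = r' \<and> s = s'"
proof -
  have 1: "\<not> r1 < r2" if "flat_block p r1 s1" "x \<in> {r1..s1}" "flat_block p r2 s2" "x \<in> {r2..s2}" for r1 s1 r2 s2
  proof
    assume "r1 < r2"
    then have "r2 - 1 \<in> {r1..s1}" "r2 \<in> {r1..s1}" using that by auto
    then have "pmf p (r2 - 1) = pmf p r2" by (rule flat_block_const[OF that(1)])
    then show False using flat_blockD(2)[OF that(3)] \<open>r1 < r2\<close> by (simp add: cut_def)
  qed
  have 2: "\<not> s1 < s2" if "flat_block p r1 s1" "x \<in> {r1..s1}" "flat_block p r2 s2" "x \<in> {r2..s2}" for r1 s1 r2 s2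
  proof
    assume "s1 < s2"
    then have "s1 + 1 \<in> {r2..s2}" "s1 \<in> {r2..s2}" using that by auto
    then have "pmf p (s1 + 1) = pmf p s1" by (rule flat_block_const[OF that(3)])
    then show False using flat_blockD(3)[OF that(1)] by simp
  qed
  show ?thesis
    using 1[OF assms] 1[OF assms(3,4,1,2)] 2[OF assms] 2[OF assms(3,4,1,2)] by simp
qed

lemma grenander_process_single:
  assumes "\<And>r s. flat_block p r s \<Longrightarrow> x \<notin> {r..s}"
  shows "grenander_process p y x = y x"
  using assms by (auto simp: grenander_process_def)

text \<open>Uniqueness of the block resolves the \<open>THE\<close>, and \<open>gren_eq\<close>
  applies to an antitone fit of the block shifted to start at 0. All later arguments use this
  description.\<close>

lemma grenander_process_block:
  assumes f: "flat_block p r s"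
  shows "antitone_fit r (Suc s) y (grenander_process p y)"
proof -
  obtain g where g: "antitone_fit r (Suc s) y g" using antitone_fit_exists by blast
  have rs: "r \<le> Suc s" using flat_blockD(1)[OF f] by simp
  let ?w = "map y [r..<Suc s]"
  have "antitone_fit 0 (length ?w) (nth ?w) (\<lambda>i. g (i + r))"
    using antitone_fit_shift[OF g rs] by (subst antitone_fit_cong[where w' = "\<lambda>i. y (i + r)" and g' =
        "\<lambda>i. g (i + r)"])
      (auto simp: add.commute simp del: upt_Suc)
  then have gr: "gren ?w = map (\<lambda>i. g (i + r)) [0..<length ?w]" by (rule gren_eq)
  have "grenander_process p y x = g x" if x: "r \<le> x" "x < Suc s" for x
  proof -
    have ex: "\<exists>r s. flat_block p r s \<and> x \<in> {r..s}" using f x by (intro exI[of _ r] exI[of _ s]) auto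
    have th: "(THE (r, s). flat_block p r s \<and> x \<in> {r..s}) = (r, s)"
    proof (rule the_equality)
      show "case (r, s) of (r, s) \<Rightarrow> flat_block p r s \<and> x \<in> {r..s}" using f x by simp
      show "z = (r, s)" if "case z of (r, s) \<Rightarrow> flat_block p r s \<and> x \<in> {r..s}" for z
      proof -
        obtain a b where z: "z = (a, b)" by (cases z)
        with that have "flat_block p a b" "x \<in> {a..b}" by auto
        from flat_block_unique[OF this f] x z show ?thesis by auto
      qed
    qed
    have "x - r < Suc s - r" using x by (simp add: diff_less_mono)
    then show ?thesis unfolding grenander_process_def th using ex gr x by (simp add: nth_map_upt del: upt_Suc)
  qed
  then show ?thesis using g by (subst antitone_fit_cong[where w' = y and g' = g]) auto
qed

section \<open>Cuts and the limit map for a decreasing mass function\<close>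

locale decreasing_pmf =
  fixes p :: "nat pmf"
  assumes dec: "decseq (pmf p)"
begin

abbreviation "gp \<equiv> grenander_process p"

lemma antimono: "x \<le> y \<Longrightarrow> pmf p y \<le> pmf p x"
  using dec by (rule decseqD)

lemma eq_between: "pmf p a = pmf p b \<Longrightarrow> a \<le> x \<Longrightarrow> x \<le> b \<Longrightarrow> pmf p x = pmf p a"
  using antimono[of a x] antimono[of x b] by simp

lemma flat_block_pos: "flat_block p r s \<Longrightarrow> x \<in> {r..s} \<Longrightarrow> pmf p x > 0"
  using flat_block_const[of p r s x s] le_less_trans[OF pmf_nonneg flat_blockD(3)[of p r s]]
    flat_blockD(1)[of p r s] by auto

lemma block_start:
  obtains r where "r \<le> x" "pmf p r = pmf p x" "cut p r"
proof -
  define r where "r = (LEAST r. pmf p r = pmf p x)"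
  have r: "pmf p r = pmf p x" "r \<le> x" unfolding r_def by (auto intro: LeastI Least_le)
  have "pmf p (r - 1) \<noteq> pmf p x" if "0 < r"
    using not_less_Least[of "r - 1" "\<lambda>r. pmf p r = pmf p x"] that by (auto simp: r_def)
  then have "cut p r" using antimono[of "r - 1" r] r by (force simp: cut_def)
  with r that show ?thesis by blast
qed

lemma block_end:
  assumes "pmf p x > 0"
  obtains s where "x \<le> s" "pmf p s = pmf p x" "pmf p (s + 1) < pmf p s"
proof -
  have "\<exists>k. pmf p k < pmf p x"
    using order_tendstoD(2)[OF pmf_tendsto_zero[of p] assms] by (auto simp: eventually_sequentially)
  define k where "k = (LEAST k. pmf p k < pmf p x)"
  have k: "pmf p k < pmf p x" unfolding k_def using \<open>\<exists>k. _\<close> by (rule LeastI_ex)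
  have "x < k" using antimono[of k x] k by (meson leI not_less)
  moreover have "\<not> pmf p (k - 1) < pmf p x"
    using not_less_Least[of "k - 1" "\<lambda>k. pmf p k < pmf p x"] \<open>x < k\<close> by (auto simp: k_def)
  ultimately show ?thesis using that[of "k - 1"] antimono[of x "k - 1"] k by auto
qed

lemma cut_pos: "cut p m \<Longrightarrow> j < m \<Longrightarrow> pmf p j > 0"
  using antimono[of j "m - 1"] pmf_nonneg[of p m] unfolding cut_def by linarith

lemma weak_cut_imp_cut: "weak_cut p j \<Longrightarrow> cut p m \<Longrightarrow> j \<le> m \<Longrightarrow> cut p j"
  using cut_pos[of m j] by (cases "j = m") (auto simp: weak_cut_def)

lemma not_weak_cut: "\<not> weak_cut p j \<Longrightarrow> 0 < j \<and> pmf p j = pmf p (j - 1) \<and> pmf p j > 0"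
proof -
  assume "\<not> weak_cut p j"
  then have j: "j \<noteq> 0" "\<not> pmf p j < pmf p (j - 1)" "pmf p j \<noteq> 0" by (auto simp: weak_cut_def cut_def)
  moreover have "pmf p j \<le> pmf p (j - 1)" by (rule antimono) simp
  moreover have "0 \<le> pmf p j" by simp
  ultimately show ?thesis by linarith
qed

text \<open>Peels off the last piece below a separator, either an interval of constancy or a single
  index where \<open>p\<close> vanishes, and so drives inductions over pieces. The implication for
  \<open>cut\<close> serves inductions that stay inside the support.\<close>

lemma previous_cut:
  assumes m: "weak_cut p m" "0 < m"
  obtains r where "r < m" "weak_cut p r" "cut p m \<Longrightarrow> cut p r"
    "\<And>x. r \<le> x \<Longrightarrow> x < m \<Longrightarrow> pmf p x = pmf p r"
    "antitone_fit r m y (gp y)" "\<And>j. r < j \<Longrightarrow> j < m \<Longrightarrow> \<not> weak_cut p j"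
proof (cases "pmf p (m - 1) = 0")
  case True
  have "gp y (m - 1) = y (m - 1)"
    using flat_block_pos[of _ _ "m - 1"] True by (intro grenander_process_single) force
  then have i: "antitone_fit (m - 1) m y (gp y)" using m by (cases m) (auto simp: antitone_fit_def pooled_def)
  have nc: "\<not> cut p m" using m True pmf_nonneg[of p m] unfolding cut_def by linarith
  have x: "x = m - 1" if "m - 1 \<le> x" "x < m" for x using that by simp
  show ?thesis
  proof (rule that[OF _ _ _ _ i])
    show "m - 1 < m" using m by simp
    show "weak_cut p (m - 1)" using True by (simp add: weak_cut_def)
    show "pmf p y = pmf p (m - 1)" if "m - 1 \<le> y" "y < m" for y using x[OF that] by simp
    show "\<not> weak_cut p j" if "m - 1 < j" "j < m" for j using that by simp
  qed (use nc in blast)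
next
  case False
  then have pos: "pmf p (m - 1) > 0" using pmf_nonneg[of p "m - 1"] by (simp add: less_le)
  with m have lt: "pmf p m < pmf p (m - 1)" by (auto simp: weak_cut_def cut_def)
  obtain r where r: "r \<le> m - 1" "pmf p r = pmf p (m - 1)" "cut p r" by (rule block_start)
  have const: "pmf p x = pmf p r" if "r \<le> x" "x < m" for x
    using eq_between[OF r(2), of x] that by simp
  have "antitone_fit r m y (gp y)"
  proof (cases "r = m - 1")
    case True
    \<comment> \<open>A one-point interval of constancy lies in no flat block: a block reaching
      \<open>m\<close> contradicts the drop there, and one starting earlier contradicts the drop at
      \<open>r = m - 1\<close>.\<close>
    have "m - 1 \<notin> {r'..s'}" if f: "flat_block p r' s'" for r' s'
    proof
      assume x: "m - 1 \<in> {r'..s'}"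
      show False
      proof (cases "m \<le> s'")
        case True
        then have "pmf p m = pmf p (m - 1)"
          using flat_block_const[OF f, of m "m - 1"] x by auto
        then show False using lt by simp
      next
        case False
        then have "s' = m - 1" "r' < m - 1" using x flat_blockD(1)[OF f] by auto
        moreover from this have "m - 1 - 1 \<in> {r'..s'}" by auto
        ultimately have "pmf p (m - 1 - 1) = pmf p (m - 1)" using flat_block_const[OF f] x by blast
        then show False using r(3) True \<open>r' < m - 1\<close> by (auto simp: cut_def)
      qed
    qed
    then have "gp y (m - 1) = y (m - 1)" by (rule grenander_process_single)
    with True m show ?thesis by (cases m) (auto simp: antitone_fit_def pooled_def)
  next
    case False
    then have "flat_block p r (m - 1)"
      using r lt m by (intro flat_blockI const) auto
    then show ?thesis using grenander_process_block[of p r "m - 1" y] m by simp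
  qed
  moreover have "\<not> weak_cut p j" if "r < j" "j < m" for j
    using const[of j] const[of "j - 1"] that r(2) pos unfolding weak_cut_def cut_def by linarith
  moreover have "r < m" using r(1) m by simp
  moreover have "weak_cut p r" using r(3) by (simp add: weak_cut_def)
  ultimately show ?thesis using const r(3) by (intro that)
qed

text \<open>Only \<open>pooled\<close> can be claimed: at a separator the fits of the neighbouring
  pieces are unrelated, so \<open>gp y\<close> may rise there.\<close>

lemma gp_pooled:
  assumes "weak_cut p a" "weak_cut p b" "a \<le> b"
  shows "pooled a b y (gp y)"
  using assms(2,3)
proof (induction b rule: less_induct)
  case (less b)
  show ?case
  proof (cases "a = b")
    case False
    then have b: "0 < b" using less by simp
    obtain r where r: "r < b" "weak_cut p r" "antitone_fit r b y (gp y)" "\<And>j. r < j \<Longrightarrow> j < b \<Longrightarrow> \<not> weak_cut p j"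
      by (rule previous_cut[OF less(2) b, where y = y]) blast
    have "a \<le> r" using r(4)[of a] assms(1) False less.prems by (meson leI le_neq_implies_less)
    with less.IH[OF r(1,2)] r show ?thesis
      by (intro pooled_append[of a r _ _ b]) (auto simp: antitone_fit_def)
  qed (auto simp: pooled_def)
qed

lemma gp_decreasing:
  assumes "\<not> weak_cut p j"
  shows "gp y j \<le> gp y (j - 1)"
proof -
  from not_weak_cut[OF assms] have j: "0 < j" "pmf p j = pmf p (j - 1)" "pmf p j > 0" by auto
  obtain r where r: "r \<le> j - 1" "pmf p r = pmf p (j - 1)" "cut p r" by (rule block_start)
  obtain s where s: "j \<le> s" "pmf p s = pmf p j" "pmf p (s + 1) < pmf p s" by (rule block_end[OF j(3)])
  have "pmf p r = pmf p s" using r(2) s(2) j(2) by simp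
  then have "pmf p x = pmf p r" if "r \<le> x" "x \<le> s" for x
    using eq_between that by blast
  moreover have rs: "r < s" "r < j" "j < Suc s" using r(1) s(1) j(1) by auto
  ultimately have "flat_block p r s" using r(3) s(3) by (intro flat_blockI)
  from grenander_process_block[OF this, of y] show ?thesis using rs by (simp add: antitone_fit_def)
qed

text \<open>Cumulative sums of \<open>y\<close> and \<open>gp y\<close> differ only at indices that
  do not separate, and there \<open>gp\<close> of every sequence decreases. This is what
  \<open>pooled_lipschitz\<close> asks for.\<close>

lemma gp_lipschitz:
  assumes m: "weak_cut p m" "x < m"
  shows "\<bar>gp y x - gp y' x\<bar> \<le> (\<Sum>z<m. \<bar>y z - y' z\<bar>)"
proof -
  have z: "weak_cut p 0" by (simp add: weak_cut_def cut_def)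
  have nw: "\<not> weak_cut p j" if "sum y {0..<j} \<noteq> sum (gp y) {0..<j}" for j y
    using gp_pooled[OF z, of j y] that pooledD(1) by blast
  show ?thesis unfolding atLeast0LessThan[symmetric]
    by (rule pooled_lipschitz[OF gp_pooled[OF z m(1)] gp_pooled[OF z m(1)]])
      (use nw gp_decreasing m in auto)
qed

text \<open>Strict cuts end with a finite support; weak ones do not, so an infinite tail can always
  be exhausted by intervals ending at a separator.\<close>

lemma weak_cut_unbounded: "\<exists>m\<ge>n. weak_cut p m"
proof (cases "pmf p n = 0")
  case False
  then have "pmf p n > 0" using pmf_nonneg[of p n] by (simp add: less_le)
  then obtain s where "n \<le> s" "pmf p s = pmf p n" "pmf p (s + 1) < pmf p s" by (rule block_end)
  then show ?thesis by (intro exI[of _ "s + 1"]) (auto simp: weak_cut_def cut_def)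
qed (auto simp: weak_cut_def)

text \<open>A strict cut beyond any index exists while \<open>p\<close> is positive. If
  \<open>p\<close> vanishes from some point on, the last cut has tail exactly zero, because
  \<open>q\<close> vanishes where \<open>p\<close> does.\<close>

lemma cut_tail:
  assumes q: "summable q" "\<And>x. 0 \<le> q x" "\<And>x. pmf p x = 0 \<Longrightarrow> q x = 0" and "0 < (\<epsilon>::real)"
  obtains m where "cut p m" "(\<Sum>x. q (x + m)) \<le> \<epsilon>"
proof -
  have "(\<lambda>m. \<Sum>x. q (x + m)) \<longlonglongrightarrow> 0"
    using suminf_exist_split2[OF q(1)] .
  then have "\<forall>\<^sub>F m in sequentially. (\<Sum>x. q (x + m)) < \<epsilon>" using assms(4) by (rule order_tendstoD)
  then obtain M where M: "\<And>m. M \<le> m \<Longrightarrow> (\<Sum>x. q (x + m)) < \<epsilon>" by (auto simp: eventually_sequentially)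
  show ?thesis
  proof (cases "pmf p M > 0")
    case True
    then obtain s where "M \<le> s" "pmf p (s + 1) < pmf p s" by (rule block_end)
    then show ?thesis using M[of "s + 1"] by (intro that[of "s + 1"]) (auto simp: cut_def)
  next
    case False
    then have z: "pmf p M = 0" using pmf_nonneg[of p M] by linarith
    define m where "m = (LEAST m. pmf p m = 0)"
    have m: "pmf p m = 0" unfolding m_def using z by (rule LeastI)
    have "pmf p (m - 1) \<noteq> 0" if "m \<noteq> 0"
      using not_less_Least[of "m - 1" "\<lambda>m. pmf p m = 0"] that unfolding m_def[symmetric] by simp
    then have "cut p m" using m pmf_nonneg[of p "m - 1"] unfolding cut_def by linarith
    moreover have "q (x + m) = 0" for x
      using antimono[of m "x + m"] m pmf_nonneg[of p "x + m"] by (intro q(3)) simp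
    ultimately show ?thesis using assms(4) by (intro that[of m]) auto
  qed
qed

text \<open>A fit is guessed and identified by uniqueness: \<open>p\<close> plus the rescaled
  \<open>gp V\<close> below \<open>m\<close>, an independent fit of the data from \<open>m\<close>
  on. Uniform closeness \<open>d\<close>, with every drop up to \<open>m\<close> at least
  \<open>2 * d\<close>, makes the pieces fit together decreasingly. In the application
  \<open>c\<close> is the square root of the sample size.\<close>

lemma antitone_fit_localizes:
  assumes i: "antitone_fit 0 L e g" and m: "cut p m" "m \<le> L" and c: "c > 0"
    and d: "\<And>x. \<bar>e x - pmf p x\<bar> \<le> d"
    and gap: "\<And>j. 0 < j \<Longrightarrow> j \<le> m \<Longrightarrow> cut p j \<Longrightarrow> 2 * d \<le> pmf p (j - 1) - pmf p j"
  shows "\<And>x. x < m \<Longrightarrow> c * (g x - pmf p x) = gp (\<lambda>x. c * (e x - pmf p x)) x"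
    and "pooled m L e g"
proof -
  define V where "V = (\<lambda>x. c * (e x - pmf p x))"
  obtain g2 where g2: "antitone_fit m L e g2" using antitone_fit_exists by blast
  define h where "h x = (if x < m then pmf p x + gp V x / c else g2 x)" for x
  have z: "weak_cut p 0" "weak_cut p m" using m by (auto simp: weak_cut_def cut_def)
  have pV: "pooled 0 m V (gp V)" using z by (intro gp_pooled) auto
  have bV: "\<bar>gp V x\<bar> \<le> c * d" if "x < m" for x
  proof -
    have "\<bar>V y\<bar> \<le> c * d" for y using d[of y] c by (simp add: V_def abs_mult)
    then have "V y \<le> c * d" "- (c * d) \<le> V y" for y by (auto simp: abs_le_iff intro: minus_le_iff[THEN iffD1])
    then have "gp V x \<le> c * d" "- (c * d) \<le> gp V x"
      using pooled_bounds[OF pV, of x] that by blast+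
    then show ?thesis by auto
  qed
  have bh: "pmf p x - d \<le> h x" "h x \<le> pmf p x + d" if "x < m" for x
    using bV[OF that] c that by (auto simp: h_def abs_le_iff field_simps)
  have se: "sum e {0..<j} = sum (pmf p) {0..<j} + sum V {0..<j} / c" for j
    using c by (simp add: V_def sum_divide_distrib sum.distrib[symmetric])
  have sh: "sum h {0..<j} = sum (pmf p) {0..<j} + sum (gp V) {0..<j} / c" if "j \<le> m" for j
    using that by (simp add: h_def sum_divide_distrib sum.distrib[symmetric])
  \<comment> \<open>At a separator \<open>p\<close> drops by at least \<open>2 * d\<close> and the
    fitted errors are at most \<open>d\<close> on either side; elsewhere \<open>p\<close> is
    constant and the fit of \<open>V\<close> decreases.\<close>
  have step: "h j \<le> h (j - 1)" if "0 < j" "j < m" for j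
  proof (cases "weak_cut p j")
    case True
    then have "cut p j" using weak_cut_imp_cut[OF _ m(1)] that by simp
    moreover have "j - 1 < m" using that by simp
    ultimately show ?thesis using gap[of j] bh[of j] bh[of "j - 1"] that by linarith
  next
    case False
    from not_weak_cut[OF this] gp_decreasing[OF this, of V] show ?thesis
      using that c by (auto simp: h_def divide_right_mono)
  qed
  have "pooled 0 m e h" unfolding pooled_def
  proof (intro conjI allI impI)
    show "sum e {0..<m} = sum h {0..<m}" using pooledD(1)[OF pV] by (simp add: se sh)
    fix j assume j: "0 < j \<and> j < m"
    show "sum e {0..<j} \<le> sum h {0..<j}" using pooledD(2)[OF pV, of j] j c by (simp add: se sh
        divide_right_mono)
    assume "sum e {0..<j} \<noteq> sum h {0..<j}"
    then have ne: "sum V {0..<j} \<noteq> sum (gp V) {0..<j}" using j by (auto simp: se sh)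
    then have "\<not> weak_cut p j" using gp_pooled[OF z(1), of j V] pooledD(1) by blast
    then show "h j = h (j - 1)" using pooledD(3)[OF pV _ _ ne] j not_weak_cut[of j] by (auto simp: h_def)
  qed
  then have 1: "antitone_fit 0 m e h" using step by (auto simp: antitone_fit_def)
  have 2: "antitone_fit m L e h" using g2 by (subst antitone_fit_cong[where w' = e and g' = g2]) (auto
      simp: h_def)
  have "h m \<le> h (m - 1)" if "0 < m" "m < L"
  proof -
    have "e y \<le> pmf p m + d" if "m \<le> y" for y using d[of y] antimono[OF that] by (auto simp: abs_le_iff)
    then have "h m \<le> pmf p m + d" using 2 that by (intro pooled_bounds(1)[of m L e h]) (auto simp:
        antitone_fit_def)
    then show ?thesis using bh[of "m - 1"] gap[of m] that m by simp
  qed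
  then have h: "antitone_fit 0 L e h" using m by (intro antitone_fit_append[OF 1 2]) auto
  have eq: "g x = h x" if "x < L" for x using antitone_fit_unique[OF i h, of x] that by simp
  show "c * (g x - pmf p x) = gp (\<lambda>x. c * (e x - pmf p x)) x" if "x < m" for x
    using eq[of x] that m c by (simp add: h_def V_def)
  show "pooled m L e g" using 2 eq by (subst pooled_cong[where w' = e and g' = h]) (auto simp: antitone_fit_def)
qed

end

section \<open>Convex domination and the rearrangement\<close>

text \<open>Domination for all convex functions covers the power losses, and via \<open>t \<mapsto> max 0 (\<bar>t\<bar> - c)\<close>
  also the supremum loss.\<close>

definition dominated :: "nat set \<Rightarrow> (nat \<Rightarrow> real) \<Rightarrow> (nat \<Rightarrow> real) \<Rightarrow> bool" where
  "dominated A u v \<longleftrightarrow> (\<forall>\<phi>. convex_on UNIV \<phi> \<longrightarrow> (\<Sum>x\<in>A. \<phi> (u x)) \<le> (\<Sum>x\<in>A. \<phi> (v x)))"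

lemma dominated_cong:
  "(\<And>x. x \<in> A \<Longrightarrow> u x = u' x) \<Longrightarrow> (\<And>x. x \<in> A \<Longrightarrow> v x = v' x) \<Longrightarrow> dominated A u v = dominated A u' v'"
  by (simp add: dominated_def cong: sum.cong)

lemma dominated_scale:
  assumes "dominated A u v"
  shows "dominated A (\<lambda>x. c * u x) (\<lambda>x. c * v x)"
  unfolding dominated_def
proof (intro allI impI)
  fix \<phi> :: "real \<Rightarrow> real" assume \<phi>: "convex_on UNIV \<phi>"
  have "convex_on UNIV (\<lambda>t. \<phi> (c * t))"
  proof (rule convex_onI)
    fix t x y :: real assume t: "0 < t" "t < 1"
    have "c * ((1 - t) *\<^sub>R x + t *\<^sub>R y) = (1 - t) *\<^sub>R (c * x) + t *\<^sub>R (c * y)" by (simp add: algebra_simps)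
    then show "\<phi> (c * ((1 - t) *\<^sub>R x + t *\<^sub>R y)) \<le> (1 - t) * \<phi> (c * x) + t * \<phi> (c * y)"
      using convex_onD[OF \<phi>, of t "c * x" "c * y"] t by simp
  qed simp
  with assms show "(\<Sum>x\<in>A. \<phi> (c * u x)) \<le> (\<Sum>x\<in>A. \<phi> (c * v x))"
    by (auto simp: dominated_def)
qed

lemma pooled_dominated:
  assumes "pooled a b w g" "\<And>j. a < j \<Longrightarrow> j < b \<Longrightarrow> q j \<le> q (j - 1)"
  shows "dominated {a..<b} (\<lambda>x. g x - q x) (\<lambda>x. w x - q x)"
  unfolding dominated_def by (intro allI impI pooled_contract[OF assms(1)] assms(2))

text \<open>The two arguments on the left lie between \<open>b - q'\<close> and \<open>a - q\<close>
  and have the same sum as these two.\<close>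

lemma convex_swap:
  fixes \<phi> :: "real \<Rightarrow> real"
  assumes \<phi>: "convex_on UNIV \<phi>" and "b \<le> a" "q \<le> q'"
  shows "\<phi> (b - q) + \<phi> (a - q') \<le> \<phi> (a - q) + \<phi> (b - q')"
proof (cases "b < a \<or> q < q'")
  case True
  define s where "s = (a - q) - (b - q')"
  have s: "0 < s" using True assms by (auto simp: s_def)
  \<comment> \<open>The weight that represents \<open>b - q\<close> as a convex combination of the
    extreme points; \<open>a - q'\<close> then receives the complementary weight.\<close>
  define t where "t = (a - b) / s"
  have t: "0 \<le> t" "t \<le> 1" using s assms by (auto simp: t_def s_def field_simps)
  have ts: "t * s = a - b" using s by (simp add: t_def)
  have "b - q = (1 - t) *\<^sub>R (a - q) + t *\<^sub>R (b - q')" "a - q' = (1 - (1 - t)) *\<^sub>R (a - q) + (1 - t) *\<^sub>R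
      (b - q')"
    using ts by (simp_all add: s_def algebra_simps)
  then have "\<phi> (b - q) \<le> (1 - t) * \<phi> (a - q) + t * \<phi> (b - q')"
    "\<phi> (a - q') \<le> (1 - (1 - t)) * \<phi> (a - q) + (1 - t) * \<phi> (b - q')"
    using convex_onD[OF \<phi>, of t "a - q" "b - q'"] convex_onD[OF \<phi>, of "1 - t" "a - q" "b - q'"] t by auto
  then show ?thesis by (simp add: algebra_simps)
qed (use assms in auto)

definition mismatch :: "(real \<Rightarrow> real) \<Rightarrow> real list \<Rightarrow> real list \<Rightarrow> real" where
  "mismatch \<phi> ws qs = sum_list (map2 (\<lambda>a b. \<phi> (a - b)) ws qs)"

text \<open>Each step of the insertion resolves one inverted pair, \<open>a > u\<close> standing
  before \<open>u\<close> against \<open>q \<le> q'\<close>, by \<open>convex_swap\<close>.\<close>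

lemma mismatch_insort:
  assumes \<phi>: "convex_on UNIV \<phi>" and "sorted (q # qs)" "length us = length qs"
  shows "mismatch \<phi> (insort a us) (q # qs) \<le> \<phi> (a - q) + mismatch \<phi> us qs"
  using assms(2,3)
proof (induction us arbitrary: q qs)
  case (Cons u us)
  then obtain q' qs' where qs: "qs = q' # qs'" by (cases qs) auto
  show ?case
  proof (cases "a \<le> u")
    case False
    have "mismatch \<phi> (insort a us) (q' # qs') \<le> \<phi> (a - q') + mismatch \<phi> us qs'"
      using Cons qs by auto
    moreover have "\<phi> (u - q) + \<phi> (a - q') \<le> \<phi> (a - q) + \<phi> (u - q')"
      using False Cons(2) qs by (intro convex_swap[OF \<phi>]) auto
    ultimately show ?thesis using False qs by (simp add: mismatch_def)
  qed (simp add: mismatch_def)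
qed (simp add: mismatch_def)

lemma mismatch_sort:
  assumes \<phi>: "convex_on UNIV \<phi>" and "sorted qs" "length ws = length qs"
  shows "mismatch \<phi> (sort ws) qs \<le> mismatch \<phi> ws qs"
  using assms(2,3)
proof (induction ws arbitrary: qs)
  case (Cons w ws)
  then obtain q qs' where qs: "qs = q # qs'" by (cases qs) auto
  have "mismatch \<phi> (insort w (sort ws)) (q # qs') \<le> \<phi> (w - q) + mismatch \<phi> (sort ws) qs'"
    using Cons qs by (intro mismatch_insort[OF \<phi>]) auto
  also have "\<dots> \<le> \<phi> (w - q) + mismatch \<phi> ws qs'" using Cons qs by auto
  finally show ?case by (simp add: qs mismatch_def)
qed simp

lemma mismatch_rev: "length ws = length qs \<Longrightarrow> mismatch \<phi> (rev ws) (rev qs) = mismatch \<phi> ws qs"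
  by (simp add: mismatch_def zip_rev rev_map[symmetric] sum_list_rev)

lemma sort_rev: "sort (rev w) = sort (w :: real list)"
  by (rule properties_for_sort) auto

text \<open>Reversing both lists turns decreasing order into increasing order, where
  \<open>mismatch_sort\<close> applies.\<close>

lemma mismatch_rear:
  assumes \<phi>: "convex_on UNIV \<phi>" and "sorted (rev qs)" "length ws = length qs"
  shows "mismatch \<phi> (rear ws) qs \<le> mismatch \<phi> ws qs"
  using mismatch_sort[OF assms(1,2), of "rev ws"] mismatch_rev[of "rear ws" qs \<phi>] mismatch_rev[of ws qs \<phi>] assms
  by (simp add: sort_rev rear_def)

lemma rear_append:
  assumes "\<And>x y. x \<in> set u \<Longrightarrow> y \<in> set v \<Longrightarrow> y \<le> x"
  shows "rear (u @ v) = rear u @ rear v"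
proof -
  have "sort (u @ v) = sort v @ sort u"
    using assms by (intro properties_for_sort) (auto simp: sorted_append)
  then show ?thesis by (simp add: rear_def)
qed

lemma length_rear [simp]: "length (rear w) = length w" by (simp add: rear_def)

lemma mset_rear [simp]: "mset (rear w) = mset w" by (simp add: rear_def)

lemma rear_replicate [simp]: "rear (replicate n x) = replicate n x"
proof -
  have "sort (replicate n x) = replicate n x" by (intro properties_for_sort) (auto simp: sorted_replicate)
  then show ?thesis by (simp add: rear_def)
qed

section \<open>The estimators as operations on zero-padded vectors\<close>

context
  fixes n :: nat and xs :: "nat \<Rightarrow> nat"
  assumes n: "1 \<le> n"
begin

private abbreviation (input) "e \<equiv> empirical n xs"
private abbreviation (input) "L0 \<equiv> Suc (Max (xs ` {1..n}))"

lemma empirical_eq_0: "L0 \<le> x \<Longrightarrow> e x = 0"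
proof -
  assume x: "L0 \<le> x"
  have "xs i \<noteq> x" if "i \<in> {1..n}" for i
  proof -
    have "xs i \<le> Max (xs ` {1..n})" using that by (intro Max_ge) auto
    then show ?thesis using x by auto
  qed
  then have "{i \<in> {1..n}. xs i = x} = {}" by auto
  then show ?thesis by (simp add: empirical_def)
qed

lemma empirical_nonneg: "0 \<le> e x" by (simp add: empirical_def)

text \<open>The estimators are compared with \<open>p\<close> on arbitrarily long intervals, so the
  vector is extended by zeros. Nonnegative frequencies make the extension harmless: the zeros form
  the lowest level.\<close>

lemma grenander_estimator_antitone_fit:
  assumes "L0 \<le> L"
  shows "antitone_fit 0 L e (grenander_estimator n xs)"
    and "L0 \<le> x \<Longrightarrow> grenander_estimator n xs x = 0"
proof -
  let ?w = "empirical_vector n xs" and ?g = "grenander_estimator n xs"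
  have len: "length ?w = L0" and nth: "\<And>x. x < L0 \<Longrightarrow> ?w ! x = e x"
    by (simp_all add: empirical_vector_def del: upt_Suc)
  obtain g where g: "antitone_fit 0 (length ?w) (nth ?w) g" using antitone_fit_exists by blast
  have gr: "gren ?w = map g [0..<L0]" using gren_eq[OF g] len by simp
  have est: "?g x = (if x < L0 then g x else 0)" for x
    by (simp add: grenander_estimator_def gr nth_default_def del: upt_Suc)
  then show "L0 \<le> x \<Longrightarrow> ?g x = 0" by simp
  have 1: "antitone_fit 0 L0 e ?g"
    using g len nth est by (subst antitone_fit_cong[where w' = "nth ?w" and g' = g]) auto
  have z: "e x = 0" "?g x = 0" if "L0 \<le> x" for x using empirical_eq_0 est that by auto
  have 2: "antitone_fit L0 L e ?g"
    by (subst antitone_fit_cong[where w' = "\<lambda>_. 0" and g' = "\<lambda>_. 0"]) (auto simp: z antitone_fit_def)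
  \<comment> \<open>The last fitted value is nonnegative, so the step down to the appended zeros
    keeps the fit decreasing.\<close>
  have "0 \<le> ?g (L0 - 1)"
    using 1 empirical_nonneg by (intro pooled_bounds(2)[of 0 L0 e ?g]) (auto simp: antitone_fit_def)
  then show "antitone_fit 0 L e ?g" using assms by (intro antitone_fit_append[OF 1 2]) (auto simp: z)
qed

lemma rearrangement_estimator_eq:
  assumes "L0 \<le> L"
  shows "rearrangement_estimator n xs = nth_default 0 (rear (map e [0..<L]))"
proof -
  have "map e [L0..<L] = replicate (L - L0) 0"
    by (rule nth_equalityI) (auto simp: empirical_eq_0 simp del: upt_Suc)
  then have "map e [0..<L] = map e [0..<L0] @ replicate (L - L0) 0"
    using assms upt_add_eq_append[of 0 L0 "L - L0"] by (simp del: upt_Suc)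
  moreover have "rear (map e [0..<L0] @ replicate (L - L0) 0) = rear (map e [0..<L0]) @ replicate (L - L0) 0"
    using empirical_nonneg by (subst rear_append) auto
  ultimately show ?thesis
    by (auto simp: rearrangement_estimator_def empirical_vector_def nth_default_def nth_append
        fun_eq_iff simp del: upt_Suc)
qed

context
  fixes m L :: nat
  assumes L: "L0 \<le> L" "m \<le> L"
    and sep: "\<And>x y. x < m \<Longrightarrow> m \<le> y \<Longrightarrow> e y \<le> e x"
begin

lemma rearrangement_estimator_split:
  shows "x < m \<Longrightarrow> rearrangement_estimator n xs x = rear (map e [0..<m]) ! x"
    and "m \<le> x \<Longrightarrow> x < L \<Longrightarrow> rearrangement_estimator n xs x = rear (map e [m..<L]) ! (x - m)"
proof -
  have "map e [0..<L] = map e [0..<m] @ map e [m..<L]"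
    using L upt_add_eq_append[of 0 m "L - m"] by simp
  then have "rear (map e [0..<L]) = rear (map e [0..<m]) @ rear (map e [m..<L])"
    using sep by (auto intro!: rear_append)
  then have "rearrangement_estimator n xs = nth_default 0 (rear (map e [0..<m]) @ rear (map e [m..<L]))"
    using rearrangement_estimator_eq[OF L(1)] by simp
  then show "x < m \<Longrightarrow> rearrangement_estimator n xs x = rear (map e [0..<m]) ! x"
    and "m \<le> x \<Longrightarrow> x < L \<Longrightarrow> rearrangement_estimator n xs x = rear (map e [m..<L]) ! (x - m)"
    using L by (auto simp: nth_default_def nth_append)
qed

text \<open>If every frequency below \<open>m\<close> is at least every later one, sorting permutes
  the first \<open>m\<close> entries among themselves.\<close>

lemma rearrangement_estimator_sum:
  "(\<Sum>x<m. \<psi> (rearrangement_estimator n xs x)) = (\<Sum>x<m. \<psi> (e x) :: real)"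
proof -
  have "(\<Sum>x<m. \<psi> (rearrangement_estimator n xs x)) = sum_list (map \<psi> (rear (map e [0..<m])))"
    unfolding sum_list_sum_nth atLeast0LessThan
    by (intro sum.cong) (auto simp: rearrangement_estimator_split)
  also have "\<dots> = sum_mset (image_mset \<psi> (mset (rear (map e [0..<m]))))"
    by (metis mset_map sum_mset_sum_list)
  also have "\<dots> = sum_mset (mset (map \<psi> (map e [0..<m])))"
    by (simp add: image_mset.compositionality)
  also have "\<dots> = sum_list (map \<psi> (map e [0..<m]))" by (rule sum_mset_sum_list)
  also have "\<dots> = (\<Sum>x<m. \<psi> (e x))"
    unfolding sum_list_sum_nth atLeast0LessThan by (intro sum.cong) auto
  finally show ?thesis .
qed

lemma rearrangement_estimator_tail:
  assumes q: "\<And>x y. x \<le> y \<Longrightarrow> q y \<le> q x"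
  shows "dominated {m..<L} (\<lambda>x. rearrangement_estimator n xs x - q x) (\<lambda>x. e x - q x)"
  unfolding dominated_def
proof (intro allI impI)
  fix \<phi> :: "real \<Rightarrow> real" assume \<phi>: "convex_on UNIV \<phi>"
  have eq: "(\<Sum>x\<in>{m..<L}. \<phi> (f x - q x)) = mismatch \<phi> ws (map q [m..<L])"
    if "length ws = L - m" "\<And>x. m \<le> x \<Longrightarrow> x < L \<Longrightarrow> f x = ws ! (x - m)" for f ws
  proof -
    have "mismatch \<phi> ws (map q [m..<L]) = (\<Sum>i\<in>{0..<L - m}. \<phi> (f (i + m) - q (i + m)))"
      unfolding mismatch_def sum_list_sum_nth using that
      by (intro sum.cong) (auto simp: add.commute)
    also have "\<dots> = (\<Sum>x\<in>{0 + m..<L - m + m}. \<phi> (f x - q x))"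
      by (rule sum.shift_bounds_nat_ivl[symmetric])
    finally show ?thesis using L by simp
  qed
  have "sorted (rev (map q [m..<L]))"
    unfolding sorted_iff_nth_mono using q by (auto simp: rev_nth)
  then have "mismatch \<phi> (rear (map e [m..<L])) (map q [m..<L]) \<le> mismatch \<phi> (map e [m..<L]) (map q [m..<L])"
    by (intro mismatch_rear[OF \<phi>]) auto
  then show "(\<Sum>x\<in>{m..<L}. \<phi> (rearrangement_estimator n xs x - q x)) \<le> (\<Sum>x\<in>{m..<L}. \<phi> (e x - q x))"
    by (subst (1 2) eq[where ws = "rear (map e [m..<L])"] eq[where ws = "map e [m..<L]"])
      (auto simp: rearrangement_estimator_split)
qed

end

end

context decreasing_pmf
begin

text \<open>Under the gap condition sorting respects every cut up to \<open>m\<close>, so it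
  permutes the frequencies within each interval of constancy, where subtracting \<open>p\<close> is
  subtracting a constant.\<close>

lemma rearrangement_localizes:
  assumes n: "1 \<le> n" and L: "Suc (Max (xs ` {1..n})) \<le> L" and m: "cut p m" "m \<le> L"
    and d: "\<And>x. \<bar>empirical n xs x - pmf p x\<bar> \<le> d"
    and gap: "\<And>j. 0 < j \<Longrightarrow> j \<le> m \<Longrightarrow> cut p j \<Longrightarrow> 2 * d \<le> pmf p (j - 1) - pmf p j"
  shows "(\<Sum>x<m. \<psi> (rearrangement_estimator n xs x - pmf p x)) = (\<Sum>x<m. \<psi> (empirical n xs x - pmf p x) :: real)"
    and "dominated {m..<L} (\<lambda>x. rearrangement_estimator n xs x - pmf p x) (\<lambda>x. empirical n xs x - pmf p x)"
proof -
  let ?e = "empirical n xs" and ?r = "rearrangement_estimator n xs"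
  \<comment> \<open>Left of a cut \<open>j\<close> the frequencies are at least
    \<open>pmf p (j - 1) - d\<close>, from \<open>j\<close> on at most \<open>pmf p j + d\<close>;
    the gap orders these two bounds.\<close>
  have sep: "?e y \<le> ?e x" if j: "cut p j" "j \<le> m" and xy: "x < j" "j \<le> y" for j x y
  proof -
    have "?e y \<le> pmf p j + d" using d[of y] antimono[OF xy(2)] by (auto simp: abs_le_iff)
    also have "\<dots> \<le> pmf p (j - 1) - d" using gap[OF _ j(2,1)] xy by simp
    also have "\<dots> \<le> ?e x"
    proof -
      have "pmf p (j - 1) \<le> pmf p x" using xy(1) by (intro antimono) simp
      moreover have "pmf p x - ?e x \<le> d" using d[of x] by (simp add: abs_le_iff)
      ultimately show ?thesis by linarith
    qed
    finally show ?thesis .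
  qed
  show "dominated {m..<L} (\<lambda>x. ?r x - pmf p x) (\<lambda>x. ?e x - pmf p x)"
    by (rule rearrangement_estimator_tail[OF n L m(2) sep[OF m(1) order_refl] antimono])
  have S: "(\<Sum>x<j. \<psi> (?r x)) = (\<Sum>x<j. \<psi> (?e x) :: real)" if "cut p j" "j \<le> m" for \<psi> j
    using that m by (intro rearrangement_estimator_sum[OF n L _ sep]) auto
  have "j \<le> m \<Longrightarrow> cut p j \<Longrightarrow> (\<Sum>x<j. \<psi> (?r x - pmf p x)) = (\<Sum>x<j. \<psi> (?e x - pmf p x))" for j
  proof (induction j rule: less_induct)
    case (less j)
    show ?case
    proof (cases "j = 0")
      case False
      have wj: "weak_cut p j" "0 < j" using less False by (auto simp: weak_cut_def)
      obtain r where r: "r < j" "cut p r" and c: "\<And>x. r \<le> x \<Longrightarrow> x < j \<Longrightarrow> pmf p x = pmf p r"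
        by (rule previous_cut[OF wj]) (use less.prems in blast)
      have split: "(\<Sum>x<j. f x) = (\<Sum>x<r. f x) + (\<Sum>x\<in>{r..<j}. f x)" for f :: "nat \<Rightarrow> real"
        using sum.atLeastLessThan_concat[of 0 r j f] r by (simp add: atLeast0LessThan)
      have "(\<Sum>x\<in>{r..<j}. \<psi> (?r x - pmf p x)) = (\<Sum>x\<in>{r..<j}. \<psi> (?r x - pmf p r))"
        by (intro sum.cong refl arg_cong[where f = \<psi>] arg_cong2[where f = minus] c) auto
      \<comment> \<open>Difference of the prefix identities at \<open>j\<close> and
        \<open>r\<close>, both for the fixed function that maps \<open>t\<close> to
        \<open>\<psi> (t - pmf p r)\<close>.\<close>
      also have "\<dots> = (\<Sum>x\<in>{r..<j}. \<psi> (?e x - pmf p r))"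
        using S[OF less.prems(2,1), of "\<lambda>t. \<psi> (t - pmf p r)"] S[OF r(2), of "\<lambda>t. \<psi> (t - pmf p r)"]
          r(1) less.prems by (simp add: split)
      also have "\<dots> = (\<Sum>x\<in>{r..<j}. \<psi> (?e x - pmf p x))"
        by (intro sum.cong refl arg_cong[where f = \<psi>] arg_cong2[where f = minus] c[symmetric]) auto
      finally show ?thesis using less.IH[OF r(1) _ r(2)] r(1) less.prems by (simp add: split)
    qed simp
  qed
  with m show "(\<Sum>x<m. \<psi> (?r x - pmf p x)) = (\<Sum>x<m. \<psi> (?e x - pmf p x))" by simp
qed

end

section \<open>Lipschitz functionals and characteristic functions\<close>

text \<open>The bound forces \<open>F\<close> to depend on the first \<open>m\<close> coordinates
  only; functionals of finitely many coordinates thus stay functions of sequences.\<close>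

definition coord_lipschitz :: "nat \<Rightarrow> ((nat \<Rightarrow> real) \<Rightarrow> real) \<Rightarrow> bool" where
  "coord_lipschitz m F \<longleftrightarrow> (\<exists>C\<ge>0. \<forall>u v. \<bar>F u - F v\<bar> \<le> C * (\<Sum>x<m. \<bar>u x - v x\<bar>))"

lemma continuous_on_coordinate [continuous_intros]:
  "continuous_on S (\<lambda>v :: nat \<Rightarrow> real. v x)"
  by (rule continuous_on_subset[OF continuous_on_product_coordinates]) simp

lemma coord_lipschitz_continuous:
  assumes "coord_lipschitz m F"
  shows "continuous_on S F"
  unfolding continuous_on_def
proof (intro ballI)
  fix v assume "v \<in> S"
  from assms obtain C where C: "C \<ge> 0" "\<And>u v. \<bar>F u - F v\<bar> \<le> C * (\<Sum>x<m. \<bar>u x - v x\<bar>)"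
    by (auto simp: coord_lipschitz_def)
  have "((\<lambda>u. C * (\<Sum>x<m. \<bar>u x - v x\<bar>)) \<longlongrightarrow> C * (\<Sum>x<m. \<bar>v x - v x\<bar>)) (at v within S)"
  proof (intro tendsto_intros)
    fix x
    show "((\<lambda>u. u x) \<longlongrightarrow> v x) (at v within S)"
      using continuous_on_coordinate[of S x] \<open>v \<in> S\<close> unfolding continuous_on_def by blast
  qed
  then have "((\<lambda>u. C * (\<Sum>x<m. \<bar>u x - v x\<bar>)) \<longlongrightarrow> 0) (at v within S)" by simp
  then have "((\<lambda>u. F u - F v) \<longlongrightarrow> 0) (at v within S)"
    by (rule Lim_null_comparison[rotated]) (simp add: C)
  then show "(F \<longlongrightarrow> F v) (at v within S)" using Lim_null by blast
qed

lemma borel_measurable_continuous_coords: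
  fixes F :: "(nat \<Rightarrow> real) \<Rightarrow> 'b::topological_space"
  assumes "continuous_on UNIV F" "\<And>x. (\<lambda>\<omega>. U \<omega> x) \<in> borel_measurable M"
  shows "(\<lambda>\<omega>. F (U \<omega>)) \<in> borel_measurable M"
  using borel_measurable_continuous_onI[OF assms(1)] measurable_coordinatewise_then_product[OF assms(2)]
  by (rule measurable_compose[rotated])

lemma tendsto_approx:
  fixes a :: "nat \<Rightarrow> 'a::real_normed_vector"
  assumes "\<And>\<epsilon>. 0 < \<epsilon> \<Longrightarrow> \<exists>b l'. b \<longlonglongrightarrow> l' \<and> (\<forall>n. norm (a n - b n) \<le> \<epsilon>) \<and> norm (l - l') \<le> \<epsilon>"
  shows "a \<longlonglongrightarrow> l"
proof (rule LIMSEQ_I)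
  fix r :: real assume r: "0 < r"
  obtain b l' where b: "b \<longlonglongrightarrow> l'" "\<And>n. norm (a n - b n) \<le> r / 4" "norm (l - l') \<le> r / 4"
    using assms[of "r / 4"] r by auto
  obtain n0 where n0: "\<And>n. n \<ge> n0 \<Longrightarrow> norm (b n - l') < r / 4" using LIMSEQ_D[OF b(1), of "r / 4"] r by auto
  have "norm (a n - l) < r" if "n \<ge> n0" for n
  proof -
    have "norm (a n - l) = norm ((a n - b n) + (b n - l') - (l - l'))" by simp
    also have "\<dots> \<le> norm (a n - b n) + norm (b n - l') + norm (l - l')"
      by (metis norm_triangle_ineq norm_triangle_ineq4 add_right_mono order_trans)
    finally show ?thesis using n0[OF that] b(2)[of n] b(3) r by linarith
  qed
  then show "\<exists>n0. \<forall>n\<ge>n0. norm (a n - l) < r" by blast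
qed

text \<open>Quadratic, in accordance with the second moments that will bound this error in
  mean.\<close>

lemma abs_diff_sin_le: "\<bar>u - sin u\<bar> \<le> 2 * u\<^sup>2" for u :: real
proof (cases "\<bar>u\<bar> \<le> 1")
  case True
  have "\<bar>sin u - (\<Sum>i<3. sin_coeff i * u ^ i)\<bar> \<le> inverse (fact 3) * \<bar>u\<bar> ^ 3" by (rule Maclaurin_sin_bound)
  moreover have "(\<Sum>i<3. sin_coeff i * u ^ i) = u"
    by (simp add: numeral_eq_Suc sin_coeff_def)
  ultimately have "\<bar>u - sin u\<bar> \<le> inverse (fact 3) * \<bar>u\<bar> ^ 3" by (simp add: abs_minus_commute)
  also have "\<dots> \<le> 1 * (\<bar>u\<bar>\<^sup>2 * 1)"
    unfolding power3_eq_cube power2_eq_square using True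
    by (intro mult_mono) (auto simp: fact_numeral)
  finally show ?thesis by (simp add: power2_eq_square)
next
  case False
  have "\<bar>u - sin u\<bar> \<le> \<bar>u\<bar> + \<bar>sin u\<bar>" by (rule abs_triangle_ineq4)
  also have "\<dots> \<le> 2 * \<bar>u\<bar>" using abs_sin_x_le_abs_x[of u] by simp
  also have "\<dots> \<le> 2 * (\<bar>u\<bar> * \<bar>u\<bar>)" using False mult_left_mono[of 1 "\<bar>u\<bar>" "\<bar>u\<bar>"] by simp
  finally show ?thesis by (simp add: power2_eq_square)
qed

text \<open>The function ring for Stone-Weierstrass, generated inductively so that convergence of
  means can be proved by rule induction over it.\<close>

inductive_set poly_ring :: "nat \<Rightarrow> ((nat \<Rightarrow> real) \<Rightarrow> real) set" for m where
  const: "(\<lambda>_. c) \<in> poly_ring m"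
| coord: "x < m \<Longrightarrow> (\<lambda>s. s x) \<in> poly_ring m"
| add: "f \<in> poly_ring m \<Longrightarrow> g \<in> poly_ring m \<Longrightarrow> (\<lambda>s. f s + g s) \<in> poly_ring m"
| mult: "f \<in> poly_ring m \<Longrightarrow> g \<in> poly_ring m \<Longrightarrow> (\<lambda>s. f s * g s) \<in> poly_ring m"

text \<open>Coordinates from \<open>m\<close> on are fixed at 0, so polynomials in the first
  \<open>m\<close> coordinates separate points.\<close>

definition cube :: "nat \<Rightarrow> (nat \<Rightarrow> real) set" where
  "cube m = {s. (\<forall>x<m. s x \<in> {-1..1}) \<and> (\<forall>x\<ge>m. s x = 0)}"

lemma compact_cube: "compact (cube m)"
proof -
  have "compactin (product_topology (\<lambda>_. euclidean) UNIV) (PiE UNIV (\<lambda>x. if x < m then {-1..1} else {0::real}))"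
    unfolding compactin_PiE by auto
  moreover have "PiE UNIV (\<lambda>x. if x < m then {-1..1} else {0::real}) = cube m"
  proof (rule set_eqI)
    fix s :: "nat \<Rightarrow> real"
    have "s \<in> PiE UNIV (\<lambda>x. if x < m then {-1..1} else {0}) \<longleftrightarrow> (\<forall>x. s x \<in> (if x < m then {-1..1} else {0}))"
      by (simp add: PiE_UNIV_domain Pi_iff)
    also have "\<dots> \<longleftrightarrow> s \<in> cube m"
      unfolding cube_def mem_Collect_eq if_split_mem2 by (simp add: all_conj_distrib not_less)
    finally show "s \<in> PiE UNIV (\<lambda>x. if x < m then {-1..1} else {0}) \<longleftrightarrow> s \<in> cube m" .
  qed
  ultimately show ?thesis by (simp add: euclidean_product_topology)
qed

lemma poly_ring_continuous: "f \<in> poly_ring m \<Longrightarrow> continuous_on S f"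
  by (induction rule: poly_ring.induct) (auto intro!: continuous_intros)

lemma poly_ring_dense:
  assumes "continuous_on (cube m) f" "0 < e"
  obtains g where "g \<in> poly_ring m" "\<And>s. s \<in> cube m \<Longrightarrow> \<bar>f s - g s\<bar> < e"
proof -
  interpret function_ring_on "poly_ring m" "cube m"
  proof
    fix x y assume xy: "x \<in> cube m" "y \<in> cube m" "x \<noteq> y"
    then obtain i where i: "x i \<noteq> y i" by auto
    have "i < m"
    proof (rule ccontr)
      assume "\<not> i < m"
      then have "x i = 0" "y i = 0" using xy(1,2) by (auto simp: cube_def)
      with i show False by simp
    qed
    then have "(\<lambda>s. s i) \<in> poly_ring m" by (rule poly_ring.coord)
    then show "\<exists>f\<in>poly_ring m. f x \<noteq> f y" using i by (intro bexI[of _ "\<lambda>s. s i"])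
  qed (fact compact_cube, fact poly_ring_continuous, fact poly_ring.add, fact poly_ring.mult, fact
      poly_ring.const)
  from Stone_Weierstrass_basic[OF assms] obtain g
    where "g \<in> poly_ring m" "\<forall>s\<in>cube m. \<bar>f s - g s\<bar> < e" ..
  then show ?thesis by (intro that) auto
qed

text \<open>A bounded substitute for \<open>v x / T\<close>. The sine is chosen because
  multiplication by it is a combination of two characters.\<close>

definition clip :: "real \<Rightarrow> nat \<Rightarrow> (nat \<Rightarrow> real) \<Rightarrow> nat \<Rightarrow> real" where
  "clip T m v x = (if x < m then sin (v x / T) else 0)"

lemma clip_in_cube: "clip T m v \<in> cube m"
  by (auto simp: clip_def cube_def)

lemma continuous_on_clip: "continuous_on S (\<lambda>v. clip T m v)"
proof (rule continuous_on_coordinatewise_then_product)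
  show "continuous_on S (\<lambda>v. clip T m v x)" for x
    unfolding clip_def divide_inverse by (cases "x < m") (auto intro!: continuous_intros)
qed

lemma iexp_eq_cis: "iexp x = cis x"
  by (simp add: cis_conv_exp)

text \<open>Since \<open>v\<close> and \<open>T sin (v / T)\<close> are close, a Lipschitz function is approximated in mean by
  polynomials in \<open>sin (v\<^sub>x / T)\<close>, i.e. by linear combinations of characters.\<close>

locale characters_converge =
  fixes M :: "nat \<Rightarrow> 'a measure" and U :: "nat \<Rightarrow> 'a \<Rightarrow> nat \<Rightarrow> real"
    and N :: "'b measure" and Y :: "'b \<Rightarrow> nat \<Rightarrow> real" and m :: nat and B :: real
  assumes prob: "\<And>n. prob_space (M n)" "prob_space N"
    and meas: "\<And>n x. (\<lambda>\<omega>. U n \<omega> x) \<in> borel_measurable (M n)" "\<And>x. (\<lambda>\<omega>. Y \<omega> x) \<in> borel_measurable N"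
    and int: "\<And>n x. x < m \<Longrightarrow> integrable (M n) (\<lambda>\<omega>. (U n \<omega> x)\<^sup>2)" "\<And>x. x < m \<Longrightarrow> integrable N (\<lambda>\<omega>. (Y \<omega> x)\<^sup>2)"
    and bound: "\<And>n x. x < m \<Longrightarrow> (\<integral>\<omega>. (U n \<omega> x)\<^sup>2 \<partial>M n) \<le> B" "\<And>x. x < m \<Longrightarrow> (\<integral>\<omega>. (Y \<omega> x)\<^sup>2 \<partial>N) \<le> B"
    and char: "\<And>t. (\<lambda>n. \<integral>\<omega>. iexp (\<Sum>x<m. t x * U n \<omega> x) \<partial>M n) \<longlonglongrightarrow> (\<integral>\<omega>. iexp (\<Sum>x<m. t x * Y \<omega> x) \<partial>N)"
begin

text \<open>The additional character makes the convergence property stable: multiplying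
  \<open>f\<close> by a sine only shifts the frequency \<open>t\<close>. For this reason
  \<open>admissible\<close> quantifies over all \<open>t\<close>.\<close>

definition twisted :: "((nat \<Rightarrow> real) \<Rightarrow> real) \<Rightarrow> (nat \<Rightarrow> real) \<Rightarrow> (nat \<Rightarrow> real) \<Rightarrow> complex" where
  "twisted f t v = of_real (f v) * iexp (\<Sum>x<m. t x * v x)"

definition admissible :: "((nat \<Rightarrow> real) \<Rightarrow> real) \<Rightarrow> bool" where
  "admissible f \<longleftrightarrow> continuous_on UNIV f \<and> (\<exists>C. \<forall>v. \<bar>f v\<bar> \<le> C) \<and>
     (\<forall>t. (\<lambda>n. \<integral>\<omega>. twisted f t (U n \<omega>) \<partial>M n) \<longlonglongrightarrow> (\<integral>\<omega>. twisted f t (Y \<omega>) \<partial>N))"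

lemma admissibleD:
  assumes "admissible f"
  shows "continuous_on UNIV f" "\<exists>C. \<forall>v. \<bar>f v\<bar> \<le> C"
    "(\<lambda>n. \<integral>\<omega>. twisted f t (U n \<omega>) \<partial>M n) \<longlonglongrightarrow> (\<integral>\<omega>. twisted f t (Y \<omega>) \<partial>N)"
  using assms unfolding admissible_def by blast+

lemma admissibleI:
  assumes "continuous_on UNIV f" "\<And>v. \<bar>f v\<bar> \<le> C"
    "\<And>t. (\<lambda>n. \<integral>\<omega>. twisted f t (U n \<omega>) \<partial>M n) \<longlonglongrightarrow> (\<integral>\<omega>. twisted f t (Y \<omega>) \<partial>N)"
  shows "admissible f"
  using assms unfolding admissible_def by blast

lemma twisted_integrable:
  assumes "admissible f"
  shows "integrable (M n) (\<lambda>\<omega>. twisted f t (U n \<omega>))" "integrable N (\<lambda>\<omega>. twisted f t (Y \<omega>))"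
proof -
  from admissibleD(2)[OF assms] obtain C where C: "\<And>v. \<bar>f v\<bar> \<le> C" by blast
  have c: "continuous_on UNIV (twisted f t)"
    unfolding twisted_def by (intro continuous_intros admissibleD(1)[OF assms])
  have n: "norm (twisted f t v) \<le> C" for v
    using C[of v] by (simp add: twisted_def norm_mult iexp_eq_cis)
  interpret M: prob_space "M n" by (rule prob)
  interpret N: prob_space N by (rule prob)
  show "integrable (M n) (\<lambda>\<omega>. twisted f t (U n \<omega>))"
    by (rule M.integrable_const_bound[of _ C]) (auto intro!: borel_measurable_continuous_coords c meas n)
  show "integrable N (\<lambda>\<omega>. twisted f t (Y \<omega>))"
    by (rule N.integrable_const_bound[of _ C]) (auto intro!: borel_measurable_continuous_coords c meas n)
qed

lemma admissible_one: "admissible (\<lambda>_. 1)"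
  by (rule admissibleI[of _ 1]) (use char in \<open>auto simp: twisted_def\<close>)

text \<open>Euler's formula writes the sine as a difference of exponentials over
  \<open>2 * \<i>\<close>, which moves \<open>t x\<close> by \<open>1 / T\<close> up and
  down.\<close>

lemma admissible_clip:
  assumes "x < m" "admissible f"
  shows "admissible (\<lambda>v. f v * clip T m v x)"
proof -
  define s :: "(nat \<Rightarrow> real) \<Rightarrow> nat \<Rightarrow> real" where "s t = t(x := t x + 1 / T)" for t
  define r :: "(nat \<Rightarrow> real) \<Rightarrow> nat \<Rightarrow> real" where "r t = t(x := t x + - (1 / T))" for t
  have sum: "(\<Sum>y<m. (t(x := t x + d)) y * v y) = (\<Sum>y<m. t y * v y) + d * v x" for t :: "nat \<Rightarrow> real" and d v
  proof -
    have "(\<Sum>y<m. (t(x := t x + d)) y * v y) = (\<Sum>y<m. t y * v y + (if y = x then d * v y else 0))"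
      by (intro sum.cong) (auto simp: algebra_simps)
    then show ?thesis using assms(1) by (simp add: sum.distrib)
  qed
  have tw: "twisted (\<lambda>v. f v * clip T m v x) t v = (twisted f (s t) v - twisted f (r t) v) / (2 * \<i>)" for t v
  proof -
    have "twisted f (s t) v = of_real (f v) * iexp (\<Sum>y<m. t y * v y) * iexp (v x / T)"
      unfolding twisted_def s_def sum by (simp add: exp_add[symmetric] algebra_simps)
    moreover have "twisted f (r t) v = of_real (f v) * iexp (\<Sum>y<m. t y * v y) * iexp (- (v x / T))"
      unfolding twisted_def r_def sum by (simp add: exp_add[symmetric] algebra_simps)
    moreover have "iexp u - iexp (- u) = 2 * \<i> * of_real (sin u)" for u
      by (simp only: iexp_eq_cis) (simp add: complex_eq_iff)
    ultimately have "twisted f (s t) v - twisted f (r t) v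
        = of_real (f v) * iexp (\<Sum>y<m. t y * v y) * (2 * \<i> * of_real (sin (v x / T)))"
      by (simp only: right_diff_distrib[symmetric])
    also have "\<dots> = twisted (\<lambda>v. f v * clip T m v x) t v * (2 * \<i>)"
      using assms(1) by (simp add: twisted_def clip_def mult_ac)
    finally show ?thesis by (intro nonzero_eq_divide_eq[THEN iffD2]) (simp, rule sym)
  qed
  have int: "(\<integral>\<omega>. twisted (\<lambda>v. f v * clip T m v x) t (W \<omega>) \<partial>K)
      = ((\<integral>\<omega>. twisted f (s t) (W \<omega>) \<partial>K) - (\<integral>\<omega>. twisted f (r t) (W \<omega>) \<partial>K)) / (2 * \<i>)"
    if "\<And>t. integrable K (\<lambda>\<omega>. twisted f t (W \<omega>))" for t and K :: "'c measure" and W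
    unfolding tw using that by simp
  from admissibleD(2)[OF assms(2)] obtain C where C: "\<And>v. \<bar>f v\<bar> \<le> C" by blast
  show ?thesis
  proof (rule admissibleI)
    show "continuous_on UNIV (\<lambda>v. f v * clip T m v x)"
      by (intro continuous_on_mult admissibleD(1)[OF assms(2)]
          continuous_on_product_then_coordinatewise[OF continuous_on_clip])
    show "\<bar>f v * clip T m v x\<bar> \<le> C" for v
    proof -
      have "\<bar>f v\<bar> * \<bar>clip T m v x\<bar> \<le> C * 1"
        using C[of v] by (intro mult_mono) (auto simp: clip_def)
      then show ?thesis by (simp add: abs_mult)
    qed
    show "(\<lambda>n. \<integral>\<omega>. twisted (\<lambda>v. f v * clip T m v x) t (U n \<omega>) \<partial>M n)
        \<longlonglongrightarrow> (\<integral>\<omega>. twisted (\<lambda>v. f v * clip T m v x) t (Y \<omega>) \<partial>N)" for t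
      unfolding int[OF twisted_integrable(1)[OF assms(2)]] int[OF twisted_integrable(2)[OF assms(2)]]
      by (intro tendsto_divide tendsto_diff tendsto_const admissibleD(3)[OF assms(2)]) simp
  qed
qed

lemma admissible_add:
  assumes "admissible f" "admissible g"
  shows "admissible (\<lambda>v. f v + g v)"
proof -
  have tw: "twisted (\<lambda>v. f v + g v) t v = twisted f t v + twisted g t v" for t v
    by (simp add: twisted_def algebra_simps)
  obtain C D where C: "\<And>v. \<bar>f v\<bar> \<le> C" "\<And>v. \<bar>g v\<bar> \<le> D"
    using admissibleD(2)[OF assms(1)] admissibleD(2)[OF assms(2)] by blast
  show ?thesis
  proof (rule admissibleI)
    show "continuous_on UNIV (\<lambda>v. f v + g v)"
      by (intro continuous_on_add admissibleD(1) assms)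
    show "\<bar>f v + g v\<bar> \<le> C + D" for v by (intro order_trans[OF abs_triangle_ineq] add_mono C)
    show "(\<lambda>n. \<integral>\<omega>. twisted (\<lambda>v. f v + g v) t (U n \<omega>) \<partial>M n)
        \<longlonglongrightarrow> (\<integral>\<omega>. twisted (\<lambda>v. f v + g v) t (Y \<omega>) \<partial>N)" for t
      unfolding tw Bochner_Integration.integral_add[OF twisted_integrable(1)[OF assms(1)]
          twisted_integrable(1)[OF assms(2)]]
        Bochner_Integration.integral_add[OF twisted_integrable(2)[OF assms(1)] twisted_integrable(2)[OF
            assms(2)]]
      by (intro tendsto_add admissibleD(3) assms)
  qed
qed

lemma admissible_const_mult:
  assumes "admissible f"
  shows "admissible (\<lambda>v. f v * c)"
proof -
  have tw: "twisted (\<lambda>v. f v * c) t v = twisted f t v * of_real c" for t v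
    by (simp add: twisted_def algebra_simps)
  obtain C where C: "\<And>v. \<bar>f v\<bar> \<le> C" using admissibleD(2)[OF assms] by blast
  show ?thesis
  proof (rule admissibleI)
    show "continuous_on UNIV (\<lambda>v. f v * c)"
      by (intro continuous_on_mult continuous_on_const admissibleD(1) assms)
    show "\<bar>f v * c\<bar> \<le> C * \<bar>c\<bar>" for v using C[of v] by (simp add: abs_mult mult_right_mono)
    show "(\<lambda>n. \<integral>\<omega>. twisted (\<lambda>v. f v * c) t (U n \<omega>) \<partial>M n)
        \<longlonglongrightarrow> (\<integral>\<omega>. twisted (\<lambda>v. f v * c) t (Y \<omega>) \<partial>N)" for t
      unfolding tw Bochner_Integration.integral_mult_left_zero
      by (intro tendsto_mult tendsto_const admissibleD(3) assms)
  qed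
qed

text \<open>The factor \<open>f\<close> is arbitrary so that a product can be treated by multiplying
  with one polynomial after the other.\<close>

lemma admissible_poly:
  assumes "g \<in> poly_ring m" "admissible f"
  shows "admissible (\<lambda>v. f v * g (clip T m v))"
  using assms
proof (induction arbitrary: f rule: poly_ring.induct)
  case (const c) then show ?case by (rule admissible_const_mult)
next
  case (coord x) then show ?case by (rule admissible_clip)
next
  case (add g h)
  then show ?case using admissible_add[of "\<lambda>v. f v * g (clip T m v)" "\<lambda>v. f v * h (clip T m v)"]
    by (simp add: algebra_simps)
next
  case (mult g h)
  then show ?case using mult.IH(2)[of "\<lambda>v. f v * g (clip T m v)"] by (simp add: algebra_simps)
qed

lemma poly_limit:
  assumes "g \<in> poly_ring m"
  shows "(\<lambda>n. \<integral>\<omega>. g (clip T m (U n \<omega>)) \<partial>M n) \<longlonglongrightarrow> (\<integral>\<omega>. g (clip T m (Y \<omega>)) \<partial>N)"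
proof -
  have "admissible (\<lambda>v. 1 * g (clip T m v))" using assms admissible_one by (rule admissible_poly)
  then have "(\<lambda>n. \<integral>\<omega>. twisted (\<lambda>v. 1 * g (clip T m v)) (\<lambda>_. 0) (U n \<omega>) \<partial>M n)
      \<longlonglongrightarrow> (\<integral>\<omega>. twisted (\<lambda>v. 1 * g (clip T m v)) (\<lambda>_. 0) (Y \<omega>) \<partial>N)"
    by (rule admissibleD(3))
  then show ?thesis by (simp add: twisted_def tendsto_of_real_iff)
qed

lemma square_imp_integrable:
  assumes "prob_space K" "f \<in> borel_measurable K" "integrable K (\<lambda>\<omega>. (f \<omega> :: real)\<^sup>2)"
  shows "integrable K f"
proof -
  interpret prob_space K by fact
  show ?thesis using assms(2,3) by (rule square_integrable_imp_integrable)
qed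

text \<open>Two errors add up: \<open>e\<close> from the polynomial approximation on the cube, and
  the Lipschitz constant times the distance from \<open>v x\<close> to
  \<open>T * sin (v x / T)\<close>, which is at most \<open>2 / T\<close> times the square of
  \<open>v x\<close>.\<close>

lemma mean_close:
  assumes K: "prob_space K" and W: "\<And>x. (\<lambda>\<omega>. W \<omega> x) \<in> borel_measurable K"
    and i: "\<And>x. x < m \<Longrightarrow> integrable K (\<lambda>\<omega>. (W \<omega> x)\<^sup>2)" and b: "\<And>x. x < m \<Longrightarrow> (\<integral>\<omega>. (W \<omega> x)\<^sup>2 \<partial>K) \<le> B"
    and F: "coord_lipschitz m F" "C \<ge> 0" "\<And>u v. \<bar>F u - F v\<bar> \<le> C * (\<Sum>x<m. \<bar>u x - v x\<bar>)"
    and g: "g \<in> poly_ring m" "\<And>s. s \<in> cube m \<Longrightarrow> \<bar>F (\<lambda>x. T * s x) - g s\<bar> < e" and T: "0 < T"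
  shows "norm ((\<integral>\<omega>. F (W \<omega>) \<partial>K) - (\<integral>\<omega>. g (clip T m (W \<omega>)) \<partial>K)) \<le> e + 2 * C * m * B / T"
proof -
  interpret prob_space K by fact
  let ?c = "\<lambda>v. clip T m v"
  have pt: "\<bar>F v - g (?c v)\<bar> \<le> e + 2 * C / T * (\<Sum>x<m. (v x)\<^sup>2)" for v
  proof -
    have "\<bar>F v - F (\<lambda>x. T * ?c v x)\<bar> \<le> C * (\<Sum>x<m. \<bar>v x - T * ?c v x\<bar>)" by (rule F)
    also have "\<dots> \<le> C * (\<Sum>x<m. 2 / T * (v x)\<^sup>2)"
    proof (intro mult_left_mono sum_mono F(2))
      fix x assume "x \<in> {..<m}"
      have "v x - T * ?c v x = T * (v x / T - sin (v x / T))"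
        using T \<open>x \<in> _\<close> by (simp add: clip_def right_diff_distrib)
      then have "\<bar>v x - T * ?c v x\<bar> = T * \<bar>v x / T - sin (v x / T)\<bar>"
        using T by (simp add: abs_mult)
      also have "\<dots> \<le> T * (2 * (v x / T)\<^sup>2)" using T abs_diff_sin_le by (intro mult_left_mono) auto
      also have "\<dots> = 2 / T * (v x)\<^sup>2" using T by (simp add: power2_eq_square)
      finally show "\<bar>v x - T * ?c v x\<bar> \<le> 2 / T * (v x)\<^sup>2" .
    qed
    also have "\<dots> = 2 * C / T * (\<Sum>x<m. (v x)\<^sup>2)" by (simp add: sum_distrib_left mult_ac)
    finally show ?thesis using g(2)[OF clip_in_cube, of T v] by linarith
  qed
  have Fm: "(\<lambda>\<omega>. F (W \<omega>)) \<in> borel_measurable K"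
    by (rule borel_measurable_continuous_coords[OF coord_lipschitz_continuous[OF F(1)] W])
  have gc: "continuous_on UNIV (\<lambda>v. g (?c v))"
    by (rule continuous_on_compose2[OF poly_ring_continuous[OF g(1), of UNIV] continuous_on_clip]) simp
  have gm: "(\<lambda>\<omega>. g (?c (W \<omega>))) \<in> borel_measurable K"
    by (rule borel_measurable_continuous_coords[OF gc W])
  have Fi: "integrable K (\<lambda>\<omega>. F (W \<omega>))"
  proof (rule Bochner_Integration.integrable_bound[OF _ Fm])
    show "integrable K (\<lambda>\<omega>. \<bar>F (\<lambda>_. 0)\<bar> + C * (\<Sum>x<m. \<bar>W \<omega> x\<bar>))"
      by (intro Bochner_Integration.integrable_add integrable_const integrable_mult_right
          Bochner_Integration.integrable_sum integrable_abs square_imp_integrable[OF K W i]) simp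
    have "\<bar>F v\<bar> \<le> \<bar>F (\<lambda>_. 0)\<bar> + C * (\<Sum>x<m. \<bar>v x\<bar>)" for v
      using F(3)[of v "\<lambda>_. 0"] by simp
    then show "AE \<omega> in K. norm (F (W \<omega>)) \<le> norm (\<bar>F (\<lambda>_. 0)\<bar> + C * (\<Sum>x<m. \<bar>W \<omega> x\<bar>))"
      by (intro AE_I2) (simp add: order_trans[OF _ abs_ge_self])
  qed
  have qi: "integrable K (\<lambda>\<omega>. e + 2 * C / T * (\<Sum>x<m. (W \<omega> x)\<^sup>2))"
    by (intro Bochner_Integration.integrable_add integrable_const integrable_mult_right
        Bochner_Integration.integrable_sum i) simp
  have di: "integrable K (\<lambda>\<omega>. F (W \<omega>) - g (?c (W \<omega>)))"
  proof (rule Bochner_Integration.integrable_bound[OF qi])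
    show "(\<lambda>\<omega>. F (W \<omega>) - g (?c (W \<omega>))) \<in> borel_measurable K" using Fm gm by simp
    show "AE \<omega> in K. norm (F (W \<omega>) - g (?c (W \<omega>))) \<le> norm (e + 2 * C / T * (\<Sum>x<m. (W \<omega> x)\<^sup>2))"
      unfolding real_norm_def by (intro AE_I2 order_trans[OF pt abs_ge_self])
  qed
  have gi: "integrable K (\<lambda>\<omega>. g (?c (W \<omega>)))"
    using Bochner_Integration.integrable_diff[OF Fi di] by simp
  have "(\<integral>\<omega>. F (W \<omega>) \<partial>K) - (\<integral>\<omega>. g (?c (W \<omega>)) \<partial>K) = (\<integral>\<omega>. F (W \<omega>) - g (?c (W \<omega>)) \<partial>K)"
    using Fi gi by simp
  moreover have si: "integrable K (\<lambda>\<omega>. \<Sum>x<m. (W \<omega> x)\<^sup>2)"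
    by (intro Bochner_Integration.integrable_sum i) simp
  ultimately have "norm ((\<integral>\<omega>. F (W \<omega>) \<partial>K) - (\<integral>\<omega>. g (?c (W \<omega>)) \<partial>K)) = norm (\<integral>\<omega>. F (W \<omega>) - g (?c (W \<omega>)) \<partial>K)"
    by simp
  also have "\<dots> \<le> (\<integral>\<omega>. e + 2 * C / T * (\<Sum>x<m. (W \<omega> x)\<^sup>2) \<partial>K)"
    by (rule order_trans[OF integral_norm_bound integral_mono[OF integrable_norm[OF di] qi]])
      (unfold real_norm_def, rule pt)
  also have "\<dots> = e + 2 * C / T * (\<Sum>x<m. \<integral>\<omega>. (W \<omega> x)\<^sup>2 \<partial>K)"
  proof -
    have "(\<integral>\<omega>. (\<Sum>x<m. (W \<omega> x)\<^sup>2) \<partial>K) = (\<Sum>x<m. \<integral>\<omega>. (W \<omega> x)\<^sup>2 \<partial>K)"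
      by (intro Bochner_Integration.integral_sum i) simp
    then show ?thesis using si by (simp add: prob_space)
  qed
  also have "\<dots> \<le> e + 2 * C / T * (\<Sum>x<m. B)"
    using b F(2) T by (intro add_left_mono mult_left_mono sum_mono) auto
  finally show ?thesis by (simp add: mult_ac)
qed

theorem lipschitz_limit:
  assumes F: "coord_lipschitz m F"
  shows "(\<lambda>n. \<integral>\<omega>. F (U n \<omega>) \<partial>M n) \<longlonglongrightarrow> (\<integral>\<omega>. F (Y \<omega>) \<partial>N)"
proof (rule tendsto_approx)
  fix \<epsilon> :: real assume \<epsilon>: "0 < \<epsilon>"
  obtain C where C: "C \<ge> 0" "\<And>u v. \<bar>F u - F v\<bar> \<le> C * (\<Sum>x<m. \<bar>u x - v x\<bar>)"
    using F by (auto simp: coord_lipschitz_def)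
  \<comment> \<open>The scale is fixed first, so that the sine error is at most
    \<open>\<epsilon> / 2\<close>; the polynomial is then chosen for this scale. The summand 1 keeps
    \<open>T\<close> positive.\<close>
  define T where "T = 1 + \<bar>2 * C * m * B\<bar> * 2 / \<epsilon>"
  have T: "0 < T" "2 * C * m * B / T \<le> \<epsilon> / 2"
  proof -
    show "0 < T" using \<epsilon> by (auto simp: T_def intro!: add_pos_nonneg)
    moreover have "2 * C * m * B \<le> \<epsilon> / 2 * T"
    proof -
      have "\<epsilon> / 2 * T = \<epsilon> / 2 + \<bar>2 * C * m * B\<bar>" using \<epsilon> by (simp add: T_def distrib_left)
      then show ?thesis using \<epsilon> abs_ge_self[of "2 * C * m * B"] by linarith
    qed
    ultimately show "2 * C * m * B / T \<le> \<epsilon> / 2" by (simp only: pos_divide_le_eq)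
  qed
  have "continuous_on (cube m) (\<lambda>s. F (\<lambda>x. T * s x))"
    by (rule continuous_on_compose2[OF coord_lipschitz_continuous[OF F, of UNIV]])
      (auto intro!: continuous_on_coordinatewise_then_product continuous_intros)
  then obtain g where g: "g \<in> poly_ring m" "\<And>s. s \<in> cube m \<Longrightarrow> \<bar>F (\<lambda>x. T * s x) - g s\<bar> < \<epsilon> / 2"
    using poly_ring_dense[of m _ "\<epsilon> / 2"] \<epsilon> by (metis half_gt_zero)
  show "\<exists>b l'. b \<longlonglongrightarrow> l' \<and> (\<forall>n. norm ((\<integral>\<omega>. F (U n \<omega>) \<partial>M n) - b n) \<le> \<epsilon>) \<and> norm ((\<integral>\<omega>. F (Y \<omega>) \<partial>N) - l') \<le> \<epsilon>"
  proof (intro exI conjI allI)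
    show "(\<lambda>n. \<integral>\<omega>. g (clip T m (U n \<omega>)) \<partial>M n) \<longlonglongrightarrow> (\<integral>\<omega>. g (clip T m (Y \<omega>)) \<partial>N)"
      by (rule poly_limit[OF g(1)])
    show "norm ((\<integral>\<omega>. F (U n \<omega>) \<partial>M n) - (\<integral>\<omega>. g (clip T m (U n \<omega>)) \<partial>M n)) \<le> \<epsilon>" for n
      using mean_close[where K = "M n" and W = "U n", OF prob(1) meas(1) int(1) bound(1) F C g T(1)]
          T(2) by linarith
    show "norm ((\<integral>\<omega>. F (Y \<omega>) \<partial>N) - (\<integral>\<omega>. g (clip T m (Y \<omega>)) \<partial>N)) \<le> \<epsilon>"
      using mean_close[where K = N and W = Y, OF prob(2) meas(2) int(2) bound(2) F C g T(1)] T(2) by linarith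
  qed
qed

end

section \<open>Gaussian variables: second moment and characteristic function\<close>

lemma gaussian_square_integrable:
  assumes "prob_space N" "gaussian_var N Z"
  shows "Z \<in> borel_measurable N" "integrable N (\<lambda>\<omega>. (Z \<omega>)\<^sup>2)"
proof -
  interpret prob_space N by fact
  show Z: "Z \<in> borel_measurable N" using assms by (simp add: gaussian_var_def)
  from assms(2) consider c where "AE \<omega> in N. Z \<omega> = c"
    | \<mu> \<sigma> where "\<sigma> > 0" "distributed N lborel Z (normal_density \<mu> \<sigma>)"
    by (auto simp: gaussian_var_def)
  then show "integrable N (\<lambda>\<omega>. (Z \<omega>)\<^sup>2)"
  proof cases
    case 1
    have "integrable N (\<lambda>\<omega>. c\<^sup>2)" by simp
    then show ?thesis by (rule integrable_cong_AE_imp) (use 1 Z in auto)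
  next
    case 2
    have "integrable lborel (\<lambda>x. normal_density \<mu> \<sigma> x * (x - \<mu>)\<^sup>2)"
      by (rule integrable_normal_moment) fact
    then have sq: "integrable N (\<lambda>\<omega>. (Z \<omega> - \<mu>)\<^sup>2)"
      using distributed_integrable[OF 2(2), of "\<lambda>x. (x - \<mu>)\<^sup>2"] by simp
    have "(\<lambda>\<omega>. Z \<omega> - \<mu>) \<in> borel_measurable N" using Z by simp
    then have "integrable N (\<lambda>\<omega>. Z \<omega> - \<mu>)"
      using sq by (rule square_integrable_imp_integrable)
    with sq have "integrable N (\<lambda>\<omega>. (Z \<omega> - \<mu>)\<^sup>2 + 2 * \<mu> * (Z \<omega> - \<mu>) + \<mu>\<^sup>2)"
      by (intro Bochner_Integration.integrable_add integrable_mult_right integrable_const)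
    moreover have "(\<lambda>\<omega>. (Z \<omega> - \<mu>)\<^sup>2 + 2 * \<mu> * (Z \<omega> - \<mu>) + \<mu>\<^sup>2) = (\<lambda>\<omega>. (Z \<omega>)\<^sup>2)"
      by (simp add: power2_eq_square algebra_simps)
    ultimately show ?thesis by (simp only:)
  qed
qed

lemma gaussian_char:
  assumes "prob_space N" "gaussian_var N Z" "(\<integral>\<omega>. Z \<omega> \<partial>N) = 0"
  shows "(\<integral>\<omega>. iexp (Z \<omega>) \<partial>N) = of_real (exp (- (\<integral>\<omega>. (Z \<omega>)\<^sup>2 \<partial>N) / 2))"
proof -
  interpret prob_space N by fact
  have Z: "Z \<in> borel_measurable N" using assms by (simp add: gaussian_var_def)
  from assms(2) consider c where "AE \<omega> in N. Z \<omega> = c"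
    | \<mu> \<sigma> where "\<sigma> > 0" "distributed N lborel Z (normal_density \<mu> \<sigma>)"
    by (auto simp: gaussian_var_def)
  then show ?thesis
  proof cases
    case 1
    have "(\<integral>\<omega>. Z \<omega> \<partial>N) = (\<integral>\<omega>. c \<partial>N)" using 1 Z by (intro integral_cong_AE) auto
    then have c: "c = 0" using assms(3) by (simp add: prob_space)
    have "(\<integral>\<omega>. iexp (Z \<omega>) \<partial>N) = (\<integral>\<omega>. 1 \<partial>N)" using 1 Z c by (intro integral_cong_AE) auto
    moreover have "(\<integral>\<omega>. (Z \<omega>)\<^sup>2 \<partial>N) = (\<integral>\<omega>. 0 \<partial>N)" using 1 Z c by (intro integral_cong_AE) auto
    ultimately show ?thesis by (simp add: prob_space)
  next
    case 2
    have \<mu>: "\<mu> = 0" using normal_distributed_expectation[OF 2] assms(3) by simp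
    have var: "(\<integral>\<omega>. (Z \<omega>)\<^sup>2 \<partial>N) = \<sigma>\<^sup>2" using normal_distributed_variance[OF 2] assms(3) by simp
    have d: "distributed N lborel (\<lambda>x. Z x / \<sigma>) std_normal_density"
      using normal_standard_normal_convert[OF 2(1), of Z \<mu>] 2(2) \<mu> by simp
    have "distr N lborel (\<lambda>x. Z x / \<sigma>) = std_normal_distribution"
      using distributed_distr_eq_density[OF d] by simp
    then have "char std_normal_distribution \<sigma> = (\<integral>x. iexp (\<sigma> * x) \<partial>distr N lborel (\<lambda>x. Z x / \<sigma>))"
      by (simp add: char_def)
    also have "\<dots> = (\<integral>\<omega>. iexp (\<sigma> * (Z \<omega> / \<sigma>)) \<partial>N)" using Z by (subst integral_distr) auto
    also have "\<dots> = (\<integral>\<omega>. iexp (Z \<omega>) \<partial>N)" using 2(1) by simp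
    finally show ?thesis by (simp add: var char_std_normal_distribution)
  qed
qed

section \<open>Moments and central limit theorem for the empirical process\<close>

lemma exp_le_quadratic:
  fixes u :: real
  assumes "\<bar>u\<bar> \<le> 1"
  shows "exp u \<le> 1 + u + u\<^sup>2"
proof (cases "0 \<le> u")
  case True
  then show ?thesis using exp_bound[of u] assms by simp
next
  case False
  define a where "a = - u"
  have a: "0 < a" "a \<le> 1" using False assms by (auto simp: a_def)
  \<comment> \<open>The product equals \<open>1 + a ^ 3\<close>.\<close>
  have "1 \<le> (1 - a + a\<^sup>2) * (1 + a)"
    using a by (simp add: power2_eq_square algebra_simps)
  also have "\<dots> \<le> (1 - a + a\<^sup>2) * exp a"
    using a exp_ge_add_one_self[of a] by (intro mult_left_mono) auto
  finally have "exp (- a) * 1 \<le> exp (- a) * ((1 - a + a\<^sup>2) * exp a)" by (intro mult_left_mono) auto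
  also have "\<dots> = 1 - a + a\<^sup>2" by (simp add: exp_minus field_simps)
  finally show ?thesis by (simp add: a_def)
qed

lemma even_power_le_cosh:
  fixes v :: real
  assumes "0 < j"
  shows "v ^ (2 * j) \<le> fact (2 * j) * (cosh v - 1)"
proof -
  let ?f = "\<lambda>n. if even n then v ^ n /\<^sub>R fact n else 0"
  have s: "?f sums cosh v" by (rule cosh_converges)
  have "sum ?f {0, 2 * j} \<le> cosh v"
    unfolding sums_unique[OF s] by (rule sum_le_suminf) (use sums_summable[OF s] in auto)
  then show ?thesis using assms by (simp add: field_simps)
qed

text \<open>The power is at most the sum of the square and of a higher even power, each a term of
  the series of \<open>cosh v - 1\<close>. Removing the constant term is essential: the mean is then
  of order \<open>pmf p x\<close>, which is summable. It also limits the exponents to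
  \<open>r \<ge> 2\<close>.\<close>

lemma powr_le_cosh:
  assumes r: "2 \<le> r"
  obtains C where "0 < C" "\<And>v :: real. \<bar>v\<bar> powr r \<le> C * (cosh v - 1)"
proof -
  obtain j :: nat where j: "r \<le> real (2 * j)" "0 < j"
  proof -
    have "r \<le> real (2 * nat \<lceil>r\<rceil>)" using r by linarith
    moreover have "0 < nat \<lceil>r\<rceil>" using r by linarith
    ultimately show ?thesis by (rule that)
  qed
  have "\<bar>v\<bar> powr r \<le> (2 + fact (2 * j)) * (cosh v - 1)" for v :: real
  proof -
    have "\<bar>v\<bar> powr r \<le> \<bar>v\<bar> ^ 2 + \<bar>v\<bar> ^ (2 * j)"
    proof (cases "\<bar>v\<bar> \<le> 1")
      case True
      show ?thesis
      proof (cases "v = 0")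
        case False
        have "\<bar>v\<bar> powr r \<le> \<bar>v\<bar> powr real 2" using r True False by (intro powr_mono') auto
        also have "\<dots> = \<bar>v\<bar> ^ 2" using False by (intro powr_realpow) auto
        finally show ?thesis using zero_le_power[of "\<bar>v\<bar>" "2 * j"] by linarith
      qed simp
    next
      case False
      have "\<bar>v\<bar> powr r \<le> \<bar>v\<bar> powr real (2 * j)" using j False by (intro powr_mono) auto
      also have "\<dots> = \<bar>v\<bar> ^ (2 * j)" using False by (intro powr_realpow) auto
      finally show ?thesis by (simp add: add_increasing)
    qed
    also have "\<dots> \<le> fact (2 * 1) * (cosh v - 1) + fact (2 * j) * (cosh v - 1)"
      using even_power_le_cosh[of 1 v] even_power_le_cosh[OF j(2), of v] by (intro add_mono) (auto simp:
          power_mult)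
    finally show ?thesis by (simp add: algebra_simps)
  qed
  then show ?thesis by (intro that[of "2 + fact (2 * j)"]) (auto intro: add_pos_pos)
qed

lemma (in prob_space) integrable_bounded:
  fixes f :: "'a \<Rightarrow> 'b::{banach, second_countable_topology}"
  assumes "f \<in> borel_measurable M" "\<And>\<omega>. norm (f \<omega>) \<le> C"
  shows "integrable M f"
  using assms by (intro integrable_const_bound[of _ C]) auto

text \<open>Observations are numbered from 1, the summands in the central limit theorem from
  0.\<close>

lemma (in prob_space) indep_vars_Suc:
  assumes "indep_vars M' Z {1..}"
  shows "indep_vars (M' \<circ> Suc) (Z \<circ> Suc) UNIV"
proof -
  let ?F = "\<lambda>i. {Z i -` A \<inter> space M |A. A \<in> sets (M' i)}"
  have rv: "\<And>i. 1 \<le> i \<Longrightarrow> random_variable (M' i) (Z i)" and ind: "indep_sets ?F {1..}"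
    using assms unfolding indep_vars_def2 by auto
  have "indep_sets (\<lambda>i. ?F (Suc i)) UNIV"
  proof (rule indep_setsI)
    show "?F (Suc i) \<subseteq> events" for i using rv[of "Suc i"] by (auto intro: measurable_sets)
    fix A and J :: "nat set" assume J: "J \<noteq> {}" "finite J" "\<forall>j\<in>J. A j \<in> ?F (Suc j)"
    have "prob (\<Inter>j\<in>Suc ` J. A (j - 1)) = (\<Prod>j\<in>Suc ` J. prob (A (j - 1)))"
      by (rule indep_setsD[OF ind]) (use J in auto)
    then show "prob (\<Inter>j\<in>J. A j) = (\<Prod>j\<in>J. prob (A j))"
      by (simp add: prod.reindex)
  qed
  then show ?thesis using rv unfolding indep_vars_def2 by (simp add: comp_def)
qed

section \<open>Moments and characteristic functions of the empirical process\<close>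

locale sampling = prob_space M for M :: "'a measure" +
  fixes p :: "nat pmf" and X :: "nat \<Rightarrow> 'a \<Rightarrow> nat"
  assumes iid: "iid_sample M p X"
begin

lemma indep: "indep_vars (\<lambda>_. count_space UNIV) X {1..}"
  using iid by (simp add: iid_sample_def)

lemma X_measurable [measurable]: "1 \<le> i \<Longrightarrow> X i \<in> measurable M (count_space UNIV)"
  using indep unfolding indep_vars_def2 by auto

lemma distr_X: "1 \<le> i \<Longrightarrow> distr M (count_space UNIV) (X i) = measure_pmf p"
  using iid by (simp add: iid_sample_def)

lemma expectation_X:
  fixes f :: "nat \<Rightarrow> 'b::{banach, second_countable_topology}"
  assumes "1 \<le> i"
  shows "(\<integral>\<omega>. f (X i \<omega>) \<partial>M) = (\<integral>y. f y \<partial>measure_pmf p)"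
  unfolding distr_X[OF assms, symmetric] using X_measurable[OF assms]
  by (subst integral_distr) auto

text \<open>The first \<open>n\<close> observations form a list of naturals; such lists are
  countably many, so every function of them is measurable.\<close>

lemma sample_measurable:
  fixes T :: "(nat \<Rightarrow> nat) \<Rightarrow> 'b::topological_space"
  assumes "\<And>xs ys. (\<And>i. 1 \<le> i \<Longrightarrow> i \<le> n \<Longrightarrow> xs i = ys i) \<Longrightarrow> T xs = T ys"
  shows "(\<lambda>\<omega>. T (\<lambda>i. X i \<omega>)) \<in> borel_measurable M"
proof -
  define L where "L \<omega> = map (\<lambda>i. X i \<omega>) [1..<Suc n]" for \<omega>
  have "L \<in> measurable M (count_space UNIV)"
    unfolding measurable_count_space_eq2_countable
  proof (intro conjI ballI)
    fix l :: "nat list"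
    show "L -` {l} \<inter> space M \<in> sets M"
    proof (cases "length l = n")
      case True
      have "L \<omega> = l \<longleftrightarrow> (\<forall>j\<in>{..<n}. X (Suc j) \<omega> = l ! j)" for \<omega>
        using True by (auto simp: L_def list_eq_iff_nth_eq simp del: upt_Suc)
      then have "L -` {l} \<inter> space M = {\<omega> \<in> space M. \<forall>j\<in>{..<n}. X (Suc j) \<omega> = l ! j}" by auto
      also have "\<dots> \<in> sets M"
      proof (intro sets.sets_Collect_finite_All)
        fix j assume "j \<in> {..<n}"
        have "X (Suc j) -` {l ! j} \<inter> space M \<in> sets M"
          using X_measurable[of "Suc j"] by (rule measurable_sets) auto
        moreover have "X (Suc j) -` {l ! j} \<inter> space M = {\<omega> \<in> space M. X (Suc j) \<omega> = l ! j}" by auto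
        ultimately show "{\<omega> \<in> space M. X (Suc j) \<omega> = l ! j} \<in> sets M" by simp
      qed simp
      finally show ?thesis .
    next
      case False
      then have "L -` {l} \<inter> space M = {}" by (auto simp: L_def simp del: upt_Suc)
      then show ?thesis by simp
    qed
  qed auto
  moreover have "(\<lambda>l. T (\<lambda>i. l ! (i - 1))) \<in> measurable (count_space UNIV) borel" by simp
  ultimately have "(\<lambda>\<omega>. T (\<lambda>i. L \<omega> ! (i - 1))) \<in> borel_measurable M" by (rule measurable_compose)
  moreover have "T (\<lambda>i. L \<omega> ! (i - 1)) = T (\<lambda>i. X i \<omega>)" for \<omega>
  proof (rule assms)
    fix i assume i: "1 \<le> i" "i \<le> n"
    then have "[1..<Suc n] ! (i - 1) = i" "i - 1 < length [1..<Suc n]"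
      using nth_upt[of 1 "i - 1" "Suc n"] by (auto simp del: upt_Suc)
    then show "L \<omega> ! (i - 1) = X i \<omega>" unfolding L_def by (simp del: upt_Suc)
  qed
  ultimately show ?thesis by simp
qed

definition V :: "nat \<Rightarrow> 'a \<Rightarrow> nat \<Rightarrow> real" where
  "V n \<omega> x = sqrt n * (empirical n (\<lambda>i. X i \<omega>) x - pmf p x)"

lemma V_measurable [measurable]: "(\<lambda>\<omega>. V n \<omega> x) \<in> borel_measurable M"
  unfolding V_def
proof (rule sample_measurable[of n "\<lambda>xs. sqrt n * (empirical n xs x - pmf p x)"])
  fix xs ys :: "nat \<Rightarrow> nat" assume "\<And>i. 1 \<le> i \<Longrightarrow> i \<le> n \<Longrightarrow> xs i = ys i"
  then have "{i \<in> {1..n}. xs i = x} = {i \<in> {1..n}. ys i = x}" by auto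
  then show "sqrt n * (empirical n xs x - pmf p x) = sqrt n * (empirical n ys x - pmf p x)"
    by (simp add: empirical_def)
qed

definition centred :: "nat \<Rightarrow> nat \<Rightarrow> real" where
  "centred x y = indicator {x} y - pmf p x"

lemma V_eq_sum: "V n \<omega> x = (\<Sum>i\<in>{1..n}. centred x (X i \<omega>)) / sqrt n"
proof (cases "n = 0")
  case False
  have "(\<Sum>i\<in>{1..n}. indicator {x} (X i \<omega>) :: real) = (\<Sum>i\<in>{1..n}. if X i \<omega> = x then 1 else 0)"
    by (intro sum.cong) auto
  also have "\<dots> = real (card {i \<in> {1..n}. X i \<omega> = x})"
    by (subst sum.inter_filter[symmetric]) simp_all
  finally have s: "(\<Sum>i\<in>{1..n}. centred x (X i \<omega>)) = real (card {i \<in> {1..n}. X i \<omega> = x}) - n * pmf p x"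
    unfolding centred_def sum_subtractf by simp
  have "V n \<omega> x * sqrt n = (sqrt n * sqrt n) * (empirical n (\<lambda>i. X i \<omega>) x - pmf p x)"
    by (simp only: V_def mult_ac)
  also have "\<dots> = real n * empirical n (\<lambda>i. X i \<omega>) x - n * pmf p x"
    by (simp add: right_diff_distrib)
  also have "real n * empirical n (\<lambda>i. X i \<omega>) x = real (card {i \<in> {1..n}. X i \<omega> = x})"
    using False by (simp add: empirical_def)
  finally show ?thesis unfolding s using False by (simp add: nonzero_eq_divide_eq)
qed (simp add: V_def)

lemma abs_centred_le: "\<bar>centred x y\<bar> \<le> 1"
proof -
  have "- 1 \<le> pmf p x" using pmf_nonneg[of p x] by linarith
  then show ?thesis using pmf_le_1[of p x] by (auto simp: centred_def indicator_def abs_le_iff)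
qed

lemma abs_V_le: "\<bar>V n \<omega> x\<bar> \<le> sqrt n"
proof -
  have "\<bar>\<Sum>i\<in>{1..n}. centred x (X i \<omega>)\<bar> \<le> (\<Sum>i\<in>{1..n}. 1)"
    by (rule order_trans[OF sum_abs sum_mono]) (rule abs_centred_le)
  then have "\<bar>V n \<omega> x\<bar> \<le> real n / sqrt n"
    unfolding V_eq_sum abs_divide by (simp add: divide_right_mono)
  then show ?thesis by (simp add: real_div_sqrt)
qed

lemma integrable_pmf_bounded:
  fixes f :: "nat \<Rightarrow> real"
  assumes "\<And>y. \<bar>f y\<bar> \<le> C"
  shows "integrable (measure_pmf p) f"
  by (rule measure_pmf.integrable_const_bound[of _ C]) (use assms in auto)

lemma integral_centred_product:
  "(\<integral>y. centred x y * centred z y \<partial>measure_pmf p) = (if x = z then pmf p x else 0) - pmf p x * pmf p z"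
proof -
  have "centred x y * centred z y = (if x = z then indicator {x} y else 0) - pmf p z * indicator {x} y
      - pmf p x * indicator {z} y + pmf p x * pmf p z" for y
    by (auto simp: centred_def indicator_def algebra_simps)
  moreover have "integrable (measure_pmf p) (\<lambda>y. indicator {x} y :: real)" for x
    by (rule integrable_pmf_bounded[of _ 1]) (simp add: indicator_def)
  ultimately show ?thesis by (auto simp: measure_pmf_single)
qed

lemma integral_centred: "(\<integral>y. centred x y \<partial>measure_pmf p) = 0"
proof -
  have "integrable (measure_pmf p) (\<lambda>y. indicator {x} y :: real)"
    by (rule integrable_pmf_bounded[of _ 1]) (simp add: indicator_def)
  then show ?thesis by (simp add: centred_def measure_pmf_single)
qed

text \<open>In the quadratic bound for the exponential the linear term has mean zero and the
  quadratic one has mean at most \<open>pmf p x\<close>.\<close>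

lemma mgf_centred:
  assumes "\<bar>s\<bar> \<le> 1"
  shows "(\<integral>y. exp (s * centred x y) \<partial>measure_pmf p) \<le> exp (s\<^sup>2 * pmf p x)"
proof -
  have c: "\<bar>s * centred x y\<bar> \<le> 1" for y
    using mult_mono[OF assms abs_centred_le[of x y]] by (simp add: abs_mult)
  have "(\<integral>y. exp (s * centred x y) \<partial>measure_pmf p)
      \<le> (\<integral>y. 1 + s * centred x y + s\<^sup>2 * (centred x y * centred x y) \<partial>measure_pmf p)"
  proof (rule integral_mono)
    have "exp (s * centred x y) \<le> exp 1" for y using c[of y] by (simp add: abs_le_iff)
    then show "integrable (measure_pmf p) (\<lambda>y. exp (s * centred x y))"
      by (intro integrable_pmf_bounded[of _ "exp 1"]) simp
    have b: "\<bar>centred x y * centred x y\<bar> \<le> 1" for y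
      using mult_mono[OF abs_centred_le[of x y] abs_centred_le[of x y]] by (simp add: abs_mult)
    show "integrable (measure_pmf p) (\<lambda>y. 1 + s * centred x y + s\<^sup>2 * (centred x y * centred x y))"
      by (intro Bochner_Integration.integrable_add integrable_mult_right measure_pmf.integrable_const
          integrable_pmf_bounded[OF abs_centred_le] integrable_pmf_bounded[OF b])
    show "exp (s * centred x y) \<le> 1 + s * centred x y + s\<^sup>2 * (centred x y * centred x y)" for y
      using exp_le_quadratic[OF c[of y]] by (simp add: power2_eq_square mult_ac)
  qed
  also have "\<dots> = 1 + s\<^sup>2 * (pmf p x - pmf p x * pmf p x)"
  proof -
    have b: "\<bar>centred x y * centred x y\<bar> \<le> 1" for y
      using mult_mono[OF abs_centred_le[of x y] abs_centred_le[of x y]] by (simp add: abs_mult)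
    show ?thesis
      using integrable_pmf_bounded[OF abs_centred_le[of x]] integrable_pmf_bounded[OF b]
      by (simp add: integral_centred integral_centred_product)
  qed
  also have "\<dots> \<le> 1 + s\<^sup>2 * pmf p x" by (intro add_left_mono mult_left_mono) auto
  also have "\<dots> \<le> exp (s\<^sup>2 * pmf p x)" by (rule exp_ge_add_one_self)
  finally show ?thesis .
qed

text \<open>By independence the mean is a product of \<open>n\<close> factors, each at most
  \<open>exp (pmf p x / n)\<close>. The bound is uniform in \<open>n\<close>.\<close>

lemma exp_V:
  assumes s: "\<bar>s\<bar> = 1"
  shows "(\<integral>\<omega>. exp (s * V n \<omega> x) \<partial>M) \<le> exp (pmf p x)"
proof (cases "n = 0")
  case True
  then show ?thesis by (simp add: V_def prob_space)
next
  case False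
  let ?s = "s / sqrt n"
  have le1: "\<bar>?s\<bar> \<le> 1" using s False by (simp add: abs_divide)
  have ind: "indep_vars (\<lambda>_. borel) (\<lambda>i \<omega>. exp (?s * centred x (X i \<omega>))) {1..n}"
    using indep_vars_compose2[OF indep_vars_subset[OF indep, of "{1..n}"], of "\<lambda>_ y. exp (?s * centred x
        y)" "\<lambda>_. borel"]
    by simp
  have int: "integrable M (\<lambda>\<omega>. exp (?s * centred x (X i \<omega>)))" if "i \<in> {1..n}" for i
  proof (rule integrable_bounded)
    show "(\<lambda>\<omega>. exp (?s * centred x (X i \<omega>))) \<in> borel_measurable M"
      using ind that unfolding indep_vars_def2 by auto
    show "norm (exp (?s * centred x (X i \<omega>))) \<le> exp 1" for \<omega>
    proof -
      have "\<bar>?s\<bar> * \<bar>centred x (X i \<omega>)\<bar> \<le> 1 * 1"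
        by (intro mult_mono le1 abs_centred_le) auto
      then have "\<bar>?s * centred x (X i \<omega>)\<bar> \<le> 1" by (simp only: abs_mult mult_1)
      then have "?s * centred x (X i \<omega>) \<le> 1" by (rule abs_le_D1)
      then show ?thesis unfolding real_norm_def abs_exp_cancel exp_le_cancel_iff .
    qed
  qed
  have "(\<integral>\<omega>. exp (s * V n \<omega> x) \<partial>M) = (\<integral>\<omega>. (\<Prod>i\<in>{1..n}. exp (?s * centred x (X i \<omega>))) \<partial>M)"
  proof (intro Bochner_Integration.integral_cong refl)
    fix \<omega>
    have "s * V n \<omega> x = (\<Sum>i\<in>{1..n}. ?s * centred x (X i \<omega>))"
      unfolding V_eq_sum by (simp only: sum_distrib_left[symmetric]) simp
    then show "exp (s * V n \<omega> x) = (\<Prod>i\<in>{1..n}. exp (?s * centred x (X i \<omega>)))"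
      by (simp only: exp_sum finite_atLeastAtMost)
  qed
  also have "\<dots> = (\<Prod>i\<in>{1..n}. \<integral>\<omega>. exp (?s * centred x (X i \<omega>)) \<partial>M)"
    by (rule indep_vars_lebesgue_integral[OF _ ind int]) auto
  also have "\<dots> = (\<Prod>i\<in>{1..n}. \<integral>y. exp (?s * centred x y) \<partial>measure_pmf p)"
    by (intro prod.cong refl expectation_X) auto
  also have "\<dots> \<le> (\<Prod>i\<in>{1..n}. exp (?s\<^sup>2 * pmf p x))"
    by (intro prod_mono conjI Bochner_Integration.integral_nonneg mgf_centred[OF le1]) simp
  also have "\<dots> = exp (n * (?s\<^sup>2 * pmf p x))" by (simp add: exp_of_nat_mult)
  also have "n * (?s\<^sup>2 * pmf p x) = pmf p x"
  proof -
    have "s\<^sup>2 = 1" using s by (metis power2_abs one_power2)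
    then show ?thesis using False by (simp add: power_divide)
  qed
  finally show ?thesis .
qed

lemma cosh_V: "(\<integral>\<omega>. cosh (V n \<omega> x) - 1 \<partial>M) \<le> 2 * pmf p x"
proof -
  have i: "integrable M (\<lambda>\<omega>. exp (s * V n \<omega> x))" if "\<bar>s\<bar> = 1" for s
  proof (rule integrable_bounded)
    show "norm (exp (s * V n \<omega> x)) \<le> exp (sqrt n)" for \<omega>
      using abs_V_le[of n \<omega> x] that abs_ge_self[of "s * V n \<omega> x"] by (simp add: abs_mult)
  qed simp
  have "(\<integral>\<omega>. cosh (V n \<omega> x) - 1 \<partial>M)
      = ((\<integral>\<omega>. exp (1 * V n \<omega> x) \<partial>M) + (\<integral>\<omega>. exp (- 1 * V n \<omega> x) \<partial>M)) / 2 - 1"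
    using i[of 1] i[of "- 1"] by (simp add: cosh_field_def prob_space)
  also have "\<dots> \<le> exp (pmf p x) - 1"
    using exp_V[of 1 n x] exp_V[of "- 1" n x] by simp
  also have "\<dots> \<le> pmf p x + (pmf p x)\<^sup>2"
    using exp_bound[of "pmf p x"] pmf_le_1[of p x] by simp
  also have "\<dots> \<le> 2 * pmf p x"
    using mult_left_mono[OF pmf_le_1[of p x] pmf_nonneg[of p x]] by (simp add: power2_eq_square)
  finally show ?thesis .
qed

lemma V_moment:
  assumes "2 \<le> r"
  obtains C where "0 < C" "\<And>n x. (\<integral>\<omega>. \<bar>V n \<omega> x\<bar> powr r \<partial>M) \<le> C * pmf p x"
proof -
  obtain C where C: "0 < C" "\<And>v :: real. \<bar>v\<bar> powr r \<le> C * (cosh v - 1)"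
    by (rule powr_le_cosh[OF assms], rule that)
  have "(\<integral>\<omega>. \<bar>V n \<omega> x\<bar> powr r \<partial>M) \<le> (C * 2) * pmf p x" for n x
  proof -
    have "\<bar>V n \<omega> x\<bar> powr r \<le> sqrt n powr r" for \<omega>
      using abs_V_le[of n \<omega> x] assms by (intro powr_mono2) auto
    then have i: "integrable M (\<lambda>\<omega>. \<bar>V n \<omega> x\<bar> powr r)"
      by (intro integrable_bounded[of _ "sqrt n powr r"]) auto
    have "cosh (V n \<omega> x) \<le> cosh (sqrt n)" for \<omega>
      using abs_V_le[of n \<omega> x] cosh_real_nonneg_le_iff[of "\<bar>V n \<omega> x\<bar>" "sqrt n"] by simp
    moreover have "0 \<le> cosh (V n \<omega> x)" for \<omega> by simp
    ultimately have "integrable M (\<lambda>\<omega>. cosh (V n \<omega> x))"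
      unfolding cosh_field_def by (intro integrable_bounded[of _ "cosh (sqrt n)"]) (auto simp:
          cosh_field_def abs_of_nonneg)
    then have j: "integrable M (\<lambda>\<omega>. C * (cosh (V n \<omega> x) - 1))" by simp
    have "(\<integral>\<omega>. \<bar>V n \<omega> x\<bar> powr r \<partial>M) \<le> (\<integral>\<omega>. C * (cosh (V n \<omega> x) - 1) \<partial>M)"
      by (rule integral_mono[OF i j]) (rule C)
    also have "\<dots> = C * (\<integral>\<omega>. cosh (V n \<omega> x) - 1 \<partial>M)" by simp
    also have "\<dots> \<le> C * (2 * pmf p x)" using C(1) cosh_V by (intro mult_left_mono) auto
    finally show ?thesis by simp
  qed
  moreover have "0 < C * 2" using C(1) by simp
  ultimately show ?thesis by (rule that[rotated])
qed

text \<open>A linear combination of the coordinates of \<open>V n\<close> is a normalised sum of the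
  i.i.d. variables \<open>W i\<close> with mean zero and variance \<open>v\<close>. If
  \<open>v = 0\<close> they vanish almost surely and the claim is trivial; otherwise the real
  central limit theorem applies.\<close>

lemma V_char_limit:
  "(\<lambda>n. \<integral>\<omega>. iexp (\<Sum>x<m. t x * V n \<omega> x) \<partial>M)
    \<longlonglongrightarrow> of_real (exp (- (\<Sum>x<m. \<Sum>z<m. t x * t z * ((if x = z then pmf p x else 0) - pmf p x * pmf p z)) / 2))"
proof -
  define h where "h y = (\<Sum>x<m. t x * centred x y)" for y
  define v where "v = (\<Sum>x<m. \<Sum>z<m. t x * t z * ((if x = z then pmf p x else 0) - pmf p x * pmf p z))"
  define W where "W i \<omega> = h (X (Suc i) \<omega>)" for i \<omega>
  have ci: "integrable (measure_pmf p) (centred x)" for x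
    by (rule integrable_pmf_bounded[OF abs_centred_le])
  have ci2: "integrable (measure_pmf p) (\<lambda>y. centred x y * centred z y)" for x z
  proof (rule integrable_pmf_bounded[of _ 1])
    show "\<bar>centred x y * centred z y\<bar> \<le> 1" for y
      using mult_mono[OF abs_centred_le[of x y] abs_centred_le[of z y]] by (simp add: abs_mult)
  qed
  have h_bound: "\<bar>h y\<bar> \<le> (\<Sum>x<m. \<bar>t x\<bar>)" for y
    unfolding h_def
  proof (rule order_trans[OF sum_abs sum_mono])
    show "\<bar>t x * centred x y\<bar> \<le> \<bar>t x\<bar>" for x
      using mult_left_mono[OF abs_centred_le[of x y], of "\<bar>t x\<bar>"] by (simp add: abs_mult)
  qed
  have h0: "(\<integral>y. h y \<partial>measure_pmf p) = 0"
    unfolding h_def using ci by (simp add: integral_centred)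
  have hsq: "(h y)\<^sup>2 = (\<Sum>x<m. \<Sum>z<m. t x * t z * (centred x y * centred z y))" for y
    by (simp add: h_def power2_eq_square sum_product mult_ac)
  have h2: "(\<integral>y. (h y)\<^sup>2 \<partial>measure_pmf p) = v"
    unfolding hsq v_def using ci2 by (simp add: integral_centred_product)
  have S: "(\<Sum>x<m. t x * V n \<omega> x) = (\<Sum>i<n. W i \<omega>) / sqrt n" for n \<omega>
  proof -
    have "(\<Sum>x<m. t x * V n \<omega> x) = (\<Sum>x<m. \<Sum>i\<in>{1..n}. t x * centred x (X i \<omega>)) / sqrt n"
      by (simp add: V_eq_sum sum_distrib_left sum_divide_distrib)
    also have "\<dots> = (\<Sum>i\<in>{1..n}. h (X i \<omega>)) / sqrt n"
      unfolding h_def by (subst sum.swap) simp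
    also have "(\<Sum>i\<in>{1..n}. h (X i \<omega>)) = (\<Sum>i<n. W i \<omega>)"
      unfolding W_def by (rule sum.reindex_bij_witness[of _ Suc "\<lambda>i. i - 1"]) auto
    finally show ?thesis .
  qed
  have Wm [measurable]: "W i \<in> borel_measurable M" for i
  proof -
    have "(\<lambda>\<omega>. h (X (Suc i) \<omega>)) \<in> borel_measurable M"
      using X_measurable[of "Suc i"] by (rule measurable_compose) auto
    then show ?thesis by (simp add: W_def[abs_def])
  qed
  have W2: "integrable M (\<lambda>\<omega>. (W i \<omega>)\<^sup>2)" for i
  proof (rule integrable_bounded)
    show "norm ((W i \<omega>)\<^sup>2) \<le> (\<Sum>x<m. \<bar>t x\<bar>)\<^sup>2" for \<omega>
      using h_bound[of "X (Suc i) \<omega>"] power_mono[of "\<bar>W i \<omega>\<bar>" _ 2] by (simp add: W_def)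
  qed simp
  have EW2: "(\<integral>\<omega>. (W i \<omega>)\<^sup>2 \<partial>M) = v" for i
    unfolding W_def using expectation_X[of "Suc i" "\<lambda>y. (h y)\<^sup>2"] h2 by simp
  have EW: "(\<integral>\<omega>. W i \<omega> \<partial>M) = 0" for i
    unfolding W_def using expectation_X[of "Suc i" h] h0 by simp
  have v0: "0 \<le> v" unfolding h2[symmetric] by (rule Bochner_Integration.integral_nonneg) simp
  show ?thesis unfolding S v_def[symmetric]
  proof (cases "v = 0")
    case True
    have "AE \<omega> in M. W i \<omega> = 0" for i
      using integral_nonneg_eq_0_iff_AE[OF W2[of i]] EW2[of i] True by simp
    then have "AE \<omega> in M. \<forall>i. W i \<omega> = 0" by (simp add: AE_all_countable)
    then have "(\<integral>\<omega>. iexp ((\<Sum>i<n. W i \<omega>) / sqrt n) \<partial>M) = (\<integral>\<omega>. 1 \<partial>M)" for n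
      by (intro integral_cong_AE) auto
    then show "(\<lambda>n. \<integral>\<omega>. iexp ((\<Sum>i<n. W i \<omega>) / sqrt n) \<partial>M) \<longlonglongrightarrow> of_real (exp (- v / 2))"
      using True by (simp add: prob_space)
  next
    case False
    then have \<sigma>: "0 < sqrt v" "(sqrt v)\<^sup>2 = v" using v0 by auto
    have ind: "indep_vars (\<lambda>_. borel) W UNIV"
    proof -
      have "indep_vars (\<lambda>_. count_space UNIV) (\<lambda>i. X (Suc i)) UNIV"
      proof -
        have "indep_vars ((\<lambda>_. count_space UNIV) \<circ> Suc) (X \<circ> Suc) UNIV"
          using indep by (intro indep_vars_Suc) simp
        then show ?thesis by (simp add: comp_def)
      qed
      from indep_vars_compose2[OF this, of "\<lambda>_. h" "\<lambda>_. borel"] show ?thesis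
        by (simp add: W_def[abs_def])
    qed
    have dist: "distr M borel (W n) = distr (measure_pmf p) borel h" for n
    proof -
      have 1: "(1::nat) \<le> Suc n" by simp
      show ?thesis
        unfolding distr_X[OF 1, symmetric] W_def[abs_def]
        using X_measurable[OF 1] by (subst distr_distr) (auto simp: comp_def)
    qed
    have weak: "weak_conv_m (\<lambda>n. distr M borel (\<lambda>\<omega>. (\<Sum>i<n. W i \<omega>) / sqrt (n * (sqrt v)\<^sup>2)))
        std_normal_distribution"
      using central_limit_theorem_zero_mean[OF ind EW \<sigma>(1) W2 _ dist] EW EW2 \<sigma>(2) by simp
    \<comment> \<open>Evaluating at the frequency \<open>sqrt v\<close> cancels the normalisation by
      the standard deviation.\<close>
    have "(\<lambda>n. char (distr M borel (\<lambda>\<omega>. (\<Sum>i<n. W i \<omega>) / sqrt (n * (sqrt v)\<^sup>2))) (sqrt v))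
        \<longlonglongrightarrow> char std_normal_distribution (sqrt v)"
      by (rule levy_continuity1[OF _ _ weak]) (auto intro!: real_distribution_distr real_dist_normal_dist)
    moreover have "char (distr M borel (\<lambda>\<omega>. (\<Sum>i<n. W i \<omega>) / sqrt (n * (sqrt v)\<^sup>2))) (sqrt v)
        = (\<integral>\<omega>. iexp ((\<Sum>i<n. W i \<omega>) / sqrt n) \<partial>M)" for n
    proof -
      have "sqrt v * ((\<Sum>i<n. W i \<omega>) / sqrt (n * (sqrt v)\<^sup>2)) = (\<Sum>i<n. W i \<omega>) / sqrt n" for \<omega>
        unfolding \<sigma>(2) using \<sigma>(1) by (simp add: real_sqrt_mult)
      then show ?thesis unfolding char_def by (subst integral_distr) auto
    qed
    ultimately show "(\<lambda>n. \<integral>\<omega>. iexp ((\<Sum>i<n. W i \<omega>) / sqrt n) \<partial>M) \<longlonglongrightarrow> of_real (exp (- v / 2))"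
      using \<sigma>(2) by (simp add: char_std_normal_distribution)
  qed
qed

end

section \<open>The Gaussian limit process\<close>

locale gaussian_limit = prob_space N for N :: "'b measure" +
  fixes p :: "nat pmf" and Y :: "nat \<Rightarrow> 'b \<Rightarrow> real"
  assumes limit: "limit_process N p Y"
begin

lemma gaussian_combination: "finite J \<Longrightarrow> gaussian_var N (\<lambda>\<omega>. \<Sum>x\<in>J. a x * Y x \<omega>)"
  using limit unfolding limit_process_def gaussian_process_def by blast

lemma gaussian_Y: "gaussian_var N (Y x)"
  using gaussian_combination[of "{x}" "\<lambda>_. 1"] by simp

lemma Y_measurable [measurable]: "Y x \<in> borel_measurable N"
  using gaussian_square_integrable(1)[OF prob_space_axioms gaussian_Y] .

lemma Y_square_integrable: "integrable N (\<lambda>\<omega>. (Y x \<omega>)\<^sup>2)"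
  using gaussian_square_integrable(2)[OF prob_space_axioms gaussian_Y] .

lemma Y_integrable: "integrable N (Y x)"
  by (rule square_integrable_imp_integrable[OF Y_measurable Y_square_integrable])

lemma Y_mean: "(\<integral>\<omega>. Y x \<omega> \<partial>N) = 0"
  using limit by (simp add: limit_process_def)

lemma Y_product: "(\<integral>\<omega>. Y x \<omega> * Y z \<omega> \<partial>N) = (if x = z then pmf p x else 0) - pmf p x * pmf p z"
proof -
  have "covar N (Y x) (Y z) = (if x = z then pmf p x else 0) - pmf p x * pmf p z"
    using limit unfolding limit_process_def by blast
  then show ?thesis by (simp add: covar_def Y_mean)
qed

lemma Y_product_integrable: "integrable N (\<lambda>\<omega>. Y x \<omega> * Y z \<omega>)"
proof (rule Bochner_Integration.integrable_bound)
  show "integrable N (\<lambda>\<omega>. (Y x \<omega>)\<^sup>2 + (Y z \<omega>)\<^sup>2)" using Y_square_integrable by simp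
  have "\<bar>u * v\<bar> \<le> u\<^sup>2 + v\<^sup>2" for u v :: real
  proof -
    have "2 * (\<bar>u\<bar> * \<bar>v\<bar>) \<le> \<bar>u\<bar>\<^sup>2 + \<bar>v\<bar>\<^sup>2" using sum_squares_bound[of "\<bar>u\<bar>" "\<bar>v\<bar>"] by simp
    moreover have "0 \<le> \<bar>u\<bar> * \<bar>v\<bar>" by simp
    ultimately show ?thesis unfolding abs_mult power2_abs by linarith
  qed
  then show "AE \<omega> in N. norm (Y x \<omega> * Y z \<omega>) \<le> norm ((Y x \<omega>)\<^sup>2 + (Y z \<omega>)\<^sup>2)"
    by (intro AE_I2) (simp add: order_trans[OF _ abs_ge_self])
qed simp

lemma combination_mean: "(\<integral>\<omega>. (\<Sum>x\<in>J. a x * Y x \<omega>) \<partial>N) = 0"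
  by (subst Bochner_Integration.integral_sum) (simp_all add: Y_mean Y_integrable)

lemma combination_product:
  "(\<integral>\<omega>. (\<Sum>x\<in>J. a x * Y x \<omega>) * (\<Sum>x\<in>J. b x * Y x \<omega>) \<partial>N)
    = (\<Sum>x\<in>J. \<Sum>z\<in>J. a x * b z * ((if x = z then pmf p x else 0) - pmf p x * pmf p z))"
proof -
  have "(\<Sum>x\<in>J. a x * Y x \<omega>) * (\<Sum>x\<in>J. b x * Y x \<omega>) = (\<Sum>x\<in>J. \<Sum>z\<in>J. a x * b z * (Y x \<omega> * Y z \<omega>))" for \<omega>
    by (simp add: sum_product mult_ac)
  then show ?thesis using Y_product_integrable by (simp add: Y_product)
qed

lemma combination_char:
  assumes "finite J"
  shows "(\<integral>\<omega>. iexp (\<Sum>x\<in>J. a x * Y x \<omega>) \<partial>N) = of_real (exp (-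
    (\<Sum>x\<in>J. \<Sum>z\<in>J. a x * a z * ((if x = z then pmf p x else 0) - pmf p x * pmf p z)) / 2))"
  using gaussian_char[OF prob_space_axioms gaussian_combination[OF assms] combination_mean, of a]
  unfolding power2_eq_square combination_product .

end

lemma abs_powr_2: "\<bar>u\<bar> powr 2 = u\<^sup>2" for u :: real
  by (cases "u = 0") (simp_all add: powr_realpow[of _ 2, simplified])

text \<open>Either \<open>t\<close> is below \<open>a\<close> or it is paid for by the square. With
  a suitable \<open>a\<close> this replaces uniform integrability arguments whenever second moments
  are bounded.\<close>

lemma le_add_square:
  fixes a t :: real
  assumes "0 < a"
  shows "t \<le> a + t\<^sup>2 * (1 / a)"
proof (cases "t \<le> a")
  case False
  then have "a * t \<le> t\<^sup>2" using assms by (simp add: power2_eq_square mult_right_mono)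
  then have "t \<le> t\<^sup>2 * (1 / a)" using assms by (simp add: pos_le_divide_eq mult.commute)
  then show ?thesis using assms by simp
qed (use assms in \<open>simp add: add_increasing2\<close>)

lemma ennreal_le_add_square:
  assumes "0 < a"
  shows "ennreal t \<le> ennreal a + ennreal (t\<^sup>2) * ennreal (1 / a)"
proof -
  have "ennreal t \<le> ennreal (a + t\<^sup>2 * (1 / a))" using le_add_square[OF assms] by (rule ennreal_leI)
  also have "\<dots> = ennreal a + ennreal (t\<^sup>2) * ennreal (1 / a)"
    using assms by (simp add: ennreal_mult[symmetric] ennreal_plus[symmetric] del: ennreal_plus)
  finally show ?thesis .
qed

lemma coord_lipschitz_comp:
  assumes "coord_lipschitz m F" "\<And>x. x < m \<Longrightarrow> coord_lipschitz m (\<lambda>y. T y x)"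
  shows "coord_lipschitz m (\<lambda>y. F (T y))"
proof -
  obtain C where C: "C \<ge> 0" "\<And>u v. \<bar>F u - F v\<bar> \<le> C * (\<Sum>x<m. \<bar>u x - v x\<bar>)"
    using assms(1) unfolding coord_lipschitz_def by blast
  have "\<forall>x\<in>{..<m}. \<exists>D\<ge>0. \<forall>u v. \<bar>T u x - T v x\<bar> \<le> D * (\<Sum>x<m. \<bar>u x - v x\<bar>)"
    using assms(2) unfolding coord_lipschitz_def by blast
  then obtain D where D: "\<And>x. x < m \<Longrightarrow> 0 \<le> D x"
    "\<And>x u v. x < m \<Longrightarrow> \<bar>T u x - T v x\<bar> \<le> D x * (\<Sum>x<m. \<bar>u x - v x\<bar>)"
    unfolding bchoice_iff lessThan_iff by blast
  have "\<bar>F (T u) - F (T v)\<bar> \<le> (C * sum D {..<m}) * (\<Sum>x<m. \<bar>u x - v x\<bar>)" for u v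
  proof -
    have "\<bar>F (T u) - F (T v)\<bar> \<le> C * (\<Sum>x<m. \<bar>T u x - T v x\<bar>)" by (rule C)
    also have "\<dots> \<le> C * (\<Sum>x<m. D x * (\<Sum>x<m. \<bar>u x - v x\<bar>))"
      using D(2) by (intro mult_left_mono sum_mono C) simp
    finally show ?thesis by (simp add: sum_distrib_right mult.assoc)
  qed
  moreover have "0 \<le> C * sum D {..<m}" using C(1) D(1) by (intro mult_nonneg_nonneg sum_nonneg) auto
  ultimately show ?thesis unfolding coord_lipschitz_def by blast
qed

section \<open>Central limit theorem for Lipschitz functionals\<close>

locale sampling_limit = sampling M p X + N: gaussian_limit N p Y
  for M :: "'a measure" and p X and N :: "'b measure" and Y
begin

abbreviation "Yv \<omega> \<equiv> (\<lambda>x. Y x \<omega>)"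

lemma lipschitz_clt:
  assumes "coord_lipschitz m F"
  shows "(\<lambda>n. \<integral>\<omega>. F (V n \<omega>) \<partial>M) \<longlonglongrightarrow> (\<integral>\<omega>. F (Yv \<omega>) \<partial>N)"
proof -
  obtain C where C: "0 < C" "\<And>n x. (\<integral>\<omega>. \<bar>V n \<omega> x\<bar> powr 2 \<partial>M) \<le> C * pmf p x"
    by (rule V_moment[of 2], simp, rule that)
  \<comment> \<open>A common bound for second moments: \<open>C\<close> serves for the empirical
    process, 1 for the variances of the limit.\<close>
  interpret characters_converge "\<lambda>_. M" V N Yv m "max C 1"
  proof

    show "integrable M (\<lambda>\<omega>. (V n \<omega> x)\<^sup>2)" for n x
    proof (rule integrable_bounded)
      show "norm ((V n \<omega> x)\<^sup>2) \<le> (sqrt n)\<^sup>2" for \<omega>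
        using power_mono[OF abs_V_le[of n \<omega> x], of 2] by simp
    qed simp
    show "(\<integral>\<omega>. (V n \<omega> x)\<^sup>2 \<partial>M) \<le> max C 1" for n x
    proof -
      have "(\<integral>\<omega>. (V n \<omega> x)\<^sup>2 \<partial>M) \<le> C * pmf p x" using C(2)[of n x] by (simp add: abs_powr_2)
      also have "\<dots> \<le> C * 1" using C(1) by (intro mult_left_mono pmf_le_1) auto
      finally show ?thesis by simp
    qed
    show "(\<integral>\<omega>. (Y x \<omega>)\<^sup>2 \<partial>N) \<le> max C 1" for x
    proof -
      have "(\<integral>\<omega>. (Y x \<omega>)\<^sup>2 \<partial>N) = pmf p x - pmf p x * pmf p x"
        using N.Y_product[of x x] by (simp add: power2_eq_square)
      also have "\<dots> \<le> 1" using pmf_le_1[of p x] by (simp add: order_trans[OF _ pmf_le_1[of p x]])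
      finally show ?thesis by simp
    qed
    show "(\<lambda>n. \<integral>\<omega>. iexp (\<Sum>x<m. t x * V n \<omega> x) \<partial>M) \<longlonglongrightarrow> (\<integral>\<omega>. iexp (\<Sum>x<m. t x * Y x \<omega>) \<partial>N)" for t
      unfolding N.combination_char[OF finite_lessThan] by (rule V_char_limit)
  qed (auto intro: N.Y_square_integrable)
  show ?thesis by (rule lipschitz_limit[OF assms])
qed

end

lemma powr_diff_le:
  fixes a b :: real
  assumes r: "1 \<le> r" and ab: "0 \<le> a" "a \<le> b"
  shows "b powr r - a powr r \<le> r * b powr (r - 1) * (b - a)"
proof (cases "a = 0 \<or> a = b")
  case True
  have "b powr r = b powr (r - 1) * b" if "0 < b" using that powr_add[of b "r - 1" 1] by simp
  moreover have "b powr (r - 1) * b \<le> r * b powr (r - 1) * b"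
    using r ab by (intro mult_right_mono) (auto simp: mult_le_cancel_right1)
  ultimately show ?thesis using True ab by (cases "b = 0") auto
next
  case False
  then have ab': "0 < a" "a < b" using ab by auto
  have "\<exists>z. a < z \<and> z < b \<and> b powr r - a powr r = (b - a) * (r * z powr (r - 1))"
    by (rule MVT2[OF ab'(2)]) (use ab' in \<open>auto intro!: has_real_derivative_powr\<close>)
  then obtain z where z: "a < z" "z < b" "b powr r - a powr r = (b - a) * (r * z powr (r - 1))" by blast
  have "z powr (r - 1) \<le> b powr (r - 1)" using z ab' r by (intro powr_mono2) auto
  then have "(b - a) * (r * z powr (r - 1)) \<le> (b - a) * (r * b powr (r - 1))"
    using r ab' by (intro mult_left_mono) auto
  then show ?thesis using z(3) by (simp add: mult_ac)
qed

lemma min_powr_lipschitz: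
  fixes u v :: real
  assumes r: "1 \<le> r" and K: "0 \<le> K"
  shows "\<bar>min \<bar>u\<bar> K powr r - min \<bar>v\<bar> K powr r\<bar> \<le> r * K powr (r - 1) * \<bar>u - v\<bar>"
proof -
  have *: "\<bar>b powr r - a powr r\<bar> \<le> r * K powr (r - 1) * (b - a)" if "0 \<le> a" "a \<le> b" "b \<le> K" for a b
  proof -
    have "0 \<le> b powr r - a powr r" using that r powr_mono2[of r a b] by simp
    moreover have "b powr r - a powr r \<le> r * b powr (r - 1) * (b - a)" by (rule powr_diff_le[OF r that(1,2)])
    moreover have "r * b powr (r - 1) * (b - a) \<le> r * K powr (r - 1) * (b - a)"
      using that r by (intro mult_right_mono mult_left_mono powr_mono2) auto
    ultimately show ?thesis by simp
  qed
  have "\<bar>min \<bar>u\<bar> K powr r - min \<bar>v\<bar> K powr r\<bar> \<le> r * K powr (r - 1) * \<bar>min \<bar>u\<bar> K - min \<bar>v\<bar> K\<bar>"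
  proof (cases "min \<bar>v\<bar> K \<le> min \<bar>u\<bar> K")
    case True
    show ?thesis unfolding abs_of_nonneg[OF True[THEN diff_ge_0_iff_ge[THEN iffD2]]]
      by (rule *) (use True K in auto)
  next
    case False
    then have le: "min \<bar>u\<bar> K \<le> min \<bar>v\<bar> K" by linarith
    show ?thesis
      unfolding abs_minus_commute[of "min \<bar>u\<bar> K powr r"] abs_minus_commute[of "min \<bar>u\<bar> K" "min \<bar>v\<bar> K"]
        abs_of_nonneg[OF le[THEN diff_ge_0_iff_ge[THEN iffD2]]]
      by (rule *) (use le K in auto)
  qed
  also have "\<dots> \<le> r * K powr (r - 1) * \<bar>u - v\<bar>"
    using r by (intro mult_left_mono) auto
  finally show ?thesis .
qed

lemma coord_lipschitz_coord:
  assumes x: "x < m" and f: "\<And>u v. \<bar>f u - f v\<bar> \<le> C * \<bar>u - v\<bar>" "0 \<le> C"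
  shows "coord_lipschitz m (\<lambda>v. f (v x))"
proof -
  have "\<bar>f (u x) - f (v x)\<bar> \<le> C * (\<Sum>x<m. \<bar>u x - v x\<bar>)" for u v :: "nat \<Rightarrow> real"
  proof -
    have "\<bar>u x - v x\<bar> \<le> (\<Sum>x<m. \<bar>u x - v x\<bar>)" using x by (intro member_le_sum) auto
    then show ?thesis using f(1)[of "u x" "v x"] mult_left_mono[OF _ f(2)] by (meson order_trans)
  qed
  then show ?thesis using f(2) unfolding coord_lipschitz_def by blast
qed

context sampling_limit
begin

text \<open>The limit inherits the constant of the empirical process: powers truncated at
  \<open>K\<close> are Lipschitz, so their means converge and keep the bound, and Fatou's lemma
  removes the truncation.\<close>

lemma moments:
  assumes r: "2 \<le> r"
  obtains C where "0 < C" "\<And>n x. (\<integral>\<^sup>+\<omega>. ennreal (\<bar>V n \<omega> x\<bar> powr r) \<partial>M) \<le> ennreal (C * pmf p x)"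
    "\<And>x. (\<integral>\<^sup>+\<omega>. ennreal (\<bar>Y x \<omega>\<bar> powr r) \<partial>N) \<le> ennreal (C * pmf p x)"
proof -
  obtain C where C: "0 < C" "\<And>n x. (\<integral>\<omega>. \<bar>V n \<omega> x\<bar> powr r \<partial>M) \<le> C * pmf p x"
    by (rule V_moment[OF r], rule that)
  have iV: "integrable M (\<lambda>\<omega>. \<bar>V n \<omega> x\<bar> powr r)" for n x
  proof (rule integrable_bounded)
    show "norm (\<bar>V n \<omega> x\<bar> powr r) \<le> sqrt n powr r" for \<omega>
      using powr_mono2[OF _ _ abs_V_le[of n \<omega> x], of r] r by simp
  qed simp
  have 1: "(\<integral>\<^sup>+\<omega>. ennreal (\<bar>V n \<omega> x\<bar> powr r) \<partial>M) \<le> ennreal (C * pmf p x)" for n x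
    unfolding nn_integral_eq_integral[OF iV AE_I2[OF powr_ge_zero]] by (rule ennreal_leI[OF C(2)])
  have 2: "(\<integral>\<^sup>+\<omega>. ennreal (\<bar>Y x \<omega>\<bar> powr r) \<partial>N) \<le> ennreal (C * pmf p x)" for x
  proof -
    define g where "g K v = min \<bar>v\<bar> (real K) powr r" for K v
    have gle: "norm (g K v) \<le> real K powr r" for K v
      unfolding g_def using r by (auto intro!: powr_mono2)
    have gY: "(\<integral>\<^sup>+\<omega>. ennreal (g K (Y x \<omega>)) \<partial>N) \<le> ennreal (C * pmf p x)" for K
    proof -
      have "coord_lipschitz (Suc x) (\<lambda>v. g K (v x))"
        unfolding g_def using min_powr_lipschitz[of r "real K"] r
        by (intro coord_lipschitz_coord[of _ _ _ "r * real K powr (r - 1)"]) auto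
      from lipschitz_clt[OF this]
      have "(\<lambda>n. \<integral>\<omega>. g K (V n \<omega> x) \<partial>M) \<longlonglongrightarrow> (\<integral>\<omega>. g K (Y x \<omega>) \<partial>N)" .
      moreover have "(\<integral>\<omega>. g K (V n \<omega> x) \<partial>M) \<le> C * pmf p x" for n
      proof (rule order_trans[OF integral_mono[OF _ iV] C(2)])
        show "integrable M (\<lambda>\<omega>. g K (V n \<omega> x))"
          by (rule integrable_bounded[OF _ gle]) (simp add: g_def)
        show "g K (V n \<omega> x) \<le> \<bar>V n \<omega> x\<bar> powr r" for \<omega>
          unfolding g_def using r by (intro powr_mono2) auto
      qed
      ultimately have "(\<integral>\<omega>. g K (Y x \<omega>) \<partial>N) \<le> C * pmf p x" by (intro LIMSEQ_le_const2) auto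
      moreover have "integrable N (\<lambda>\<omega>. g K (Y x \<omega>))"
        by (rule N.integrable_bounded[OF _ gle]) (simp add: g_def)
      ultimately show ?thesis by (subst nn_integral_eq_integral) (auto simp: g_def intro: ennreal_leI)
    qed
    have "(\<integral>\<^sup>+\<omega>. ennreal (\<bar>Y x \<omega>\<bar> powr r) \<partial>N) \<le> (\<integral>\<^sup>+\<omega>. liminf (\<lambda>K. ennreal (g K (Y x \<omega>))) \<partial>N)"
    proof (intro nn_integral_mono Liminf_bounded)
      fix \<omega>
      obtain K0 :: nat where K0: "\<bar>Y x \<omega>\<bar> \<le> real K0" using real_arch_simple by blast
      have "ennreal (\<bar>Y x \<omega>\<bar> powr r) \<le> ennreal (g K (Y x \<omega>))" if "K0 \<le> K" for K
      proof -
        have "min \<bar>Y x \<omega>\<bar> (real K) = \<bar>Y x \<omega>\<bar>" using K0 that by simp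
        then show ?thesis by (simp add: g_def)
      qed
      then show "\<forall>\<^sub>F K in sequentially. ennreal (\<bar>Y x \<omega>\<bar> powr r) \<le> ennreal (g K (Y x \<omega>))"
        unfolding eventually_sequentially by blast
    qed
    also have "\<dots> \<le> liminf (\<lambda>K. \<integral>\<^sup>+\<omega>. ennreal (g K (Y x \<omega>)) \<partial>N)"
      by (rule nn_integral_liminf) (simp add: g_def)
    also have "\<dots> \<le> ennreal (C * pmf p x)"
      by (intro Liminf_le) (simp_all add: gY)
    finally show ?thesis .
  qed
  show ?thesis by (rule that[OF C(1) 1 2])
qed

end

section \<open>Convergence of risks\<close>

text \<open>Approximation of a sequence up to every \<open>\<epsilon>\<close> by convergent ones,
  stated without differences since values may be infinite.\<close>

lemma ennreal_tendsto_approx: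
  fixes a :: "nat \<Rightarrow> ennreal"
  assumes "\<And>\<epsilon>. 0 < \<epsilon> \<Longrightarrow> \<exists>b b'. b \<longlonglongrightarrow> b' \<and> (\<forall>\<^sub>F n in sequentially. a n \<le> b n + ennreal \<epsilon>) \<and>
    (\<forall>\<^sub>F n in sequentially. b n \<le> a n + ennreal \<epsilon>) \<and> l \<le> b' + ennreal \<epsilon> \<and> b' \<le> l + ennreal \<epsilon>"
  shows "a \<longlonglongrightarrow> l"
proof -
  have half: "ennreal (e / 2) + ennreal (e / 2) = ennreal e" if "0 < e" for e
    using that by (simp add: ennreal_plus[symmetric] del: ennreal_plus)
  have "limsup a \<le> l"
  proof (rule ennreal_le_epsilon)
    fix e :: real assume e: "0 < e"
    then obtain b b' where b: "b \<longlonglongrightarrow> b'" "\<forall>\<^sub>F n in sequentially. a n \<le> b n + ennreal (e / 2)" "b' \<le> l +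
        ennreal (e / 2)"
      using assms[of "e / 2"] by auto
    have "(\<lambda>n. b n + ennreal (e / 2)) \<longlonglongrightarrow> b' + ennreal (e / 2)"
      by (intro tendsto_add b(1) tendsto_const)
    then have "limsup (\<lambda>n. b n + ennreal (e / 2)) = b' + ennreal (e / 2)"
      by (intro lim_imp_Limsup) auto
    then have "limsup a \<le> b' + ennreal (e / 2)" using Limsup_mono[OF b(2)] by simp
    also have "\<dots> \<le> l + ennreal (e / 2) + ennreal (e / 2)" using b(3) by (rule add_right_mono)
    finally show "limsup a \<le> l + ennreal e" by (simp add: add.assoc half[OF e])
  qed
  moreover have "l \<le> liminf a"
  proof (rule ennreal_le_epsilon)
    fix e :: real assume e: "0 < e"
    then obtain b b' where b: "b \<longlonglongrightarrow> b'" "\<forall>\<^sub>F n in sequentially. b n \<le> a n + ennreal (e / 2)" "l \<le> b' +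
        ennreal (e / 2)"
      using assms[of "e / 2"] by auto
    have "b' = liminf b" using lim_imp_Liminf[OF _ b(1)] by simp
    also have "\<dots> \<le> liminf (\<lambda>n. a n + ennreal (e / 2))" by (rule Liminf_mono[OF b(2)])
    also have "\<dots> = liminf a + ennreal (e / 2)"
      by (rule Liminf_add_const) auto
    finally have "l \<le> liminf a + ennreal (e / 2) + ennreal (e / 2)" using b(3) by (meson add_right_mono
        order_trans)
    then show "l \<le> liminf a + ennreal e" by (simp add: add.assoc half[OF e])
  qed
  moreover have "liminf a \<le> limsup a" by (rule Liminf_le_Limsup) simp
  ultimately have "liminf a = l" "limsup a = l" by auto
  then show ?thesis by (intro Liminf_eq_Limsup) simp_all
qed

definition on :: "nat set \<Rightarrow> (nat \<Rightarrow> real) \<Rightarrow> nat \<Rightarrow> real" where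
  "on A v x = (if x \<in> A then v x else 0)"

lemma on_UNIV [simp]: "on UNIV v = v" by (simp add: on_def fun_eq_iff)

lemma sqrt_threshold:
  fixes u d :: real
  assumes "0 < n" "0 < d" "sqrt n * d < \<bar>u\<bar>"
  shows "1 \<le> \<bar>u\<bar> powr 2 * (1 / (real n * d\<^sup>2))"
proof -
  have "(sqrt n * d)\<^sup>2 \<le> \<bar>u\<bar>\<^sup>2" using assms by (intro power_mono) auto
  then show ?thesis using assms by (simp add: abs_powr_2 power_mult_distrib)
qed

text \<open>The common interface of power and supremum losses. \<open>\<phi> m\<close> is the finite
  loss of the first \<open>m\<close> coordinates: Lipschitz after truncation, for the central limit
  theorem, and with bounded second moments, to undo the truncation. What lies beyond a suitable
  strict cut is small in mean, uniformly in \<open>n\<close>.\<close>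

locale risk_functional = sampling_limit M p X N Y + decreasing_pmf p
  for M :: "'a measure" and p X and N :: "'b measure" and Y +
  fixes \<Phi> :: "(nat \<Rightarrow> real) \<Rightarrow> ennreal" and \<phi> :: "nat \<Rightarrow> (nat \<Rightarrow> real) \<Rightarrow> real"
  assumes dom_tail: "(\<And>L0. \<exists>L\<ge>L0. dominated {a..<L} u v) \<Longrightarrow> \<Phi> (on {a..} u) \<le> \<Phi> (on {a..} v)"
    and dom_head: "dominated {0..<m} u v \<Longrightarrow> \<phi> m u \<le> \<phi> m v"
    and head: "\<Phi> (on {..<m} v) = ennreal (\<phi> m v)"
    and nonneg: "0 \<le> \<phi> m v"
    and split: "\<Phi> v \<le> \<Phi> (on {..<m} v) + \<Phi> (on {m..} v)"
    and on_le: "\<Phi> (on A v) \<le> \<Phi> v"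
    and meas: "\<And>f :: nat \<Rightarrow> 'a \<Rightarrow> real. (\<And>x. f x \<in> borel_measurable M) \<Longrightarrow> (\<lambda>\<omega>. \<Phi> (\<lambda>x. f x \<omega>)) \<in> borel_measurable M"
      "\<And>f :: nat \<Rightarrow> 'b \<Rightarrow> real. (\<And>x. f x \<in> borel_measurable N) \<Longrightarrow> (\<lambda>\<omega>. \<Phi> (\<lambda>x. f x \<omega>)) \<in> borel_measurable N"
    and lip: "0 < K \<Longrightarrow> coord_lipschitz m (\<lambda>v. min (\<phi> m v) K)"
    and sq: "\<exists>C. (\<forall>n. (\<integral>\<^sup>+\<omega>. ennreal ((\<phi> m (V n \<omega>))\<^sup>2) \<partial>M) \<le> ennreal C) \<and>
      (\<integral>\<^sup>+\<omega>. ennreal ((\<phi> m (\<lambda>x. Y x \<omega>))\<^sup>2) \<partial>N) \<le> ennreal C"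
    and tail: "0 < \<epsilon> \<Longrightarrow> \<exists>m. cut p m \<and> (\<forall>n. (\<integral>\<^sup>+\<omega>. \<Phi> (on {m..} (V n \<omega>)) \<partial>M) \<le> ennreal \<epsilon>) \<and>
      (\<integral>\<^sup>+\<omega>. \<Phi> (on {m..} (\<lambda>x. Y x \<omega>)) \<partial>N) \<le> ennreal \<epsilon>"
begin

text \<open>For \<open>n \<ge> 1\<close>, the event that some empirical frequency is further than
  \<open>d\<close> from \<open>p\<close>; outside it the localization lemmas apply.\<close>

definition bad :: "real \<Rightarrow> nat \<Rightarrow> 'a set" where
  "bad d n = {\<omega> \<in> space M. \<exists>x. sqrt n * d < \<bar>V n \<omega> x\<bar>}"

lemma bad_sets [measurable]: "bad d n \<in> sets M"
  unfolding bad_def by measurable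

lemma sq_bound:
  obtains C where "0 < C" "\<And>n. (\<integral>\<^sup>+\<omega>. ennreal ((\<phi> m (V n \<omega>))\<^sup>2) \<partial>M) \<le> ennreal C"
    "(\<integral>\<^sup>+\<omega>. ennreal ((\<phi> m (Yv \<omega>))\<^sup>2) \<partial>N) \<le> ennreal C"
proof -
  obtain C where C: "\<And>n. (\<integral>\<^sup>+\<omega>. ennreal ((\<phi> m (V n \<omega>))\<^sup>2) \<partial>M) \<le> ennreal C"
    "(\<integral>\<^sup>+\<omega>. ennreal ((\<phi> m (Yv \<omega>))\<^sup>2) \<partial>N) \<le> ennreal C" using sq by blast
  have "ennreal C \<le> ennreal (max C 1)" by (simp add: ennreal_leI)
  then show ?thesis
    using order_trans[OF C(1)] order_trans[OF C(2)] by (intro that[of "max C 1"]) simp_all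
qed

text \<open>Chebyshev's inequality in each coordinate and a union bound: the variances are bounded
  by multiples of \<open>pmf p x\<close>, so infinitely many coordinates still sum to order
  \<open>1 / n\<close>.\<close>

lemma bad_tendsto:
  assumes d: "0 < d"
  shows "(\<lambda>n. emeasure M (bad d n)) \<longlonglongrightarrow> 0"
proof -
  obtain C where C: "0 < C" "\<And>n x. (\<integral>\<^sup>+\<omega>. ennreal (\<bar>V n \<omega> x\<bar> powr 2) \<partial>M) \<le> ennreal (C * pmf p x)"
    by (rule moments[of 2], simp, rule that)
  have s: "summable (\<lambda>x. C * pmf p x)" by (intro summable_mult summable_pmf_nat)
  have "emeasure M (bad d n) \<le> ennreal ((\<Sum>x. C * pmf p x) / d\<^sup>2 * (1 / real n))" if n: "0 < n" for n
  proof -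
    let ?c = "1 / (real n * d\<^sup>2)"
    have "emeasure M (bad d n) = (\<integral>\<^sup>+\<omega>. indicator (bad d n) \<omega> \<partial>M)" by simp
    also have "\<dots> \<le> (\<integral>\<^sup>+\<omega>. (\<Sum>x. ennreal (\<bar>V n \<omega> x\<bar> powr 2) * ennreal ?c) \<partial>M)"
    proof (rule nn_integral_mono)
      fix \<omega>
      show "indicator (bad d n) \<omega> \<le> (\<Sum>x. ennreal (\<bar>V n \<omega> x\<bar> powr 2) * ennreal ?c)"
      proof (cases "\<omega> \<in> bad d n")
        case True
        then obtain x where x: "sqrt n * d < \<bar>V n \<omega> x\<bar>" by (auto simp: bad_def)
        have "(1::ennreal) = ennreal 1" by simp
        also have "\<dots> \<le> ennreal (\<bar>V n \<omega> x\<bar> powr 2 * ?c)"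
          using sqrt_threshold[OF n d x] by (rule ennreal_leI)
        also have "\<dots> = ennreal (\<bar>V n \<omega> x\<bar> powr 2) * ennreal ?c" by (rule ennreal_mult) auto
        also have "\<dots> = (\<Sum>x\<in>{x}. ennreal (\<bar>V n \<omega> x\<bar> powr 2) * ennreal ?c)" by simp
        also have "\<dots> \<le> (\<Sum>x. ennreal (\<bar>V n \<omega> x\<bar> powr 2) * ennreal ?c)" by (rule sum_le_suminf) auto
        finally show ?thesis using True by simp
      qed simp
    qed
    also have "\<dots> = (\<Sum>x. (\<integral>\<^sup>+\<omega>. ennreal (\<bar>V n \<omega> x\<bar> powr 2) \<partial>M) * ennreal ?c)"
      by (subst nn_integral_suminf) (auto simp: nn_integral_multc)
    also have "\<dots> \<le> (\<Sum>x. ennreal (C * pmf p x * ?c))"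
    proof (rule suminf_le)
      fix x
      have "(\<integral>\<^sup>+\<omega>. ennreal (\<bar>V n \<omega> x\<bar> powr 2) \<partial>M) * ennreal ?c \<le> ennreal (C * pmf p x) * ennreal ?c"
        by (intro mult_right_mono C) simp
      also have "\<dots> = ennreal (C * pmf p x * ?c)" using C(1) by (intro ennreal_mult[symmetric]) auto
      finally show "(\<integral>\<^sup>+\<omega>. ennreal (\<bar>V n \<omega> x\<bar> powr 2) \<partial>M) * ennreal ?c \<le> ennreal (C * pmf p x * ?c)" .
    qed auto
    also have "\<dots> = ennreal (\<Sum>x. C * pmf p x * ?c)"
      using C(1) s by (intro suminf_ennreal2 summable_mult2) auto
    also have "(\<Sum>x. C * pmf p x * ?c) = (\<Sum>x. C * pmf p x) * ?c"
      by (rule suminf_mult2[symmetric]) (rule s)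
    also have "\<dots> = (\<Sum>x. C * pmf p x) / d\<^sup>2 * (1 / real n)" by simp
    finally show ?thesis .
  qed
  note bound = this
  have ev: "\<forall>\<^sub>F n in sequentially. emeasure M (bad d n) \<le> ennreal ((\<Sum>x. C * pmf p x) / d\<^sup>2 * (1 / real n))"
    by (rule eventually_mono[OF eventually_gt_at_top[of 0] bound])
  have "(\<lambda>n. (\<Sum>x. C * pmf p x) / d\<^sup>2 * (1 / real n)) \<longlonglongrightarrow> (\<Sum>x. C * pmf p x) / d\<^sup>2 * 0"
    by (intro tendsto_mult tendsto_const lim_1_over_n)
  then have "(\<lambda>n. ennreal ((\<Sum>x. C * pmf p x) / d\<^sup>2 * (1 / real n))) \<longlonglongrightarrow> ennreal 0"
    by (intro tendsto_ennrealI) simp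
  then show ?thesis using ev by (intro tendsto_sandwich[OF _ ev tendsto_const]) auto
qed

lemma head_measurable:
  assumes "\<And>x. x < m \<Longrightarrow> (\<lambda>\<omega>. U \<omega> x) \<in> borel_measurable M"
  shows "(\<lambda>\<omega>. ennreal (\<phi> m (U \<omega>))) \<in> borel_measurable M"
  unfolding head[symmetric]
proof (rule meas(1))
  show "(\<lambda>\<omega>. on {..<m} (U \<omega>) x) \<in> borel_measurable M" for x
    using assms by (cases "x < m") (auto simp: on_def)
qed

lemma head_measurable_N:
  assumes "\<And>x. x < m \<Longrightarrow> (\<lambda>\<omega>. U \<omega> x) \<in> borel_measurable N"
  shows "(\<lambda>\<omega>. ennreal (\<phi> m (U \<omega>))) \<in> borel_measurable N"
  unfolding head[symmetric]
proof (rule meas(2))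
  show "(\<lambda>\<omega>. on {..<m} (U \<omega>) x) \<in> borel_measurable N" for x
    using assms by (cases "x < m") (auto simp: on_def)
qed

lemma sq_measurable:
  "(\<lambda>\<omega>. ennreal ((\<phi> m (V n \<omega>))\<^sup>2)) \<in> borel_measurable M"
  "(\<lambda>\<omega>. ennreal ((\<phi> m (Yv \<omega>))\<^sup>2)) \<in> borel_measurable N"
  using head_measurable[of m "V n"] head_measurable_N[of m Yv] nonneg
  by (simp_all add: ennreal_power[symmetric])

lemma head_bad:
  assumes d: "0 < d" and \<epsilon>: "0 < \<epsilon>"
  shows "\<forall>\<^sub>F n in sequentially. (\<integral>\<^sup>+\<omega>. ennreal (\<phi> m (V n \<omega>)) * indicator (bad d n) \<omega> \<partial>M) \<le> ennreal \<epsilon>"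
proof -
  obtain C where C: "0 < C" "\<And>n. (\<integral>\<^sup>+\<omega>. ennreal ((\<phi> m (V n \<omega>))\<^sup>2) \<partial>M) \<le> ennreal C"
    by (rule sq_bound[of m], rule that)
  \<comment> \<open>With this threshold the second-moment part \<open>C / a\<close> is
    \<open>\<epsilon> / 2\<close>; the rest is \<open>a\<close> times the vanishing probability of
    the bad event.\<close>
  define a where "a = 2 * C / \<epsilon>"
  have a: "0 < a" using C \<epsilon> by (simp add: a_def)
  have le: "(\<integral>\<^sup>+\<omega>. ennreal (\<phi> m (V n \<omega>)) * indicator (bad d n) \<omega> \<partial>M)
      \<le> ennreal a * emeasure M (bad d n) + ennreal (\<epsilon> / 2)" for n
  proof -
    have pt: "ennreal (\<phi> m v) * i \<le> ennreal a * i + ennreal ((\<phi> m v)\<^sup>2) * ennreal (1 / a)" if "i = 0 \<or> i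
        = 1" for v i
      using ennreal_le_add_square[OF a, of "\<phi> m v"] that by auto
    have "(\<integral>\<^sup>+\<omega>. ennreal (\<phi> m (V n \<omega>)) * indicator (bad d n) \<omega> \<partial>M)
        \<le> (\<integral>\<^sup>+\<omega>. ennreal a * indicator (bad d n) \<omega> + ennreal ((\<phi> m (V n \<omega>))\<^sup>2) * ennreal (1 / a) \<partial>M)"
      by (intro nn_integral_mono pt) (auto simp: indicator_def)
    also have "\<dots> = ennreal a * emeasure M (bad d n) + (\<integral>\<^sup>+\<omega>. ennreal ((\<phi> m (V n \<omega>))\<^sup>2) \<partial>M) * ennreal (1 / a)"
      using sq_measurable(1) by (subst nn_integral_add) (auto simp: nn_integral_cmult_indicator
          nn_integral_multc)
    also have "\<dots> \<le> ennreal a * emeasure M (bad d n) + ennreal C * ennreal (1 / a)"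
      by (intro add_left_mono mult_right_mono C) simp
    also have "ennreal C * ennreal (1 / a) = ennreal (\<epsilon> / 2)"
      using C(1) \<epsilon> by (simp add: ennreal_mult[symmetric] a_def)
    finally show ?thesis .
  qed
  have "(\<lambda>n. ennreal a * emeasure M (bad d n)) \<longlonglongrightarrow> ennreal a * 0"
    by (rule ennreal_tendsto_cmult[OF _ bad_tendsto[OF d]]) simp
  then have "\<forall>\<^sub>F n in sequentially. ennreal a * emeasure M (bad d n) < ennreal (\<epsilon> / 2)"
    using \<epsilon> by (intro order_tendstoD(2)) auto
  then show ?thesis
  proof (rule eventually_mono)
    fix n assume "ennreal a * emeasure M (bad d n) < ennreal (\<epsilon> / 2)"
    then have "(\<integral>\<^sup>+\<omega>. ennreal (\<phi> m (V n \<omega>)) * indicator (bad d n) \<omega> \<partial>M) \<le> ennreal (\<epsilon> / 2) + ennreal (\<epsilon> / 2)"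
      by (intro order_trans[OF le add_right_mono]) simp
    also have "\<dots> = ennreal \<epsilon>" using \<epsilon> by (simp add: ennreal_plus[symmetric] del: ennreal_plus)
    finally show "(\<integral>\<^sup>+\<omega>. ennreal (\<phi> m (V n \<omega>)) * indicator (bad d n) \<omega> \<partial>M) \<le> ennreal \<epsilon>" .
  qed
qed

lemma coord_measurable:
  assumes "coord_lipschitz m F"
  shows "(\<lambda>\<omega>. F (V n \<omega>)) \<in> borel_measurable M" "(\<lambda>\<omega>. F (Yv \<omega>)) \<in> borel_measurable N"
  by (rule borel_measurable_continuous_coords[OF coord_lipschitz_continuous[OF assms]]; measurable)+

text \<open>The loss is truncated at \<open>K\<close> to become Lipschitz. Domination gives
  \<open>\<phi> m (T v) \<le> \<phi> m v\<close>, so the truncation error is controlled by the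
  second moment of the untransformed loss.\<close>

lemma head_limit:
  assumes T: "\<And>x. x < m \<Longrightarrow> coord_lipschitz m (\<lambda>y. T y x)" and dom: "\<And>y. dominated {0..<m} (T y) y"
  shows "(\<lambda>n. \<integral>\<^sup>+\<omega>. ennreal (\<phi> m (T (V n \<omega>))) \<partial>M) \<longlonglongrightarrow> (\<integral>\<^sup>+\<omega>. ennreal (\<phi> m (T (Yv \<omega>))) \<partial>N)"
proof (rule ennreal_tendsto_approx)
  fix \<epsilon> :: real assume \<epsilon>: "0 < \<epsilon>"
  obtain C where C: "0 < C" "\<And>n. (\<integral>\<^sup>+\<omega>. ennreal ((\<phi> m (V n \<omega>))\<^sup>2) \<partial>M) \<le> ennreal C"
    "(\<integral>\<^sup>+\<omega>. ennreal ((\<phi> m (Yv \<omega>))\<^sup>2) \<partial>N) \<le> ennreal C"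
    by (rule sq_bound[of m], rule that)
  \<comment> \<open>Makes the truncation error \<open>C / K\<close> equal to
    \<open>\<epsilon>\<close>.\<close>
  define K where "K = C / \<epsilon>"
  have K: "0 < K" "C * (1 / K) = \<epsilon>" using C \<epsilon> by (auto simp: K_def)
  define g where "g v = min (\<phi> m (T v)) K" for v
  have g: "coord_lipschitz m g" unfolding g_def by (rule coord_lipschitz_comp[OF lip[OF K(1)] T])
  have g0: "0 \<le> g v" "norm (g v) \<le> K" for v using nonneg[of m "T v"] K by (auto simp: g_def)
  have gi: "(\<integral>\<^sup>+\<omega>. ennreal (g (V n \<omega>)) \<partial>M) = ennreal (\<integral>\<omega>. g (V n \<omega>) \<partial>M)" for n
    by (intro nn_integral_eq_integral AE_I2 g0(1) integrable_bounded[OF coord_measurable(1)[OF g] g0(2)])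
  have giN: "(\<integral>\<^sup>+\<omega>. ennreal (g (Yv \<omega>)) \<partial>N) = ennreal (\<integral>\<omega>. g (Yv \<omega>) \<partial>N)"
    by (intro nn_integral_eq_integral AE_I2 g0(1) N.integrable_bounded[OF coord_measurable(2)[OF g] g0(2)])
  have lo: "ennreal (g v) \<le> ennreal (\<phi> m (T v))" for v by (simp add: g_def ennreal_leI)
  have hi: "ennreal (\<phi> m (T v)) \<le> ennreal (g v) + ennreal ((\<phi> m v)\<^sup>2) * ennreal (1 / K)" for v
  proof -
    have "\<phi> m (T v) \<le> g v + (\<phi> m v)\<^sup>2 * (1 / K)"
      using le_add_square[OF K(1), of "\<phi> m v"] dom_head[OF dom, of v] K(1) unfolding g_def
      by (cases "\<phi> m (T v) \<le> K") auto
    then have "ennreal (\<phi> m (T v)) \<le> ennreal (g v + (\<phi> m v)\<^sup>2 * (1 / K))" by (rule ennreal_leI)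
    also have "\<dots> = ennreal (g v) + ennreal ((\<phi> m v)\<^sup>2) * ennreal (1 / K)"
      using K g0(1)[of v] by (simp add: ennreal_mult[symmetric] ennreal_plus[symmetric] del: ennreal_plus)
    finally show ?thesis .
  qed
  have up: "(\<integral>\<^sup>+\<omega>. ennreal (\<phi> m (T (W \<omega>))) \<partial>Q) \<le> (\<integral>\<^sup>+\<omega>. ennreal (g (W \<omega>)) \<partial>Q) + ennreal \<epsilon>"
    if m: "(\<lambda>\<omega>. g (W \<omega>)) \<in> borel_measurable Q" "(\<lambda>\<omega>. ennreal ((\<phi> m (W \<omega>))\<^sup>2)) \<in> borel_measurable Q"
      and b: "(\<integral>\<^sup>+\<omega>. ennreal ((\<phi> m (W \<omega>))\<^sup>2) \<partial>Q) \<le> ennreal C" for W and Q :: "'c measure"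
  proof -
    have "(\<integral>\<^sup>+\<omega>. ennreal (\<phi> m (T (W \<omega>))) \<partial>Q) \<le> (\<integral>\<^sup>+\<omega>. ennreal (g (W \<omega>)) + ennreal ((\<phi> m (W \<omega>))\<^sup>2) *
        ennreal (1 / K) \<partial>Q)"
      by (intro nn_integral_mono hi)
    also have "\<dots> = (\<integral>\<^sup>+\<omega>. ennreal (g (W \<omega>)) \<partial>Q) + (\<integral>\<^sup>+\<omega>. ennreal ((\<phi> m (W \<omega>))\<^sup>2) \<partial>Q) * ennreal (1 / K)"
      using m by (subst nn_integral_add) (auto simp: nn_integral_multc)
    also have "\<dots> \<le> (\<integral>\<^sup>+\<omega>. ennreal (g (W \<omega>)) \<partial>Q) + ennreal C * ennreal (1 / K)"
      by (intro add_left_mono mult_right_mono b) simp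
    also have "ennreal C * ennreal (1 / K) = ennreal \<epsilon>"
      using C(1) K by (simp only: ennreal_mult[symmetric] less_imp_le divide_nonneg_pos zero_le_one)
    finally show ?thesis .
  qed
  show "\<exists>b b'. b \<longlonglongrightarrow> b' \<and>
      (\<forall>\<^sub>F n in sequentially. (\<integral>\<^sup>+\<omega>. ennreal (\<phi> m (T (V n \<omega>))) \<partial>M) \<le> b n + ennreal \<epsilon>) \<and>
      (\<forall>\<^sub>F n in sequentially. b n \<le> (\<integral>\<^sup>+\<omega>. ennreal (\<phi> m (T (V n \<omega>))) \<partial>M) + ennreal \<epsilon>) \<and>
      (\<integral>\<^sup>+\<omega>. ennreal (\<phi> m (T (Yv \<omega>))) \<partial>N) \<le> b' + ennreal \<epsilon> \<and>
      b' \<le> (\<integral>\<^sup>+\<omega>. ennreal (\<phi> m (T (Yv \<omega>))) \<partial>N) + ennreal \<epsilon>"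
  proof (intro exI conjI always_eventually allI)
    show "(\<lambda>n. \<integral>\<^sup>+\<omega>. ennreal (g (V n \<omega>)) \<partial>M) \<longlonglongrightarrow> (\<integral>\<^sup>+\<omega>. ennreal (g (Yv \<omega>)) \<partial>N)"
      unfolding gi giN by (intro tendsto_ennrealI lipschitz_clt[OF g])
    show "(\<integral>\<^sup>+\<omega>. ennreal (\<phi> m (T (V n \<omega>))) \<partial>M) \<le> (\<integral>\<^sup>+\<omega>. ennreal (g (V n \<omega>)) \<partial>M) + ennreal \<epsilon>" for n
      by (intro up coord_measurable[OF g] sq_measurable C)
    show "(\<integral>\<^sup>+\<omega>. ennreal (\<phi> m (T (Yv \<omega>))) \<partial>N) \<le> (\<integral>\<^sup>+\<omega>. ennreal (g (Yv \<omega>)) \<partial>N) + ennreal \<epsilon>"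
      by (intro up coord_measurable[OF g] sq_measurable C)
    show "(\<integral>\<^sup>+\<omega>. ennreal (g (V n \<omega>)) \<partial>M) \<le> (\<integral>\<^sup>+\<omega>. ennreal (\<phi> m (T (V n \<omega>))) \<partial>M) + ennreal \<epsilon>" for n
      by (rule order_trans[OF nn_integral_mono[OF lo]]) simp
    show "(\<integral>\<^sup>+\<omega>. ennreal (g (Yv \<omega>)) \<partial>N) \<le> (\<integral>\<^sup>+\<omega>. ennreal (\<phi> m (T (Yv \<omega>))) \<partial>N) + ennreal \<epsilon>"
      by (rule order_trans[OF nn_integral_mono[OF lo]]) simp
  qed
qed

lemma cut_gap:
  obtains d where "0 < d" "\<And>j. 0 < j \<Longrightarrow> j \<le> m \<Longrightarrow> cut p j \<Longrightarrow> 2 * d \<le> pmf p (j - 1) - pmf p j"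
proof -
  \<comment> \<open>The smallest drop at the finitely many cuts up to \<open>m\<close>. The number 1
    keeps the set nonempty, and half of the minimum leaves room for errors on both sides of a
    cut.\<close>
  let ?G = "(\<lambda>j. pmf p (j - 1) - pmf p j) ` {j \<in> {1..m}. cut p j}"
  have fin: "finite (insert 1 ?G)" by auto
  have pos: "0 < x" if "x \<in> insert 1 ?G" for x using that by (auto simp: cut_def)
  have "0 < Min (insert 1 ?G)" using fin pos by (subst Min_gr_iff) auto
  moreover have "Min (insert 1 ?G) \<le> pmf p (j - 1) - pmf p j" if "0 < j" "j \<le> m" "cut p j" for j
    using that fin by (intro Min_le) auto
  ultimately show ?thesis by (intro that[of "Min (insert 1 ?G) / 2"]) auto
qed

text \<open>\<open>U n\<close> is a scaled error and \<open>T\<close> the map that describes its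
  limit. Outside the bad event the two heads dominate each other, so all their convex losses agree
  even if the entries are permuted; on the bad event the head is controlled by that of
  \<open>V n\<close>. Tails are dominated by those of \<open>V n\<close> and
  \<open>Y\<close>.\<close>

theorem risk_limit:
  assumes U: "\<And>n x. (\<lambda>\<omega>. U n \<omega> x) \<in> borel_measurable M"
    and T_lip: "\<And>m x. cut p m \<Longrightarrow> x < m \<Longrightarrow> coord_lipschitz m (\<lambda>y. T y x)"
    and T_meas: "\<And>x. (\<lambda>\<omega>. T (Yv \<omega>) x) \<in> borel_measurable N"
    and T_dom: "\<And>m y. cut p m \<Longrightarrow> dominated {0..<m} (T y) y"
    and T_tail: "\<And>m y L0. cut p m \<Longrightarrow> \<exists>L\<ge>L0. dominated {m..<L} (T y) y"
    and U_dom: "\<And>n \<omega> L0. 1 \<le> n \<Longrightarrow> \<exists>L\<ge>L0. dominated {0..<L} (U n \<omega>) (V n \<omega>)"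
    and good: "\<And>n \<omega> m d. 1 \<le> n \<Longrightarrow> cut p m \<Longrightarrow> (\<And>x. \<bar>V n \<omega> x\<bar> \<le> sqrt n * d) \<Longrightarrow>
      (\<And>j. 0 < j \<Longrightarrow> j \<le> m \<Longrightarrow> cut p j \<Longrightarrow> 2 * d \<le> pmf p (j - 1) - pmf p j) \<Longrightarrow>
      dominated {0..<m} (U n \<omega>) (T (V n \<omega>)) \<and> dominated {0..<m} (T (V n \<omega>)) (U n \<omega>) \<and>
      (\<forall>L0. \<exists>L\<ge>L0. dominated {m..<L} (U n \<omega>) (V n \<omega>))"
  shows "(\<lambda>n. \<integral>\<^sup>+\<omega>. \<Phi> (U n \<omega>) \<partial>M) \<longlonglongrightarrow> (\<integral>\<^sup>+\<omega>. \<Phi> (T (Yv \<omega>)) \<partial>N)"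
proof (rule ennreal_tendsto_approx)
  fix \<epsilon> :: real assume \<epsilon>: "0 < \<epsilon>"
  obtain m where m: "cut p m" "\<And>n. (\<integral>\<^sup>+\<omega>. \<Phi> (on {m..} (V n \<omega>)) \<partial>M) \<le> ennreal (\<epsilon> / 2)"
    "(\<integral>\<^sup>+\<omega>. \<Phi> (on {m..} (Yv \<omega>)) \<partial>N) \<le> ennreal (\<epsilon> / 2)" using tail[of "\<epsilon> / 2"] \<epsilon> by auto
  obtain d where d: "0 < d" "\<And>j. 0 < j \<Longrightarrow> j \<le> m \<Longrightarrow> cut p j \<Longrightarrow> 2 * d \<le> pmf p (j - 1) - pmf p j"
    by (rule cut_gap[of m], rule that)
  have half: "ennreal (\<epsilon> / 2) + ennreal (\<epsilon> / 2) = ennreal \<epsilon>"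
    using \<epsilon> by (simp add: ennreal_plus[symmetric] del: ennreal_plus)
  have half_le: "ennreal (\<epsilon> / 2) \<le> ennreal \<epsilon>" using \<epsilon> by (simp add: ennreal_leI)
  define c where "c n = (\<integral>\<^sup>+\<omega>. ennreal (\<phi> m (V n \<omega>)) * indicator (bad d n) \<omega> \<partial>M)" for n
  have c: "\<forall>\<^sub>F n in sequentially. c n \<le> ennreal (\<epsilon> / 2) \<and> 1 \<le> n"
    unfolding c_def using head_bad[OF d(1), of "\<epsilon> / 2" m] \<epsilon> eventually_ge_at_top[of 1]
    by (auto intro: eventually_conj)
  have Tm: "(\<lambda>\<omega>. ennreal (\<phi> m (T (V n \<omega>)))) \<in> borel_measurable M" for n
    by (rule head_measurable) (rule coord_measurable(1)[OF T_lip[OF m(1)]])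
  have TmN: "(\<lambda>\<omega>. ennreal (\<phi> m (T (Yv \<omega>)))) \<in> borel_measurable N"
    by (rule head_measurable_N) (rule T_meas)
  have cm: "(\<lambda>\<omega>. ennreal (\<phi> m (V n \<omega>)) * indicator (bad d n) \<omega>) \<in> borel_measurable M" for n
    using head_measurable[of m "V n"] by measurable
  have tm: "(\<lambda>\<omega>. \<Phi> (on {m..} (V n \<omega>))) \<in> borel_measurable M" for n
    by (rule meas(1)) (simp add: on_def)
  have tmN: "(\<lambda>\<omega>. \<Phi> (on {m..} (Yv \<omega>))) \<in> borel_measurable N"
    by (rule meas(2)) (simp add: on_def)
  have UV: "\<Phi> (U n \<omega>) \<le> \<Phi> (V n \<omega>)" if "1 \<le> n" for n \<omega>
    using dom_tail[of 0 "U n \<omega>" "V n \<omega>"] U_dom[OF that] by simp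
  have gd: "\<bar>V n \<omega> x\<bar> \<le> sqrt n * d" if "\<omega> \<in> space M" "\<omega> \<notin> bad d n" for n \<omega> x
    using that by (auto simp: bad_def not_less)
  \<comment> \<open>The last summand pays for the bad event, where only domination of the whole
    error by \<open>V n\<close> is available.\<close>
  have up: "\<Phi> (U n \<omega>) \<le> ennreal (\<phi> m (T (V n \<omega>))) + \<Phi> (on {m..} (V n \<omega>)) + ennreal (\<phi> m (V n \<omega>)) *
      indicator (bad d n) \<omega>"
    if n: "1 \<le> n" and \<omega>: "\<omega> \<in> space M" for n \<omega>
  proof (cases "\<omega> \<in> bad d n")
    case True
    have "\<Phi> (U n \<omega>) \<le> ennreal (\<phi> m (V n \<omega>)) + \<Phi> (on {m..} (V n \<omega>))"
      using order_trans[OF UV[OF n] split[of _ m]] by (simp add: head)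
    also have "\<dots> \<le> ennreal (\<phi> m (T (V n \<omega>))) + \<Phi> (on {m..} (V n \<omega>)) + ennreal (\<phi> m (V n \<omega>))"
      by (simp add: add.commute add_increasing)
    finally show ?thesis using True by simp
  next
    case False
    note g = good[OF n m(1) gd[OF \<omega> False] d(2)]
    have "\<Phi> (U n \<omega>) \<le> ennreal (\<phi> m (U n \<omega>)) + \<Phi> (on {m..} (U n \<omega>))"
      using split[of "U n \<omega>" m] by (simp add: head)
    also have "\<dots> \<le> ennreal (\<phi> m (T (V n \<omega>))) + \<Phi> (on {m..} (V n \<omega>))"
      using g by (intro add_mono ennreal_leI dom_head dom_tail) auto
    finally show ?thesis using False by simp
  qed
  \<comment> \<open>The tail is simply dropped here; on the bad event the head of
    \<open>T (V n)\<close> is bounded by that of \<open>V n\<close>.\<close>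
  have lo: "ennreal (\<phi> m (T (V n \<omega>))) \<le> \<Phi> (U n \<omega>) + ennreal (\<phi> m (V n \<omega>)) * indicator (bad d n) \<omega>"
    if n: "1 \<le> n" and \<omega>: "\<omega> \<in> space M" for n \<omega>
  proof (cases "\<omega> \<in> bad d n")
    case True
    have "ennreal (\<phi> m (T (V n \<omega>))) \<le> ennreal (\<phi> m (V n \<omega>))"
      by (intro ennreal_leI dom_head T_dom m)
    then show ?thesis using True by (simp add: add_increasing)
  next
    case False
    note g = good[OF n m(1) gd[OF \<omega> False] d(2)]
    have "ennreal (\<phi> m (T (V n \<omega>))) \<le> ennreal (\<phi> m (U n \<omega>))"
      using g by (intro ennreal_leI dom_head) auto
    also have "\<dots> \<le> \<Phi> (U n \<omega>)" unfolding head[symmetric] by (rule on_le)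
    finally show ?thesis using False by simp
  qed
  show "\<exists>b b'. b \<longlonglongrightarrow> b' \<and>
      (\<forall>\<^sub>F n in sequentially. (\<integral>\<^sup>+\<omega>. \<Phi> (U n \<omega>) \<partial>M) \<le> b n + ennreal \<epsilon>) \<and>
      (\<forall>\<^sub>F n in sequentially. b n \<le> (\<integral>\<^sup>+\<omega>. \<Phi> (U n \<omega>) \<partial>M) + ennreal \<epsilon>) \<and>
      (\<integral>\<^sup>+\<omega>. \<Phi> (T (Yv \<omega>)) \<partial>N) \<le> b' + ennreal \<epsilon> \<and> b' \<le> (\<integral>\<^sup>+\<omega>. \<Phi> (T (Yv \<omega>)) \<partial>N) + ennreal \<epsilon>"
  proof (intro exI conjI)
    show "(\<lambda>n. \<integral>\<^sup>+\<omega>. ennreal (\<phi> m (T (V n \<omega>))) \<partial>M) \<longlonglongrightarrow> (\<integral>\<^sup>+\<omega>. ennreal (\<phi> m (T (Yv \<omega>))) \<partial>N)"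
      by (rule head_limit[OF T_lip[OF m(1)] T_dom[OF m(1)]])
    show "\<forall>\<^sub>F n in sequentially. (\<integral>\<^sup>+\<omega>. \<Phi> (U n \<omega>) \<partial>M) \<le> (\<integral>\<^sup>+\<omega>. ennreal (\<phi> m (T (V n \<omega>))) \<partial>M) + ennreal \<epsilon>"
      using c
    proof (rule eventually_mono)
      fix n assume n: "c n \<le> ennreal (\<epsilon> / 2) \<and> 1 \<le> n"
      have "(\<integral>\<^sup>+\<omega>. \<Phi> (U n \<omega>) \<partial>M) \<le> (\<integral>\<^sup>+\<omega>. ennreal (\<phi> m (T (V n \<omega>))) + \<Phi> (on {m..} (V n \<omega>))
          + ennreal (\<phi> m (V n \<omega>)) * indicator (bad d n) \<omega> \<partial>M)"
        using n by (intro nn_integral_mono up) auto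
      also have "\<dots> = (\<integral>\<^sup>+\<omega>. ennreal (\<phi> m (T (V n \<omega>))) \<partial>M) + (\<integral>\<^sup>+\<omega>. \<Phi> (on {m..} (V n \<omega>)) \<partial>M) + c n"
        unfolding c_def using Tm tm cm by (subst nn_integral_add, simp, simp, subst nn_integral_add) auto
      also have "\<dots> \<le> (\<integral>\<^sup>+\<omega>. ennreal (\<phi> m (T (V n \<omega>))) \<partial>M) + ennreal (\<epsilon> / 2) + ennreal (\<epsilon> / 2)"
        using n m(2) by (intro add_mono) auto
      finally show "(\<integral>\<^sup>+\<omega>. \<Phi> (U n \<omega>) \<partial>M) \<le> (\<integral>\<^sup>+\<omega>. ennreal (\<phi> m (T (V n \<omega>))) \<partial>M) + ennreal \<epsilon>"
        by (simp only: add.assoc half)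
    qed
    show "\<forall>\<^sub>F n in sequentially. (\<integral>\<^sup>+\<omega>. ennreal (\<phi> m (T (V n \<omega>))) \<partial>M) \<le> (\<integral>\<^sup>+\<omega>. \<Phi> (U n \<omega>) \<partial>M) + ennreal \<epsilon>"
      using c
    proof (rule eventually_mono)
      fix n assume n: "c n \<le> ennreal (\<epsilon> / 2) \<and> 1 \<le> n"
      have "(\<integral>\<^sup>+\<omega>. ennreal (\<phi> m (T (V n \<omega>))) \<partial>M)
          \<le> (\<integral>\<^sup>+\<omega>. \<Phi> (U n \<omega>) + ennreal (\<phi> m (V n \<omega>)) * indicator (bad d n) \<omega> \<partial>M)"
        using n by (intro nn_integral_mono lo) auto
      also have "\<dots> = (\<integral>\<^sup>+\<omega>. \<Phi> (U n \<omega>) \<partial>M) + c n"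
        unfolding c_def using meas(1)[OF U] cm by (subst nn_integral_add) auto
      also have "\<dots> \<le> (\<integral>\<^sup>+\<omega>. \<Phi> (U n \<omega>) \<partial>M) + ennreal \<epsilon>"
        using n half_le by (intro add_left_mono) auto
      finally show "(\<integral>\<^sup>+\<omega>. ennreal (\<phi> m (T (V n \<omega>))) \<partial>M) \<le> (\<integral>\<^sup>+\<omega>. \<Phi> (U n \<omega>) \<partial>M) + ennreal \<epsilon>" .
    qed
    show "(\<integral>\<^sup>+\<omega>. \<Phi> (T (Yv \<omega>)) \<partial>N) \<le> (\<integral>\<^sup>+\<omega>. ennreal (\<phi> m (T (Yv \<omega>))) \<partial>N) + ennreal \<epsilon>"
    proof -
      have "\<Phi> (T y) \<le> ennreal (\<phi> m (T y)) + \<Phi> (on {m..} y)" for y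
        using order_trans[OF split[of "T y" m] add_left_mono[OF dom_tail[OF T_tail[OF m(1)]]]] by (simp
            add: head)
      then have "(\<integral>\<^sup>+\<omega>. \<Phi> (T (Yv \<omega>)) \<partial>N) \<le> (\<integral>\<^sup>+\<omega>. ennreal (\<phi> m (T (Yv \<omega>))) + \<Phi> (on {m..} (Yv \<omega>)) \<partial>N)"
        by (intro nn_integral_mono)
      also have "\<dots> = (\<integral>\<^sup>+\<omega>. ennreal (\<phi> m (T (Yv \<omega>))) \<partial>N) + (\<integral>\<^sup>+\<omega>. \<Phi> (on {m..} (Yv \<omega>)) \<partial>N)"
        using TmN tmN by (rule nn_integral_add)
      also have "\<dots> \<le> (\<integral>\<^sup>+\<omega>. ennreal (\<phi> m (T (Yv \<omega>))) \<partial>N) + ennreal \<epsilon>"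
        using order_trans[OF m(3) half_le] by (rule add_left_mono)
      finally show ?thesis .
    qed
    show "(\<integral>\<^sup>+\<omega>. ennreal (\<phi> m (T (Yv \<omega>))) \<partial>N) \<le> (\<integral>\<^sup>+\<omega>. \<Phi> (T (Yv \<omega>)) \<partial>N) + ennreal \<epsilon>"
      by (rule order_trans[OF nn_integral_mono[OF on_le[of "{..<m}", unfolded head]]]) simp
  qed
qed

text \<open>Besides making the limits finite, this is what lets a pointwise strict inequality
  survive integration.\<close>

lemma finite_limit: "(\<integral>\<^sup>+\<omega>. \<Phi> (Yv \<omega>) \<partial>N) < \<infinity>"
proof -
  obtain m where m: "(\<integral>\<^sup>+\<omega>. \<Phi> (on {m..} (Yv \<omega>)) \<partial>N) \<le> ennreal 1" using tail[of 1] by auto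
  obtain C where C: "0 < C" "(\<integral>\<^sup>+\<omega>. ennreal ((\<phi> m (Yv \<omega>))\<^sup>2) \<partial>N) \<le> ennreal C"
    by (rule sq_bound[of m], rule that)
  have pt: "\<Phi> y \<le> (1 + ennreal ((\<phi> m y)\<^sup>2)) + \<Phi> (on {m..} y)" for y
  proof -
    have "ennreal (\<phi> m y) \<le> ennreal (1 + (\<phi> m y)\<^sup>2)"
      using le_add_square[of 1 "\<phi> m y"] by (intro ennreal_leI) simp
    then have "ennreal (\<phi> m y) \<le> 1 + ennreal ((\<phi> m y)\<^sup>2)" by simp
    then show ?thesis using order_trans[OF split[of y m] add_right_mono] by (simp add: head)
  qed
  have "(\<integral>\<^sup>+\<omega>. \<Phi> (Yv \<omega>) \<partial>N) \<le> (\<integral>\<^sup>+\<omega>. (1 + ennreal ((\<phi> m (Yv \<omega>))\<^sup>2)) + \<Phi> (on {m..} (Yv \<omega>)) \<partial>N)"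
    by (intro nn_integral_mono pt)
  also have "\<dots> = (1 + (\<integral>\<^sup>+\<omega>. ennreal ((\<phi> m (Yv \<omega>))\<^sup>2) \<partial>N)) + (\<integral>\<^sup>+\<omega>. \<Phi> (on {m..} (Yv \<omega>)) \<partial>N)"
  proof -
    have tmN: "(\<lambda>\<omega>. \<Phi> (on {m..} (Yv \<omega>))) \<in> borel_measurable N"
      by (rule meas(2)) (simp add: on_def)
    have "(\<integral>\<^sup>+\<omega>. 1 + ennreal ((\<phi> m (Yv \<omega>))\<^sup>2) \<partial>N) = (\<integral>\<^sup>+\<omega>. 1 \<partial>N) + (\<integral>\<^sup>+\<omega>. ennreal ((\<phi> m (Yv \<omega>))\<^sup>2) \<partial>N)"
      by (rule nn_integral_add[OF _ sq_measurable(2)]) simp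
    moreover have "(\<integral>\<^sup>+\<omega>. 1 \<partial>N) = 1" by (simp add: N.emeasure_space_1)
    moreover have "(\<lambda>\<omega>. 1 + ennreal ((\<phi> m (Yv \<omega>))\<^sup>2)) \<in> borel_measurable N"
      using sq_measurable(2) by simp
    ultimately show ?thesis using tmN by (simp add: nn_integral_add)
  qed
  also have "\<dots> \<le> (1 + ennreal C) + ennreal 1" by (intro add_mono C m order_refl)
  also have "\<dots> < \<infinity>" by simp
  finally show ?thesis .
qed

end

section \<open>Power losses and the supremum loss\<close>

lemma convex_on_abs_powr:
  assumes k: "1 \<le> k"
  shows "convex_on UNIV (\<lambda>t :: real. \<bar>t\<bar> powr k)"
proof (rule convex_onI)
  fix t x y :: real assume t: "0 < t" "t < 1"
  have scale: "(s * \<bar>z\<bar>) powr k \<le> s * \<bar>z\<bar> powr k" if "0 < s" "s < 1" for s z :: real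
  proof -
    have "s powr k \<le> s powr 1" using that k by (intro powr_mono') auto
    then show ?thesis using that by (simp add: powr_mult mult_right_mono)
  qed
  have "\<bar>(1 - t) * x + t * y\<bar> \<le> \<bar>(1 - t) * x\<bar> + \<bar>t * y\<bar>" by (rule abs_triangle_ineq)
  then have "\<bar>(1 - t) * x + t * y\<bar> powr k \<le> ((1 - t) * \<bar>x\<bar> + t * \<bar>y\<bar>) powr k"
    using t k by (intro powr_mono2) (auto simp: abs_mult)
  also have "\<dots> \<le> (1 - t) * \<bar>x\<bar> powr k + t * \<bar>y\<bar> powr k"
  \<comment> \<open>Convexity of the power function is invoked for positive arguments; at a zero the
    inequality reduces to \<open>s powr k \<le> s\<close> for weights \<open>s\<close> below
    1.\<close>
  proof (cases "x = 0 \<or> y = 0")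
    case True
    then show ?thesis using scale[of "1 - t" x] scale[of t y] t by auto
  next
    case False
    then show ?thesis using convex_onD[OF powr_convex[OF k], of t "\<bar>x\<bar>" "\<bar>y\<bar>"] t by auto
  qed
  finally show "\<bar>(1 - t) *\<^sub>R x + t *\<^sub>R y\<bar> powr k \<le> (1 - t) * \<bar>x\<bar> powr k + t * \<bar>y\<bar> powr k" by simp
qed simp

section \<open>The power loss\<close>

definition power_loss :: "real \<Rightarrow> (nat \<Rightarrow> real) \<Rightarrow> ennreal" where
  "power_loss k v = (\<Sum>x. ennreal (\<bar>v x\<bar> powr k))"

lemma power_loss_head:
  assumes "k \<noteq> 0"
  shows "power_loss k (on {..<m} v) = ennreal (\<Sum>x<m. \<bar>v x\<bar> powr k)"
proof -
  have "power_loss k (on {..<m} v) = (\<Sum>x\<in>{..<m}. ennreal (\<bar>on {..<m} v x\<bar> powr k))"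
    unfolding power_loss_def by (rule suminf_finite) (auto simp: on_def)
  also have "\<dots> = (\<Sum>x\<in>{..<m}. ennreal (\<bar>v x\<bar> powr k))" by (intro sum.cong) (auto simp: on_def)
  also have "\<dots> = ennreal (\<Sum>x<m. \<bar>v x\<bar> powr k)" by (rule sum_ennreal) simp
  finally show ?thesis .
qed

lemma power_loss_tail: "power_loss k (on {m..} v) = (\<Sum>x. ennreal (\<bar>v (x + m)\<bar> powr k))"
proof -
  have "power_loss k (on {m..} v) = (\<Sum>x. ennreal (\<bar>on {m..} v (x + m)\<bar> powr k)) + (\<Sum>x<m. ennreal (\<bar>on
      {m..} v x\<bar> powr k))"
    unfolding power_loss_def by (rule suminf_offset) simp
  moreover have "(\<Sum>x<m. ennreal (\<bar>on {m..} v x\<bar> powr k)) = 0" by (intro sum.neutral) (auto simp: on_def)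
  moreover have "on {m..} v (x + m) = v (x + m)" for x by (simp add: on_def)
  ultimately show ?thesis by (simp only: add_0_right)
qed

lemma power_loss_on_le: "power_loss k (on A v) \<le> power_loss k v"
  unfolding power_loss_def by (intro suminf_le) (auto simp: on_def)

lemma power_loss_split: "power_loss k v \<le> power_loss k (on {..<m} v) + power_loss k (on {m..} v)"
  unfolding power_loss_def
  by (subst suminf_add) (auto intro!: suminf_le simp: on_def)

text \<open>Partial sums of nonnegative terms increase, so domination on arbitrarily long intervals
  is enough for the infinite sum.\<close>

lemma power_loss_tail_mono:
  assumes k: "1 \<le> k" and dom: "\<And>L0. \<exists>L\<ge>L0. dominated {a..<L} u v"
  shows "power_loss k (on {a..} u) \<le> power_loss k (on {a..} v)"
proof -
  have eq: "(\<Sum>x<n. ennreal (\<bar>w (x + a)\<bar> powr k)) = ennreal (\<Sum>x\<in>{a..<n + a}. \<bar>w x\<bar> powr k)" for n and w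
      :: "nat \<Rightarrow> real"
    using sum.shift_bounds_nat_ivl[of "\<lambda>x. \<bar>w x\<bar> powr k" 0 a n] by (simp add: atLeast0LessThan)
  have "(\<Sum>x<n. ennreal (\<bar>u (x + a)\<bar> powr k)) \<le> power_loss k (on {a..} v)" for n
  proof -
    obtain L where L: "n + a \<le> L" "dominated {a..<L} u v" using dom by blast
    have "(\<Sum>x\<in>{a..<n + a}. \<bar>u x\<bar> powr k) \<le> (\<Sum>x\<in>{a..<L}. \<bar>u x\<bar> powr k)"
      using L(1) by (intro sum_mono2) auto
    also have "\<dots> \<le> (\<Sum>x\<in>{a..<L - a + a}. \<bar>v x\<bar> powr k)"
      using L convex_on_abs_powr[OF k] unfolding dominated_def by auto
    finally have "(\<Sum>x<n. ennreal (\<bar>u (x + a)\<bar> powr k)) \<le> (\<Sum>x<L - a. ennreal (\<bar>v (x + a)\<bar> powr k))"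
      unfolding eq by (rule ennreal_leI)
    also have "\<dots> \<le> (\<Sum>x. ennreal (\<bar>v (x + a)\<bar> powr k))" by (rule sum_le_suminf) auto
    finally show ?thesis by (simp only: power_loss_tail)
  qed
  then show ?thesis unfolding power_loss_tail[of k a u] suminf_eq_SUP by (intro SUP_least)
qed

lemma power_loss_measurable:
  "(\<And>x. f x \<in> borel_measurable K) \<Longrightarrow> (\<lambda>\<omega>. power_loss k (\<lambda>x. f x \<omega>)) \<in> borel_measurable K"
  unfolding power_loss_def by measurable

lemma coord_lipschitz_sum:
  fixes n :: nat
  assumes "\<And>x. x < n \<Longrightarrow> coord_lipschitz m (F x)"
  shows "coord_lipschitz m (\<lambda>v. \<Sum>x<n. F x v)"
  using assms
proof (induction n)
  case 0 then show ?case by (auto simp: coord_lipschitz_def)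
next
  case (Suc n)
  obtain C where C: "C \<ge> 0" "\<And>u v. \<bar>(\<Sum>x<n. F x u) - (\<Sum>x<n. F x v)\<bar> \<le> C * (\<Sum>x<m. \<bar>u x - v x\<bar>)"
    using Suc unfolding coord_lipschitz_def by fastforce
  obtain D where D: "D \<ge> 0" "\<And>u v. \<bar>F n u - F n v\<bar> \<le> D * (\<Sum>x<m. \<bar>u x - v x\<bar>)"
    using Suc(2)[of n] unfolding coord_lipschitz_def by blast
  have "\<bar>(\<Sum>x<Suc n. F x u) - (\<Sum>x<Suc n. F x v)\<bar> \<le> (C + D) * (\<Sum>x<m. \<bar>u x - v x\<bar>)" for u v
  proof -
    have "(\<Sum>x<Suc n. F x u) - (\<Sum>x<Suc n. F x v) = ((\<Sum>x<n. F x u) - (\<Sum>x<n. F x v)) + (F n u - F n v)"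
      by simp
    also have "\<bar>\<dots>\<bar> \<le> C * (\<Sum>x<m. \<bar>u x - v x\<bar>) + D * (\<Sum>x<m. \<bar>u x - v x\<bar>)"
      by (intro order_trans[OF abs_triangle_ineq] add_mono C D)
    finally show ?thesis by (simp add: distrib_right)
  qed
  moreover have "0 \<le> C + D" using C D by simp
  ultimately show ?case unfolding coord_lipschitz_def by blast
qed

lemma coord_lipschitz_min:
  assumes "coord_lipschitz m F"
  shows "coord_lipschitz m (\<lambda>v. min (F v) K)"
proof -
  obtain C where C: "C \<ge> 0" "\<And>u v. \<bar>F u - F v\<bar> \<le> C * (\<Sum>x<m. \<bar>u x - v x\<bar>)"
    using assms unfolding coord_lipschitz_def by blast
  have "\<bar>min (F u) K - min (F v) K\<bar> \<le> \<bar>F u - F v\<bar>" for u v by linarith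
  then have "\<bar>min (F u) K - min (F v) K\<bar> \<le> C * (\<Sum>x<m. \<bar>u x - v x\<bar>)" for u v
    by (rule order_trans) (rule C)
  with C(1) show ?thesis unfolding coord_lipschitz_def by blast
qed

lemma power_loss_lipschitz:
  assumes k: "1 \<le> k" and K: "0 < K"
  shows "coord_lipschitz m (\<lambda>v. min (\<Sum>x<m. \<bar>v x\<bar> powr k) K)"
proof -
  \<comment> \<open>Truncating each coordinate at this level does not change the minimum with
    \<open>K\<close>: a single coordinate above \<open>c\<close> already contributes
    \<open>K\<close>. The truncated power is Lipschitz.\<close>
  define c where "c = K powr (1 / k)"
  have c: "0 < c" "c powr k = K" using K k by (auto simp: c_def powr_powr)
  have "coord_lipschitz m (\<lambda>v. \<Sum>x<m. min \<bar>v x\<bar> c powr k)"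
  proof (rule coord_lipschitz_sum)
    fix x assume "x < m"
    then show "coord_lipschitz m (\<lambda>v. min \<bar>v x\<bar> c powr k)"
      using min_powr_lipschitz[OF k, of c] c k
      by (intro coord_lipschitz_coord[of _ _ _ "k * c powr (k - 1)"]) auto
  qed
  then have "coord_lipschitz m (\<lambda>v. min (\<Sum>x<m. min \<bar>v x\<bar> c powr k) K)" by (rule coord_lipschitz_min)
  moreover have "min (\<Sum>x<m. min \<bar>v x\<bar> c powr k) K = min (\<Sum>x<m. \<bar>v x\<bar> powr k) K" for v :: "nat \<Rightarrow> real"
  proof (cases "\<forall>x<m. \<bar>v x\<bar> \<le> c")
    case True
    then have "(\<Sum>x<m. min \<bar>v x\<bar> c powr k) = (\<Sum>x<m. \<bar>v x\<bar> powr k)"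
      by (intro sum.cong) auto
    then show ?thesis by simp
  next
    case False
    then obtain x where x: "x < m" "c < \<bar>v x\<bar>" by auto
    have "K = min \<bar>v x\<bar> c powr k" using x c by simp
    also have "\<dots> \<le> (\<Sum>x<m. min \<bar>v x\<bar> c powr k)" using x by (intro member_le_sum) auto
    finally have "K \<le> (\<Sum>x<m. min \<bar>v x\<bar> c powr k)" .
    moreover have "(\<Sum>x<m. min \<bar>v x\<bar> c powr k) \<le> (\<Sum>x<m. \<bar>v x\<bar> powr k)"
      using c k by (intro sum_mono powr_mono2) auto
    ultimately show ?thesis by simp
  qed
  ultimately show ?thesis by simp
qed

section \<open>The supremum loss\<close>

definition sup_head :: "nat \<Rightarrow> (nat \<Rightarrow> real) \<Rightarrow> real" where
  "sup_head m v = Max (insert 0 ((\<lambda>x. \<bar>v x\<bar>) ` {..<m}))"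

lemma sup_head_ge: "x < m \<Longrightarrow> \<bar>v x\<bar> \<le> sup_head m v" "0 \<le> sup_head m v"
  unfolding sup_head_def by (auto intro!: Max_ge)

lemma sup_head_le: "0 \<le> c \<Longrightarrow> (\<And>x. x < m \<Longrightarrow> \<bar>v x\<bar> \<le> c) \<Longrightarrow> sup_head m v \<le> c"
  unfolding sup_head_def by auto

lemma sup_norm_ge: "ennreal \<bar>v x\<bar> \<le> sup_norm v"
  unfolding sup_norm_def by (rule SUP_upper) simp

lemma sup_head_le_sup_norm: "ennreal (sup_head m v) \<le> sup_norm v"
proof -
  have "sup_head m v \<in> insert 0 ((\<lambda>x. \<bar>v x\<bar>) ` {..<m})" unfolding sup_head_def by (rule Max_in) auto
  then show ?thesis using sup_norm_ge[of v] by auto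
qed

lemma sup_norm_head: "sup_norm (on {..<m} v) = ennreal (sup_head m v)"
proof (rule antisym)
  show "sup_norm (on {..<m} v) \<le> ennreal (sup_head m v)"
    unfolding sup_norm_def by (intro SUP_least ennreal_leI) (auto simp: on_def sup_head_ge)
  have "sup_head m v = sup_head m (on {..<m} v)"
    unfolding sup_head_def by (intro arg_cong[where f = Max] arg_cong[where f = "insert 0"] image_cong)
        (auto simp: on_def)
  then show "ennreal (sup_head m v) \<le> sup_norm (on {..<m} v)" by (simp add: sup_head_le_sup_norm)
qed

lemma sup_norm_on_le: "sup_norm (on A v) \<le> sup_norm v"
  unfolding sup_norm_def[of "on A v"] using sup_norm_ge[of v] by (intro SUP_least) (auto simp: on_def)

lemma sup_norm_split: "sup_norm v \<le> sup_norm (on {..<m} v) + sup_norm (on {m..} v)"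
  unfolding sup_norm_def[of v]
proof (rule SUP_least)
  fix x
  show "ennreal \<bar>v x\<bar> \<le> sup_norm (on {..<m} v) + sup_norm (on {m..} v)"
    using sup_norm_ge[of "on {..<m} v" x] sup_norm_ge[of "on {m..} v" x]
    by (cases "x < m") (auto simp: on_def add_increasing add_increasing2)
qed

lemma dominated_abs_le:
  assumes "dominated A u v" "finite A" "\<And>x. x \<in> A \<Longrightarrow> \<bar>v x\<bar> \<le> c" "x \<in> A"
  shows "\<bar>u x\<bar> \<le> c"
proof -
  have "\<bar>u x\<bar> - c \<le> 0"
  proof (rule sum_excess_le_zero[of "\<lambda>x. \<bar>u x\<bar> - c" A "\<lambda>x. \<bar>v x\<bar> - c"])
    show "(\<Sum>x\<in>A. max 0 (\<bar>u x\<bar> - c)) \<le> (\<Sum>x\<in>A. max 0 (\<bar>v x\<bar> - c))"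
      using assms(1) convex_excess(3)[of c] unfolding dominated_def by blast
  qed (use assms in auto)
  then show ?thesis by simp
qed

lemma sup_head_mono: "dominated {0..<m} u v \<Longrightarrow> sup_head m u \<le> sup_head m v"
  using dominated_abs_le[of "{0..<m}" u v "sup_head m v"] by (intro sup_head_le) (auto simp: sup_head_ge)

lemma sup_norm_tail_mono:
  assumes dom: "\<And>L0. \<exists>L\<ge>L0. dominated {a..<L} u v"
  shows "sup_norm (on {a..} u) \<le> sup_norm (on {a..} v)"
  unfolding sup_norm_def[of "on {a..} u"]
proof (rule SUP_least)
  fix x
  show "ennreal \<bar>on {a..} u x\<bar> \<le> sup_norm (on {a..} v)"
  proof (cases "a \<le> x")
    case True
    obtain L where L: "Suc x \<le> L" "dominated {a..<L} u v" using dom by blast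
    have "\<bar>u x\<bar> \<le> sup_head L (on {a..} v)"
    proof (rule dominated_abs_le[OF L(2)])
      show "\<bar>v y\<bar> \<le> sup_head L (on {a..} v)" if "y \<in> {a..<L}" for y
        using sup_head_ge(1)[of y L "on {a..} v"] that by (simp add: on_def)
    qed (use True L in auto)
    then have "ennreal \<bar>u x\<bar> \<le> ennreal (sup_head L (on {a..} v))" by (rule ennreal_leI)
    also have "\<dots> \<le> sup_norm (on {a..} v)" by (rule sup_head_le_sup_norm)
    finally show ?thesis using True by (simp add: on_def)
  qed (simp add: on_def)
qed

lemma sup_norm_measurable:
  "(\<And>x. f x \<in> borel_measurable K) \<Longrightarrow> (\<lambda>\<omega>. sup_norm (\<lambda>x. f x \<omega>)) \<in> borel_measurable K"
  unfolding sup_norm_def by measurable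

lemma sup_head_lipschitz: "coord_lipschitz m (\<lambda>v. min (sup_head m v) K)"
proof (rule coord_lipschitz_min)
  have le: "sup_head m u \<le> sup_head m v + (\<Sum>x<m. \<bar>u x - v x\<bar>)" for u v
  proof (rule sup_head_le)
    show "0 \<le> sup_head m v + (\<Sum>x<m. \<bar>u x - v x\<bar>)" using sup_head_ge(2)[of m v] by (intro
        add_nonneg_nonneg sum_nonneg) auto
    fix x assume x: "x < m"
    have "\<bar>u x - v x\<bar> \<le> (\<Sum>x<m. \<bar>u x - v x\<bar>)" using x by (intro member_le_sum) auto
    then show "\<bar>u x\<bar> \<le> sup_head m v + (\<Sum>x<m. \<bar>u x - v x\<bar>)" using sup_head_ge(1)[OF x, of v] by linarith
  qed
  have "\<bar>sup_head m u - sup_head m v\<bar> \<le> 1 * (\<Sum>x<m. \<bar>u x - v x\<bar>)" for u v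
    using le[of u v] le[of v u] by (simp add: abs_le_iff abs_minus_commute)
  then show "coord_lipschitz m (sup_head m)" unfolding coord_lipschitz_def using zero_le_one by blast
qed

section \<open>Both losses satisfy the interface\<close>

locale estimation = sampling_limit M p X N Y + decreasing_pmf p
  for M :: "'a measure" and p X and N :: "'b measure" and Y
begin

lemma tail_loss:
  assumes q: "summable q" "\<And>x. 0 \<le> q x" "\<And>x. pmf p x = 0 \<Longrightarrow> q x = 0"
    and V: "\<And>n x. (\<integral>\<^sup>+\<omega>. ennreal (\<bar>V n \<omega> x\<bar> powr k) \<partial>M) \<le> ennreal (q x)"
    and Y: "\<And>x. (\<integral>\<^sup>+\<omega>. ennreal (\<bar>Y x \<omega>\<bar> powr k) \<partial>N) \<le> ennreal (q x)"
    and \<epsilon>: "0 < \<epsilon>"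
  shows "\<exists>m. cut p m \<and> (\<forall>n. (\<integral>\<^sup>+\<omega>. power_loss k (on {m..} (V n \<omega>)) \<partial>M) \<le> ennreal \<epsilon>) \<and>
      (\<integral>\<^sup>+\<omega>. power_loss k (on {m..} (Yv \<omega>)) \<partial>N) \<le> ennreal \<epsilon>"
proof -
  obtain m where m: "cut p m" "(\<Sum>x. q (x + m)) \<le> \<epsilon>"
    using cut_tail[OF q \<epsilon>] by blast
  have le: "(\<integral>\<^sup>+\<omega>. power_loss k (on {m..} (\<lambda>x. f x \<omega>)) \<partial>Q) \<le> ennreal \<epsilon>"
    if f: "\<And>x. f x \<in> borel_measurable Q" and b: "\<And>x. (\<integral>\<^sup>+\<omega>. ennreal (\<bar>f x \<omega>\<bar> powr k) \<partial>Q) \<le> ennreal (q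
        x)" for f and Q :: "'c measure"
  proof -
    have "(\<integral>\<^sup>+\<omega>. power_loss k (on {m..} (\<lambda>x. f x \<omega>)) \<partial>Q) = (\<Sum>x. \<integral>\<^sup>+\<omega>. ennreal (\<bar>f (x + m) \<omega>\<bar> powr k) \<partial>Q)"
      unfolding power_loss_tail using f by (intro nn_integral_suminf) measurable
    also have "\<dots> \<le> (\<Sum>x. ennreal (q (x + m)))" by (intro suminf_le b) auto
    also have "\<dots> = ennreal (\<Sum>x. q (x + m))"
      using q by (intro suminf_ennreal2) (auto simp: summable_iff_shift)
    also have "\<dots> \<le> ennreal \<epsilon>" using m(2) by (rule ennreal_leI)
    finally show ?thesis .
  qed
  show ?thesis using m(1) le[of "\<lambda>x \<omega>. V n \<omega> x" M for n] le[of Y N] V Y by auto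
qed

text \<open>The origin of the square roots in the hypothesis for \<open>k = 1\<close>: a second
  moment of order \<open>s\<close> gives a first absolute moment of order
  \<open>sqrt s\<close>.\<close>

lemma abs_first_moment:
  assumes f: "f \<in> borel_measurable Q" and C: "0 < C" and s: "0 \<le> s"
    and b: "(\<integral>\<^sup>+\<omega>. ennreal (\<bar>f \<omega>\<bar> powr 2) \<partial>Q) \<le> ennreal (C * s)" and Q: "prob_space Q"
  shows "(\<integral>\<^sup>+\<omega>. ennreal (\<bar>f \<omega>\<bar> powr 1) \<partial>Q) \<le> ennreal ((1 + C) * sqrt s)"
proof (cases "s = 0")
  case True
  have "(\<integral>\<^sup>+\<omega>. ennreal (\<bar>f \<omega>\<bar> powr 2) \<partial>Q) = 0" using b True by simp
  then have "AE \<omega> in Q. ennreal (\<bar>f \<omega>\<bar> powr 2) = 0" using f by (subst (asm) nn_integral_0_iff_AE) auto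
  then have "AE \<omega> in Q. ennreal (\<bar>f \<omega>\<bar> powr 1) = 0" by eventually_elim (auto simp: ennreal_eq_0_iff)
  then have "(\<integral>\<^sup>+\<omega>. ennreal (\<bar>f \<omega>\<bar> powr 1) \<partial>Q) = (\<integral>\<^sup>+\<omega>. 0 \<partial>Q)" by (intro nn_integral_cong_AE) auto
  then show ?thesis by simp
next
  case False
  \<comment> \<open>As threshold in \<open>le_add_square\<close> this balances the two terms
    \<open>r\<close> and \<open>C * s / r\<close>.\<close>
  define r where "r = sqrt s"
  have r: "0 < r" "r * r = s" using s False by (auto simp: r_def)
  interpret Q: prob_space Q by fact
  have pt: "ennreal (\<bar>u\<bar> powr 1) \<le> ennreal r + ennreal (\<bar>u\<bar> powr 2) * ennreal (1 / r)" for u :: real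
    using ennreal_le_add_square[OF r(1), of "\<bar>u\<bar>"] by (simp add: abs_powr_2)
  have "(\<integral>\<^sup>+\<omega>. ennreal (\<bar>f \<omega>\<bar> powr 1) \<partial>Q) \<le> (\<integral>\<^sup>+\<omega>. ennreal r + ennreal (\<bar>f \<omega>\<bar> powr 2) * ennreal (1 / r) \<partial>Q)"
    by (intro nn_integral_mono pt)
  also have "\<dots> = ennreal r + (\<integral>\<^sup>+\<omega>. ennreal (\<bar>f \<omega>\<bar> powr 2) \<partial>Q) * ennreal (1 / r)"
    using f by (subst nn_integral_add) (auto simp: nn_integral_multc Q.emeasure_space_1)
  also have "\<dots> \<le> ennreal r + ennreal (C * s) * ennreal (1 / r)"
    by (intro add_left_mono mult_right_mono b) simp
  also have "\<dots> = ennreal (r + C * s * (1 / r))"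
    using r C s by (simp add: ennreal_mult[symmetric] ennreal_plus[symmetric] del: ennreal_plus)
  also have "r + C * s * (1 / r) = (1 + C) * sqrt s"
    using r by (simp add: r(2)[symmetric] r_def[symmetric] algebra_simps del: r(2))
  finally show ?thesis .
qed

lemma square_moment:
  assumes pt: "\<And>v. (\<phi> v)\<^sup>2 \<le> D * (\<Sum>x<m. \<bar>v x\<bar> powr r)" and D: "0 \<le> D" and r: "2 \<le> r"
  shows "\<exists>C. (\<forall>n. (\<integral>\<^sup>+\<omega>. ennreal ((\<phi> (V n \<omega>))\<^sup>2) \<partial>M) \<le> ennreal C) \<and>
      (\<integral>\<^sup>+\<omega>. ennreal ((\<phi> (Yv \<omega>))\<^sup>2) \<partial>N) \<le> ennreal C"
proof -
  obtain C where C: "0 < C" "\<And>n x. (\<integral>\<^sup>+\<omega>. ennreal (\<bar>V n \<omega> x\<bar> powr r) \<partial>M) \<le> ennreal (C * pmf p x)"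
    "\<And>x. (\<integral>\<^sup>+\<omega>. ennreal (\<bar>Y x \<omega>\<bar> powr r) \<partial>N) \<le> ennreal (C * pmf p x)"
    by (rule moments[OF r], rule that)
  have le: "(\<integral>\<^sup>+\<omega>. ennreal ((\<phi> (\<lambda>x. f x \<omega>))\<^sup>2) \<partial>Q) \<le> ennreal (D * (\<Sum>x<m. C * pmf p x))"
    if f: "\<And>x. f x \<in> borel_measurable Q" and b: "\<And>x. (\<integral>\<^sup>+\<omega>. ennreal (\<bar>f x \<omega>\<bar> powr r) \<partial>Q) \<le> ennreal (C *
        pmf p x)" for f and Q :: "'c measure"
  proof -
    have "(\<integral>\<^sup>+\<omega>. ennreal ((\<phi> (\<lambda>x. f x \<omega>))\<^sup>2) \<partial>Q) \<le> (\<integral>\<^sup>+\<omega>. ennreal D * (\<Sum>x<m. ennreal (\<bar>f x \<omega>\<bar> powr r)) \<partial>Q)"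
    proof (rule nn_integral_mono)
      fix \<omega>
      have "ennreal ((\<phi> (\<lambda>x. f x \<omega>))\<^sup>2) \<le> ennreal (D * (\<Sum>x<m. \<bar>f x \<omega>\<bar> powr r))"
        by (rule ennreal_leI) (rule pt)
      also have "\<dots> = ennreal D * (\<Sum>x<m. ennreal (\<bar>f x \<omega>\<bar> powr r))"
        using D by (simp add: ennreal_mult sum_nonneg)
      finally show "ennreal ((\<phi> (\<lambda>x. f x \<omega>))\<^sup>2) \<le> ennreal D * (\<Sum>x<m. ennreal (\<bar>f x \<omega>\<bar> powr r))" .
    qed
    also have "\<dots> = ennreal D * (\<Sum>x<m. \<integral>\<^sup>+\<omega>. ennreal (\<bar>f x \<omega>\<bar> powr r) \<partial>Q)"
    proof -
      have "(\<integral>\<^sup>+\<omega>. (\<Sum>x<m. ennreal (\<bar>f x \<omega>\<bar> powr r)) \<partial>Q) = (\<Sum>x<m. \<integral>\<^sup>+\<omega>. ennreal (\<bar>f x \<omega>\<bar> powr r) \<partial>Q)"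
        using f by (intro nn_integral_sum) measurable
      moreover have "(\<lambda>\<omega>. \<Sum>x<m. ennreal (\<bar>f x \<omega>\<bar> powr r)) \<in> borel_measurable Q" using f by measurable
      ultimately show ?thesis by (simp only: nn_integral_cmult)
    qed
    also have "\<dots> \<le> ennreal D * (\<Sum>x<m. ennreal (C * pmf p x))"
      by (intro mult_left_mono sum_mono b) simp
    also have "\<dots> = ennreal (D * (\<Sum>x<m. C * pmf p x))"
    proof -
      have "(\<Sum>x<m. ennreal (C * pmf p x)) = ennreal (\<Sum>x<m. C * pmf p x)"
        using C(1) by (intro sum_ennreal) simp
      moreover have "0 \<le> (\<Sum>x<m. C * pmf p x)" using C(1) by (intro sum_nonneg) simp
      ultimately show ?thesis using D by (simp only: ennreal_mult)
    qed
    finally show ?thesis .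
  qed
  show ?thesis
    using le[of "\<lambda>x \<omega>. V n \<omega> x" M for n] le[of Y N] C by (intro exI[of _ "D * (\<Sum>x<m. C * pmf p x)"]) auto
qed

lemma power_risk_functional:
  assumes k: "2 \<le> k \<or> k = 1 \<and> summable (\<lambda>x. sqrt (pmf p x))"
  shows "risk_functional M p X N Y (power_loss k) (\<lambda>m v. \<Sum>x<m. \<bar>v x\<bar> powr k)"
proof -
  have k1: "1 \<le> k" using k by auto
  obtain C where C: "0 < C" "\<And>n x. (\<integral>\<^sup>+\<omega>. ennreal (\<bar>V n \<omega> x\<bar> powr 2) \<partial>M) \<le> ennreal (C * pmf p x)"
    "\<And>x. (\<integral>\<^sup>+\<omega>. ennreal (\<bar>Y x \<omega>\<bar> powr 2) \<partial>N) \<le> ennreal (C * pmf p x)"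
    by (rule moments[of 2], simp, rule that)
  \<comment> \<open>The summable majorant of the coordinate moments, proportional to
    \<open>pmf p x\<close> for \<open>k \<ge> 2\<close> and to its square root for
    \<open>k = 1\<close>.\<close>
  obtain q where q: "summable q" "\<And>x. 0 \<le> q x" "\<And>x. pmf p x = 0 \<Longrightarrow> q x = 0"
    "\<And>n x. (\<integral>\<^sup>+\<omega>. ennreal (\<bar>V n \<omega> x\<bar> powr k) \<partial>M) \<le> ennreal (q x)"
    "\<And>x. (\<integral>\<^sup>+\<omega>. ennreal (\<bar>Y x \<omega>\<bar> powr k) \<partial>N) \<le> ennreal (q x)"
  proof (cases "2 \<le> k")
    case True
    obtain C where C: "0 < C" "\<And>n x. (\<integral>\<^sup>+\<omega>. ennreal (\<bar>V n \<omega> x\<bar> powr k) \<partial>M) \<le> ennreal (C * pmf p x)"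
      "\<And>x. (\<integral>\<^sup>+\<omega>. ennreal (\<bar>Y x \<omega>\<bar> powr k) \<partial>N) \<le> ennreal (C * pmf p x)"
      by (rule moments[OF True], rule that)
    then show ?thesis
      by (intro that[of "\<lambda>x. C * pmf p x"] summable_mult summable_pmf_nat) auto
  next
    case False
    with k have k': "k = 1" "summable (\<lambda>x. sqrt (pmf p x))" by auto
    show ?thesis
    proof (rule that[of "\<lambda>x. (1 + C) * sqrt (pmf p x)"])
      show "summable (\<lambda>x. (1 + C) * sqrt (pmf p x))" by (intro summable_mult k')
      show "(\<integral>\<^sup>+\<omega>. ennreal (\<bar>V n \<omega> x\<bar> powr k) \<partial>M) \<le> ennreal ((1 + C) * sqrt (pmf p x))" for n x
        unfolding k' by (rule abs_first_moment[OF V_measurable C(1) _ C(2) prob_space_axioms]) simp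
      show "(\<integral>\<^sup>+\<omega>. ennreal (\<bar>Y x \<omega>\<bar> powr k) \<partial>N) \<le> ennreal ((1 + C) * sqrt (pmf p x))" for x
        unfolding k' by (rule abs_first_moment[OF N.Y_measurable C(1) _ C(3) N.prob_space_axioms]) simp
    qed (use C in auto)
  qed
  show ?thesis
  proof
    show "power_loss k (on {a..} u) \<le> power_loss k (on {a..} v)" if "\<And>L0. \<exists>L\<ge>L0. dominated {a..<L} u v"
        for a u v
      using that by (rule power_loss_tail_mono[OF k1])
    show "(\<Sum>x<m. \<bar>u x\<bar> powr k) \<le> (\<Sum>x<m. \<bar>v x\<bar> powr k)" if "dominated {0..<m} u v" for m u v
      using that convex_on_abs_powr[OF k1] unfolding dominated_def atLeast0LessThan by blast
    show "power_loss k (on {..<m} v) = ennreal (\<Sum>x<m. \<bar>v x\<bar> powr k)" for m v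
      using k1 by (intro power_loss_head) auto
    show "0 \<le> (\<Sum>x<m. \<bar>v x\<bar> powr k)" for m and v :: "nat \<Rightarrow> real" by (rule sum_nonneg) simp
    show "\<exists>C. (\<forall>n. (\<integral>\<^sup>+\<omega>. ennreal ((\<Sum>x<m. \<bar>V n \<omega> x\<bar> powr k)\<^sup>2) \<partial>M) \<le> ennreal C) \<and>
      (\<integral>\<^sup>+\<omega>. ennreal ((\<Sum>x<m. \<bar>Y x \<omega>\<bar> powr k)\<^sup>2) \<partial>N) \<le> ennreal C" for m
    \<comment> \<open>By Cauchy-Schwarz the squared loss of \<open>m\<close> coordinates is at most
      \<open>m\<close> times the sum of powers \<open>2 * k\<close>, an exponent that is at least 2
      also for \<open>k = 1\<close>.\<close>
    proof (rule square_moment[where \<phi> = "\<lambda>v. \<Sum>x<m. \<bar>v x\<bar> powr k" and D = "real m" and m = m and r = "2 * k"])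
      fix v :: "nat \<Rightarrow> real"
      have "(\<Sum>x<m. \<bar>v x\<bar> powr k)\<^sup>2 \<le> (\<Sum>x<m. (\<bar>v x\<bar> powr k)\<^sup>2) * real (card {..<m})"
        by (rule sum_squared_le_sum_of_squares)
      also have "(\<Sum>x<m. (\<bar>v x\<bar> powr k)\<^sup>2) = (\<Sum>x<m. \<bar>v x\<bar> powr (2 * k))"
        by (intro sum.cong refl) (simp add: power2_eq_square powr_add[symmetric])
      finally show "(\<Sum>x<m. \<bar>v x\<bar> powr k)\<^sup>2 \<le> real m * (\<Sum>x<m. \<bar>v x\<bar> powr (2 * k))" by (simp add: mult.commute)
    qed (use k1 in auto)
    show "\<exists>m. cut p m \<and> (\<forall>n. (\<integral>\<^sup>+\<omega>. power_loss k (on {m..} (V n \<omega>)) \<partial>M) \<le> ennreal \<epsilon>) \<and>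
      (\<integral>\<^sup>+\<omega>. power_loss k (on {m..} (Yv \<omega>)) \<partial>N) \<le> ennreal \<epsilon>" if "0 < \<epsilon>" for \<epsilon>
      by (rule tail_loss[OF q that])
  qed (use k1 in \<open>simp_all add: power_loss_split power_loss_on_le power_loss_measurable power_loss_lipschitz\<close>)
qed

lemma sup_norm_le_square:
  assumes "0 < \<eta>"
  shows "sup_norm v \<le> ennreal \<eta> + power_loss 2 v * ennreal (1 / \<eta>)"
  unfolding sup_norm_def
proof (rule SUP_least)
  fix x
  have "ennreal \<bar>v x\<bar> \<le> ennreal \<eta> + ennreal (\<bar>v x\<bar> powr 2) * ennreal (1 / \<eta>)"
    using ennreal_le_add_square[OF assms, of "\<bar>v x\<bar>"] by (simp add: abs_powr_2)
  also have "\<dots> \<le> ennreal \<eta> + power_loss 2 v * ennreal (1 / \<eta>)"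
  proof (intro add_left_mono mult_right_mono)
    have "(\<Sum>y\<in>{x}. ennreal (\<bar>v y\<bar> powr 2)) \<le> power_loss 2 v"
      unfolding power_loss_def by (rule sum_le_suminf) auto
    then show "ennreal (\<bar>v x\<bar> powr 2) \<le> power_loss 2 v" by simp
  qed simp
  finally show "ennreal \<bar>v x\<bar> \<le> ennreal \<eta> + power_loss 2 v * ennreal (1 / \<eta>)" .
qed

lemma sup_risk_functional: "risk_functional M p X N Y sup_norm sup_head"
proof -
  obtain C where C: "0 < C" "\<And>n x. (\<integral>\<^sup>+\<omega>. ennreal (\<bar>V n \<omega> x\<bar> powr 2) \<partial>M) \<le> ennreal (C * pmf p x)"
    "\<And>x. (\<integral>\<^sup>+\<omega>. ennreal (\<bar>Y x \<omega>\<bar> powr 2) \<partial>N) \<le> ennreal (C * pmf p x)"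
    by (rule moments[of 2], simp, rule that)
  show ?thesis
  proof
    show "sup_norm (on {a..} u) \<le> sup_norm (on {a..} v)" if "\<And>L0. \<exists>L\<ge>L0. dominated {a..<L} u v" for a u v
      using that by (rule sup_norm_tail_mono)
    show "sup_head m u \<le> sup_head m v" if "dominated {0..<m} u v" for m u v
      using that by (rule sup_head_mono)
    show "\<exists>C. (\<forall>n. (\<integral>\<^sup>+\<omega>. ennreal ((sup_head m (V n \<omega>))\<^sup>2) \<partial>M) \<le> ennreal C) \<and>
      (\<integral>\<^sup>+\<omega>. ennreal ((sup_head m (\<lambda>x. Y x \<omega>))\<^sup>2) \<partial>N) \<le> ennreal C" for m
    proof (rule square_moment[where \<phi> = "sup_head m" and D = 1 and m = m and r = 2])
      fix v :: "nat \<Rightarrow> real"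
      have "sup_head m v \<in> insert 0 ((\<lambda>x. \<bar>v x\<bar>) ` {..<m})" unfolding sup_head_def by (rule Max_in) auto
      then consider "sup_head m v = 0" | x where "x < m" "sup_head m v = \<bar>v x\<bar>" by auto
      then show "(sup_head m v)\<^sup>2 \<le> 1 * (\<Sum>x<m. \<bar>v x\<bar> powr 2)"
      proof cases
        case 2
        have "\<bar>v x\<bar>\<^sup>2 = \<bar>v x\<bar> powr 2" by (simp add: abs_powr_2)
        also have "\<dots> \<le> (\<Sum>x<m. \<bar>v x\<bar> powr 2)" using 2 by (intro member_le_sum) auto
        finally show ?thesis using 2 by simp
      qed (simp add: sum_nonneg)
    qed auto
    show "\<exists>m. cut p m \<and> (\<forall>n. (\<integral>\<^sup>+\<omega>. sup_norm (on {m..} (V n \<omega>)) \<partial>M) \<le> ennreal \<epsilon>) \<and>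
      (\<integral>\<^sup>+\<omega>. sup_norm (on {m..} (Yv \<omega>)) \<partial>N) \<le> ennreal \<epsilon>" if \<epsilon>: "0 < \<epsilon>" for \<epsilon>
    proof -
      \<comment> \<open>With the squared tail below \<open>\<eta> * \<eta>\<close>, the bound of
        \<open>sup_norm_le_square\<close> becomes
        \<open>\<eta> + \<eta> = \<epsilon>\<close>.\<close>
      define \<eta> where "\<eta> = \<epsilon> / 2"
      have \<eta>: "0 < \<eta>" "0 < \<eta> * \<eta>" using \<epsilon> by (auto simp: \<eta>_def)
      obtain m where m: "cut p m" "\<And>n. (\<integral>\<^sup>+\<omega>. power_loss 2 (on {m..} (V n \<omega>)) \<partial>M) \<le> ennreal (\<eta> * \<eta>)"
        "(\<integral>\<^sup>+\<omega>. power_loss 2 (on {m..} (Yv \<omega>)) \<partial>N) \<le> ennreal (\<eta> * \<eta>)"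
        using tail_loss[of "\<lambda>x. C * pmf p x" 2, OF summable_mult[OF summable_pmf_nat] _ _ C(2,3) \<eta>(2)]
            C(1) by auto
      have le: "(\<integral>\<^sup>+\<omega>. sup_norm (on {m..} (\<lambda>x. f x \<omega>)) \<partial>Q) \<le> ennreal \<epsilon>"
        if Q: "prob_space Q" and f: "\<And>x. f x \<in> borel_measurable Q"
          and b: "(\<integral>\<^sup>+\<omega>. power_loss 2 (on {m..} (\<lambda>x. f x \<omega>)) \<partial>Q) \<le> ennreal (\<eta> * \<eta>)" for f and Q :: "'c measure"
      proof -
        interpret Q: prob_space Q by fact
        have pm: "(\<lambda>\<omega>. power_loss 2 (on {m..} (\<lambda>x. f x \<omega>))) \<in> borel_measurable Q"
          by (rule power_loss_measurable) (use f in \<open>simp add: on_def\<close>)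
        have "(\<integral>\<^sup>+\<omega>. sup_norm (on {m..} (\<lambda>x. f x \<omega>)) \<partial>Q)
            \<le> (\<integral>\<^sup>+\<omega>. ennreal \<eta> + power_loss 2 (on {m..} (\<lambda>x. f x \<omega>)) * ennreal (1 / \<eta>) \<partial>Q)"
          by (intro nn_integral_mono sup_norm_le_square \<eta>)
        also have "\<dots> = ennreal \<eta> + (\<integral>\<^sup>+\<omega>. power_loss 2 (on {m..} (\<lambda>x. f x \<omega>)) \<partial>Q) * ennreal (1 / \<eta>)"
          using pm by (subst nn_integral_add) (auto simp: nn_integral_multc Q.emeasure_space_1)
        also have "\<dots> \<le> ennreal \<eta> + ennreal (\<eta> * \<eta>) * ennreal (1 / \<eta>)"
          by (intro add_left_mono mult_right_mono b) simp
        also have "ennreal (\<eta> * \<eta>) * ennreal (1 / \<eta>) = ennreal (\<eta> * \<eta> * (1 / \<eta>))"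
          using \<eta> by (intro ennreal_mult[symmetric]) auto
        also have "\<eta> * \<eta> * (1 / \<eta>) = \<eta>" using \<eta>(1) by simp
        also have "ennreal \<eta> + ennreal \<eta> = ennreal (\<eta> + \<eta>)" using \<eta>(1) by (intro ennreal_plus[symmetric]) auto
        also have "\<eta> + \<eta> = \<epsilon>" by (simp add: \<eta>_def)
        finally show ?thesis .
      qed
      show ?thesis
        using m(1) le[OF prob_space_axioms V_measurable m(2)] le[OF N.prob_space_axioms N.Y_measurable
            m(3)] by blast
    qed
  qed (simp_all add: sup_norm_head sup_head_ge sup_norm_split[unfolded sup_norm_head] sup_norm_on_le
      sup_norm_measurable sup_head_lipschitz)
qed

end

section \<open>Strict inequality\<close>

lemma (in prob_space) distr_pair_snd: "distr (M \<Otimes>\<^sub>M K) K snd = K" if "sigma_finite_measure K"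
proof (intro measure_eqI)
  interpret K: sigma_finite_measure K by fact
  fix A assume A: "A \<in> sets (distr (M \<Otimes>\<^sub>M K) K snd)"
  then have "emeasure (distr (M \<Otimes>\<^sub>M K) K snd) A = emeasure (M \<Otimes>\<^sub>M K) (space M \<times> A)"
    by (auto simp: emeasure_distr space_pair_measure dest: sets.sets_into_space intro!: arg_cong2[where
        f = emeasure])
  also have "\<dots> = emeasure K A"
    using A by (simp add: K.emeasure_pair_measure_Times emeasure_space_1)
  finally show "emeasure (distr (M \<Otimes>\<^sub>M K) K snd) A = emeasure K A" .
qed simp

lemma coord_lipschitz_pair:
  assumes rs: "r < m" "s < m" and f: "\<And>a b a' b'. \<bar>f a b - f a' b'\<bar> \<le> \<bar>a - a'\<bar> + \<bar>b - b'\<bar>"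
  shows "coord_lipschitz m (\<lambda>v. f (v r) (v s))"
proof -
  have "\<bar>f (u r) (u s) - f (v r) (v s)\<bar> \<le> 2 * (\<Sum>x<m. \<bar>u x - v x\<bar>)" for u v :: "nat \<Rightarrow> real"
  proof -
    have "\<bar>u x - v x\<bar> \<le> (\<Sum>x<m. \<bar>u x - v x\<bar>)" if "x < m" for x
      using that by (intro member_le_sum) auto
    from add_mono[OF this[OF rs(1)] this[OF rs(2)]] show ?thesis
      using f[of "u r" "u s" "v r" "v s"] by simp
  qed
  then show ?thesis unfolding coord_lipschitz_def by (intro exI[of _ 2]) simp
qed

lemma coord_lipschitz_compose1:
  assumes F: "coord_lipschitz m F" and f: "\<And>s t. \<bar>f s - f t\<bar> \<le> \<bar>s - t\<bar>"
  shows "coord_lipschitz m (\<lambda>v. f (F v))"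
  using F f unfolding coord_lipschitz_def by (meson order_trans)

context gaussian_limit
begin

text \<open>For \<open>p\<^sub>r = p\<^sub>s\<close> the difference \<open>Y\<^sub>r - Y\<^sub>s\<close> is uncorrelated with \<open>Y\<^sub>r + Y\<^sub>s\<close> and with all
  other \<open>Y\<^sub>x\<close>, hence independent of them: recomputing it from an independent copy of the process
  leaves the finite-dimensional laws unchanged.\<close>

context
  fixes r s m :: nat
  assumes rs: "r \<noteq> s" "r < m" "s < m" "pmf p r = pmf p s"
begin

text \<open>With \<open>sym_part\<close> this decomposes the identity into two self-adjoint
  projections, so that they can be moved from the process to the frequency vector.\<close>

definition anti_part :: "(nat \<Rightarrow> real) \<Rightarrow> nat \<Rightarrow> real" where
  "anti_part y x = (if x = r then (y r - y s) / 2 else if x = s then (y s - y r) / 2 else 0)"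

definition sym_part :: "(nat \<Rightarrow> real) \<Rightarrow> nat \<Rightarrow> real" where
  "sym_part y x = (if x = r \<or> x = s then (y r + y s) / 2 else y x)"

lemma sum_rs: "(\<Sum>x<m. f x) = f r + f s + (\<Sum>x\<in>{..<m} - {r, s}. f x :: real)"
proof -
  have "(\<Sum>x<m. f x) = f r + (\<Sum>x\<in>{..<m} - {r}. f x)" using rs by (intro sum.remove) auto
  also have "(\<Sum>x\<in>{..<m} - {r}. f x) = f s + (\<Sum>x\<in>({..<m} - {r}) - {s}. f x)" using rs by (intro sum.remove) auto
  also have "({..<m} - {r}) - {s} = {..<m} - {r, s}" by auto
  finally show ?thesis by simp
qed

lemma anti_part_adjoint: "(\<Sum>x<m. t x * anti_part y x) = (\<Sum>x<m. anti_part t x * y x)"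
  unfolding sum_rs using rs(1) by (simp add: anti_part_def field_simps)

lemma sym_part_adjoint: "(\<Sum>x<m. t x * sym_part y x) = (\<Sum>x<m. sym_part t x * y x)"
  unfolding sum_rs using rs(1) by (simp add: sym_part_def field_simps)

lemma cov_form:
  "(\<Sum>x<m. \<Sum>z<m. a x * b z * ((if x = z then pmf p x else 0) - pmf p x * pmf p z))
    = (\<Sum>x<m. a x * b x * pmf p x) - (\<Sum>x<m. a x * pmf p x) * (\<Sum>x<m. b x * pmf p x)"
proof -
  have "(\<Sum>z<m. a x * b z * ((if x = z then pmf p x else 0) - pmf p x * pmf p z))
      = a x * b x * pmf p x - a x * pmf p x * (\<Sum>z<m. b z * pmf p z)" if "x < m" for x
  proof -
    have "(\<Sum>z<m. a x * b z * ((if x = z then pmf p x else 0) - pmf p x * pmf p z))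
        = (\<Sum>z<m. (if x = z then a x * b x * pmf p x else 0) - a x * pmf p x * (b z * pmf p z))"
      by (intro sum.cong) (auto simp: algebra_simps)
    then show ?thesis using that by (simp add: sum_subtractf sum_distrib_left)
  qed
  then show ?thesis by (simp add: sum_subtractf sum_distrib_right)
qed

text \<open>The cross terms of the covariance form vanish because \<open>pmf p r = pmf p s\<close>:
  the antisymmetric part is orthogonal to the symmetric one and has mean zero under
  \<open>p\<close>.\<close>

lemma cov_parts:
  "(\<Sum>x<m. t x * t x * pmf p x) - (\<Sum>x<m. t x * pmf p x) * (\<Sum>x<m. t x * pmf p x)
    = ((\<Sum>x<m. anti_part t x * anti_part t x * pmf p x) - (\<Sum>x<m. anti_part t x * pmf p x) * (\<Sum>x<m.
        anti_part t x * pmf p x))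
    + ((\<Sum>x<m. sym_part t x * sym_part t x * pmf p x) - (\<Sum>x<m. sym_part t x * pmf p x) * (\<Sum>x<m. sym_part
        t x * pmf p x))"
proof -
  have 1: "(\<Sum>x<m. anti_part t x * pmf p x) = 0"
    unfolding sum_rs using rs(1,4) by (simp add: anti_part_def field_simps)
  have 2: "(\<Sum>x<m. sym_part t x * pmf p x) = (\<Sum>x<m. t x * pmf p x)"
    unfolding sum_rs using rs(1,4) by (simp add: sym_part_def field_simps)
  have "(\<Sum>x<m. t x * t x * pmf p x) = (\<Sum>x<m. anti_part t x * anti_part t x * pmf p x) + (\<Sum>x<m. sym_part
      t x * sym_part t x * pmf p x)"
    unfolding sum_rs using rs(1,4) by (simp add: anti_part_def sym_part_def field_simps)
  with 1 2 show ?thesis by simp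
qed

text \<open>The difference of coordinates \<open>r\<close> and \<open>s\<close> comes from the first
  copy, everything else from the second.\<close>

definition recombined :: "'b \<times> 'b \<Rightarrow> nat \<Rightarrow> real" where
  "recombined w x = anti_part (\<lambda>x. Y x (fst w)) x + sym_part (\<lambda>x. Y x (snd w)) x"

lemma recombined_measurable [measurable]: "(\<lambda>w. recombined w x) \<in> borel_measurable (N \<Otimes>\<^sub>M N)"
  unfolding recombined_def anti_part_def sym_part_def by (cases "x = r"; cases "x = s") simp_all

text \<open>Fubini factorises the characteristic function over the two copies, and the variances of
  the two Gaussian factors add up to the original one.\<close>

lemma recombined_char:
  "(\<integral>w. iexp (\<Sum>x<m. t x * recombined w x) \<partial>(N \<Otimes>\<^sub>M N)) = (\<integral>\<omega>. iexp (\<Sum>x<m. t x * Y x \<omega>) \<partial>N)"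
proof -
  interpret P: pair_prob_space N N ..
  let ?f = "\<lambda>\<omega>. iexp (\<Sum>x<m. anti_part t x * Y x \<omega>)"
  let ?g = "\<lambda>\<omega>. iexp (\<Sum>x<m. sym_part t x * Y x \<omega>)"
  have eq: "iexp (\<Sum>x<m. t x * recombined w x) = ?f (fst w) * ?g (snd w)" for w
    by (simp add: recombined_def distrib_left sum.distrib anti_part_adjoint sym_part_adjoint exp_add)
  have int: "integrable (N \<Otimes>\<^sub>M N) (\<lambda>(x, y). ?f x * ?g y)"
    by (rule P.P.integrable_const_bound[of _ 1]) (auto simp: norm_mult)
  have "(\<integral>w. iexp (\<Sum>x<m. t x * recombined w x) \<partial>(N \<Otimes>\<^sub>M N)) = (\<integral>w. (\<lambda>(x, y). ?f x * ?g y) w \<partial>(N \<Otimes>\<^sub>M N))"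
    unfolding eq by (simp add: case_prod_beta)
  also have "\<dots> = (\<integral>x. (\<integral>y. ?f x * ?g y \<partial>N) \<partial>N)"
    by (rule P.integral_fst[OF int, symmetric])
  also have "\<dots> = (\<integral>x. ?f x \<partial>N) * (\<integral>y. ?g y \<partial>N)" by simp
  also have "\<dots> = (\<integral>\<omega>. iexp (\<Sum>x<m. t x * Y x \<omega>) \<partial>N)"
    unfolding combination_char[OF finite_lessThan] cov_form cov_parts[of t]
    by (simp add: exp_add[symmetric] add_divide_distrib diff_divide_distrib flip: of_real_mult of_real_add)
  finally show ?thesis .
qed

text \<open>\<open>lipschitz_limit\<close> for a constant sequence: equal characteristic functions
  imply equal means of Lipschitz functionals.\<close>

lemma recombined_law:
  assumes F: "coord_lipschitz m F"
  shows "(\<integral>w. F (recombined w) \<partial>(N \<Otimes>\<^sub>M N)) = (\<integral>\<omega>. F (\<lambda>x. Y x \<omega>) \<partial>N)"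
proof -
  interpret P: pair_prob_space N N ..
  have fst: "integrable (N \<Otimes>\<^sub>M N) (\<lambda>w. (Y x (fst w))\<^sup>2)" for x
    using Y_square_integrable[of x] integrable_distr[of fst "N \<Otimes>\<^sub>M N" N "\<lambda>\<omega>. (Y x \<omega>)\<^sup>2"]
    by (simp add: distr_pair_fst)
  have snd: "integrable (N \<Otimes>\<^sub>M N) (\<lambda>w. (Y x (snd w))\<^sup>2)" for x
    using Y_square_integrable[of x] integrable_distr[of snd "N \<Otimes>\<^sub>M N" N "\<lambda>\<omega>. (Y x \<omega>)\<^sup>2"]
    by (simp add: distr_pair_snd sigma_finite_measure_axioms)
  have sq: "integrable (N \<Otimes>\<^sub>M N) (\<lambda>w. (recombined w x)\<^sup>2)" for x
  proof (rule Bochner_Integration.integrable_bound)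
    show "integrable (N \<Otimes>\<^sub>M N) (\<lambda>w. (Y r (fst w))\<^sup>2 + (Y s (fst w))\<^sup>2 + (Y r (snd w))\<^sup>2 + (Y s (snd
        w))\<^sup>2 + (Y x (snd w))\<^sup>2)"
      using fst snd by simp
    \<comment> \<open>Cauchy-Schwarz for four numbers, with the defect written as a sum of six
      squares.\<close>
    have *: "((a - b) / 2 + (c + d) / 2)\<^sup>2 \<le> a\<^sup>2 + b\<^sup>2 + c\<^sup>2 + d\<^sup>2" for a b c d :: real
    proof -
      have "a\<^sup>2 + b\<^sup>2 + c\<^sup>2 + d\<^sup>2 - ((a - b) / 2 + (c + d) / 2)\<^sup>2
          = ((a + b)\<^sup>2 + (a - c)\<^sup>2 + (a - d)\<^sup>2 + (b + c)\<^sup>2 + (b + d)\<^sup>2 + (c - d)\<^sup>2) / 4"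
        by (simp add: power2_eq_square field_simps)
      moreover have "0 \<le> ((a + b)\<^sup>2 + (a - c)\<^sup>2 + (a - d)\<^sup>2 + (b + c)\<^sup>2 + (b + d)\<^sup>2 + (c - d)\<^sup>2) / 4"
        by (intro divide_nonneg_pos add_nonneg_nonneg zero_le_power2) simp
      ultimately show ?thesis by linarith
    qed
    have "(recombined w x)\<^sup>2 \<le> (Y r (fst w))\<^sup>2 + (Y s (fst w))\<^sup>2 + (Y r (snd w))\<^sup>2 + (Y s (snd w))\<^sup>2 +
        (Y x (snd w))\<^sup>2" for w
      using *[of "Y r (fst w)" "Y s (fst w)" "Y r (snd w)" "Y s (snd w)"] *[of "Y s (fst w)" "Y r (fst
          w)" "Y r (snd w)" "Y s (snd w)"]
      unfolding recombined_def anti_part_def sym_part_def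
      by (cases "x = r"; cases "x = s") (auto intro: order_trans)
    then show "AE w in N \<Otimes>\<^sub>M N. norm ((recombined w x)\<^sup>2)
        \<le> norm ((Y r (fst w))\<^sup>2 + (Y s (fst w))\<^sup>2 + (Y r (snd w))\<^sup>2 + (Y s (snd w))\<^sup>2 + (Y x (snd w))\<^sup>2)"
      by (intro AE_I2) (simp add: order_trans[OF _ abs_ge_self])
  qed simp
  define B where "B = (\<Sum>x<m. \<integral>w. (recombined w x)\<^sup>2 \<partial>(N \<Otimes>\<^sub>M N)) + (\<Sum>x<m. \<integral>\<omega>. (Y x \<omega>)\<^sup>2 \<partial>N)"
  have B: "(\<integral>w. (recombined w x)\<^sup>2 \<partial>(N \<Otimes>\<^sub>M N)) \<le> B" "(\<integral>\<omega>. (Y x \<omega>)\<^sup>2 \<partial>N) \<le> B" if "x < m" for x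
  proof -
    have "(\<integral>w. (recombined w x)\<^sup>2 \<partial>(N \<Otimes>\<^sub>M N)) \<le> (\<Sum>x<m. \<integral>w. (recombined w x)\<^sup>2 \<partial>(N \<Otimes>\<^sub>M N))"
      using that by (intro member_le_sum) auto
    moreover have "(\<integral>\<omega>. (Y x \<omega>)\<^sup>2 \<partial>N) \<le> (\<Sum>x<m. \<integral>\<omega>. (Y x \<omega>)\<^sup>2 \<partial>N)"
      using that by (intro member_le_sum) auto
    moreover have "0 \<le> (\<Sum>x<m. \<integral>w. (recombined w x)\<^sup>2 \<partial>(N \<Otimes>\<^sub>M N))" "0 \<le> (\<Sum>x<m. \<integral>\<omega>. (Y x \<omega>)\<^sup>2 \<partial>N)"
      by (auto intro!: sum_nonneg)
    ultimately show "(\<integral>w. (recombined w x)\<^sup>2 \<partial>(N \<Otimes>\<^sub>M N)) \<le> B" "(\<integral>\<omega>. (Y x \<omega>)\<^sup>2 \<partial>N) \<le> B"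
      unfolding B_def by linarith+
  qed
  have "characters_converge (\<lambda>_. N \<Otimes>\<^sub>M N) (\<lambda>_. recombined) N (\<lambda>\<omega> x. Y x \<omega>) m B"
  proof
    show "(\<lambda>n. \<integral>w. iexp (\<Sum>x<m. t x * recombined w x) \<partial>(N \<Otimes>\<^sub>M N)) \<longlonglongrightarrow> (\<integral>\<omega>. iexp (\<Sum>x<m. t x * Y x \<omega>) \<partial>N)" for t
      unfolding recombined_char by (rule tendsto_const)
  qed (use sq B Y_square_integrable in auto)
  from characters_converge.lipschitz_limit[OF this F] show ?thesis by (simp add: LIMSEQ_const_iff)
qed

end

end

section \<open>Events of positive probability for the limit process\<close>

context gaussian_limit
begin

text \<open>The variance is \<open>2 * pmf p r > 0\<close>, which rules out the degenerate case; a
  nondegenerate normal density is positive on every half-line.\<close>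

lemma difference_unbounded:
  assumes rs: "r \<noteq> s" "pmf p r = pmf p s" "0 < pmf p r"
  shows "0 < prob {\<omega> \<in> space N. Y r \<omega> - Y s \<omega> \<le> L}"
proof -
  let ?a = "\<lambda>x. if x = r then 1 else - 1 :: real"
  let ?Z = "\<lambda>\<omega>. \<Sum>x\<in>{r, s}. ?a x * Y x \<omega>"
  have Z: "?Z \<omega> = Y r \<omega> - Y s \<omega>" for \<omega> using rs(1) by simp
  have g: "gaussian_var N ?Z" by (rule gaussian_combination) simp
  have Zm: "?Z \<in> borel_measurable N" by simp
  have m0: "(\<integral>\<omega>. ?Z \<omega> \<partial>N) = 0" by (rule combination_mean)
  have var: "(\<integral>\<omega>. ?Z \<omega> * ?Z \<omega> \<partial>N) = 2 * pmf p r"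
    unfolding combination_product using rs(1) by (simp add: rs(2)[symmetric] algebra_simps)
  have nc: "\<not> (AE \<omega> in N. ?Z \<omega> = c)" for c
  proof
    assume ae: "AE \<omega> in N. ?Z \<omega> = c"
    have "(\<integral>\<omega>. ?Z \<omega> \<partial>N) = (\<integral>\<omega>. c \<partial>N)" using ae Zm by (intro integral_cong_AE) auto
    then have "c = 0" using m0 by (simp add: prob_space)
    then have "(\<integral>\<omega>. ?Z \<omega> * ?Z \<omega> \<partial>N) = (\<integral>\<omega>. 0 \<partial>N)" using ae Zm by (intro integral_cong_AE) auto
    then show False using var rs(3) by simp
  qed
  obtain \<mu> \<sigma> where d: "\<sigma> > 0" "distributed N lborel ?Z (normal_density \<mu> \<sigma>)"
    using g nc unfolding gaussian_var_def by blast
  have "emeasure N (?Z -` {..L} \<inter> space N) = (\<integral>\<^sup>+x. ennreal (normal_density \<mu> \<sigma> x) * indicator {..L} x \<partial>lborel)"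
    by (rule distributed_emeasure[OF d(2)]) simp
  moreover have "(\<integral>\<^sup>+x. ennreal (normal_density \<mu> \<sigma> x) * indicator {..L} x \<partial>lborel) \<noteq> 0"
  proof
    assume "(\<integral>\<^sup>+x. ennreal (normal_density \<mu> \<sigma> x) * indicator {..L} x \<partial>lborel) = 0"
    then have "AE x in lborel. ennreal (normal_density \<mu> \<sigma> x) * indicator {..L} x = 0"
      by (subst (asm) nn_integral_0_iff_AE) auto
    then have "AE x in lborel. x \<notin> {..L}"
    proof eventually_elim
      case (elim x)
      have "0 < normal_density \<mu> \<sigma> x" using d(1) by (rule normal_density_pos)
      then show ?case using elim by (auto simp: indicator_def split: if_splits)
    qed
    then have "AE x in lborel. x \<notin> {L - 1..L}" by eventually_elim auto
    then have "emeasure lborel {L - 1..L} = 0" by (subst (asm) AE_iff_measurable[of "{L - 1..L}"]) auto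
    then show False by simp
  qed
  moreover have "?Z -` {..L} \<inter> space N = {\<omega> \<in> space N. Y r \<omega> - Y s \<omega> \<le> L}" using Z by auto
  ultimately have "emeasure N {\<omega> \<in> space N. Y r \<omega> - Y s \<omega> \<le> L} \<noteq> 0" by (simp only: not_False_eq_True)
  then show ?thesis by (simp add: emeasure_eq_measure zero_less_measure_iff)
qed

text \<open>Here the paths enter as elements of l2: a square summable path is bounded, so one of
  countably many levels has positive probability.\<close>

lemma bounded_positive:
  obtains c where "0 < c" "0 < prob {\<omega> \<in> space N. \<forall>x. \<bar>Y x \<omega>\<bar> \<le> c}"
proof -
  define B where "B c = {\<omega> \<in> space N. \<forall>x. \<bar>Y x \<omega>\<bar> \<le> c}" for c :: real
  have B: "B c \<in> sets N" for c unfolding B_def by measurable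
  have "AE \<omega> in N. \<exists>n. \<omega> \<in> B (real (Suc n))"
  proof -
    have "AE \<omega> in N. summable (\<lambda>x. (Y x \<omega>)\<^sup>2)" using limit by (simp add: limit_process_def)
    then show ?thesis using AE_space
    proof eventually_elim
      case (elim \<omega>)
      have "Bseq (\<lambda>x. (Y x \<omega>)\<^sup>2)"
        using convergentI[OF summable_LIMSEQ_zero[OF elim(1)]] by (rule convergent_imp_Bseq)
      then obtain K where K: "\<And>x. norm ((Y x \<omega>)\<^sup>2) \<le> K" by (auto simp: Bseq_def)
      obtain n :: nat where n: "K \<le> real n" using real_arch_simple by blast
      have "\<bar>Y x \<omega>\<bar> \<le> real (Suc n)" for x
      proof (rule power2_le_imp_le)
        have "\<bar>Y x \<omega>\<bar>\<^sup>2 \<le> real n" using K[of x] n by simp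
        also have "\<dots> \<le> (real (Suc n))\<^sup>2" by (simp add: power2_eq_square algebra_simps)
        finally show "\<bar>Y x \<omega>\<bar>\<^sup>2 \<le> (real (Suc n))\<^sup>2" .
      qed simp
      then show ?case using elim(2) by (auto simp: B_def)
    qed
  qed
  have "\<exists>n. 0 < prob (B (real (Suc n)))"
  proof (rule ccontr)
    assume no: "\<not> ?thesis"
    have "prob (B (real (Suc n))) = 0" for n
    proof -
      have "\<not> 0 < prob (B (real (Suc n)))" using no by blast
      then show ?thesis using measure_nonneg[of N "B (real (Suc n))"] by linarith
    qed
    then have "AE \<omega> in N. \<omega> \<notin> B (real (Suc n))" for n
      using B by (subst AE_iff_measurable[OF _ refl]) (auto simp: emeasure_eq_measure B_def)
    then have "AE \<omega> in N. \<forall>n. \<omega> \<notin> B (real (Suc n))" by (simp add: AE_all_countable)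
    with \<open>AE \<omega> in N. \<exists>n. \<omega> \<in> B (real (Suc n))\<close> have "AE \<omega> in N. False" by eventually_elim blast
    then show False by simp
  qed
  then obtain n where n: "0 < prob (B (real (Suc n)))" by blast
  show ?thesis
  proof (rule that)
    show "0 < real (Suc n)" by simp
    show "0 < prob {\<omega> \<in> space N. \<forall>x. \<bar>Y x \<omega>\<bar> \<le> real (Suc n)}" using n unfolding B_def .
  qed
qed

text \<open>Taking the difference of coordinates \<open>r\<close> and \<open>s\<close> from an event
  where it is very negative, and the rest from an event where all coordinates are bounded, gives
  probability at least \<open>prob A * prob E\<close> for every finite number of coordinates;
  letting this number grow yields the event for all of them.\<close>

lemma separating_event_positive:
  assumes rs: "r \<noteq> s" "pmf p r = pmf p s" "0 < pmf p r"
  obtains c where "0 < c" "\<And>K. 0 < prob {\<omega> \<in> space N. Y r \<omega> - Y s \<omega> < - K \<and> \<bar>Y r \<omega> + Y s \<omega>\<bar> \<le> c \<and>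
    (\<forall>x. x \<noteq> r \<longrightarrow> x \<noteq> s \<longrightarrow> \<bar>Y x \<omega>\<bar> \<le> c)}"
proof -
  obtain b where b: "0 < b" "0 < prob {\<omega> \<in> space N. \<forall>x. \<bar>Y x \<omega>\<bar> \<le> b}" by (rule bounded_positive)
  \<comment> \<open>On bounded paths \<open>\<bar>Y r + Y s\<bar>\<close> is at most
    \<open>2 * b\<close>. The extra 1, like the one in the definition of \<open>A\<close>, leaves
    room for a Lipschitz function between two indicators.\<close>
  define c where "c = 2 * b + 1"
  have "0 < prob {\<omega> \<in> space N. Y r \<omega> - Y s \<omega> < - K \<and> \<bar>Y r \<omega> + Y s \<omega>\<bar> \<le> c \<and>
    (\<forall>x. x \<noteq> r \<longrightarrow> x \<noteq> s \<longrightarrow> \<bar>Y x \<omega>\<bar> \<le> c)}" for K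
  proof -
    define A where "A = {\<omega> \<in> space N. Y r \<omega> - Y s \<omega> \<le> - K - 1}"
    define E where "E = {\<omega> \<in> space N. \<forall>x. \<bar>Y x \<omega>\<bar> \<le> b}"
    have AE: "A \<in> sets N" "E \<in> sets N" unfolding A_def E_def by measurable
    have pos: "0 < prob A * prob E"
      unfolding A_def E_def by (intro mult_pos_pos b difference_unbounded rs)
    define m0 where "m0 = Suc (max r s)"
    define G where "G m = {\<omega> \<in> space N. Y r \<omega> - Y s \<omega> < - K \<and> \<bar>Y r \<omega> + Y s \<omega>\<bar> \<le> c \<and>
      (\<forall>x<m. x \<noteq> r \<longrightarrow> x \<noteq> s \<longrightarrow> \<bar>Y x \<omega>\<bar> \<le> c)}" for m
    have G: "G m \<in> sets N" for m unfolding G_def by measurable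
    have le: "prob A * prob E \<le> prob (G (i + m0))" for i
    proof -
      define m where "m = i + m0"
      have rsm: "r < m" "s < m" by (auto simp: m_def m0_def)
      interpret P: pair_prob_space N N ..
      let ?R = "recombined r s"
      define h where "h x v = (if x = r then max 0 (K + 1 + (v r - v s)) else
        if x = s then max 0 (\<bar>v r + v s\<bar> - 2 * b) else max 0 (\<bar>v x\<bar> - 2 * b))" for x and v :: "nat \<Rightarrow> real"
      \<comment> \<open>Equals 1 where all constraints hold with margin and 0 where one of the
        constraints of \<open>G m\<close> fails, since then the corresponding \<open>h x\<close> is
        at least 1.\<close>
      define F where "F v = max 0 (1 - (\<Sum>x<m. h x v))" for v
      have h_lip: "coord_lipschitz m (h x)" if "x < m" for x
      proof -
        consider "x = r" | "x \<noteq> r" "x = s" | "x \<noteq> r" "x \<noteq> s" by blast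
        then show ?thesis
        proof cases
          case 1
          have "coord_lipschitz m (\<lambda>v. max 0 (K + 1 + (v r - v s)))"
            by (rule coord_lipschitz_pair[OF rsm]) linarith
          then show ?thesis using 1 by (simp add: h_def[abs_def])
        next
          case 2
          have "coord_lipschitz m (\<lambda>v. max 0 (\<bar>v r + v s\<bar> - 2 * b))"
            by (rule coord_lipschitz_pair[OF rsm]) linarith
          then show ?thesis using 2 by (simp add: h_def[abs_def])
        next
          case 3
          have "coord_lipschitz m (\<lambda>v. max 0 (\<bar>v x\<bar> - 2 * b))"
          proof (rule coord_lipschitz_coord[OF that, of "\<lambda>t. max 0 (\<bar>t\<bar> - 2 * b)" 1])
            fix u v :: real
            have "\<bar>max 0 (\<bar>u\<bar> - 2 * b) - max 0 (\<bar>v\<bar> - 2 * b)\<bar> \<le> \<bar>\<bar>u\<bar> - \<bar>v\<bar>\<bar>" by linarith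
            also have "\<dots> \<le> 1 * \<bar>u - v\<bar>" by (simp add: abs_triangle_ineq3)
            finally show "\<bar>max 0 (\<bar>u\<bar> - 2 * b) - max 0 (\<bar>v\<bar> - 2 * b)\<bar> \<le> 1 * \<bar>u - v\<bar>" .
          qed simp
          then show ?thesis using 3 by (simp add: h_def[abs_def])
        qed
      qed
      have F_lip: "coord_lipschitz m F" unfolding F_def
      proof (rule coord_lipschitz_compose1[where f = "\<lambda>t. max 0 (1 - t)"])
        show "coord_lipschitz m (\<lambda>v. \<Sum>x<m. h x v)" using h_lip by (rule coord_lipschitz_sum)
        show "\<bar>max 0 (1 - t) - max 0 (1 - u)\<bar> \<le> \<bar>t - u\<bar>" for t u :: real by linarith
      qed
      have h0: "0 \<le> h x v" for x v by (simp add: h_def)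
      have F01: "0 \<le> F v" "F v \<le> 1" for v unfolding F_def using sum_nonneg[of "{..<m}" "\<lambda>x. h x v"] h0 by auto
      have Fn: "norm (F v) \<le> 1" for v using F01[of v] by simp
      have Fm: "(\<lambda>w. F (?R w)) \<in> borel_measurable (N \<Otimes>\<^sub>M N)" "(\<lambda>\<omega>. F (\<lambda>x. Y x \<omega>)) \<in> borel_measurable N"
        by (rule borel_measurable_continuous_coords[OF coord_lipschitz_continuous[OF F_lip]]; simp add:
            recombined_measurable[OF rs(1) rsm rs(2)])+
      have up: "F (\<lambda>x. Y x \<omega>) \<le> indicator (G m) \<omega>" if \<omega>: "\<omega> \<in> space N" for \<omega>
      proof (cases "\<omega> \<in> G m")
        case False
        have "\<exists>x<m. 1 \<le> h x (\<lambda>x. Y x \<omega>)"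
        proof -
          from False \<omega> consider "- K \<le> Y r \<omega> - Y s \<omega>" | "c < \<bar>Y r \<omega> + Y s \<omega>\<bar>"
            | x where "x < m" "x \<noteq> r" "x \<noteq> s" "c < \<bar>Y x \<omega>\<bar>"
            unfolding G_def by (auto simp: not_less not_le)
          then show ?thesis
          proof cases
            case 1 then show ?thesis using rsm by (intro exI[of _ r]) (simp add: h_def)
          next
            case 2 then show ?thesis using rsm rs(1) by (intro exI[of _ s]) (simp add: h_def c_def)
          next
            case 3 then show ?thesis by (intro exI[of _ x]) (simp add: h_def c_def)
          qed
        qed
        then obtain x where x: "x < m" "1 \<le> h x (\<lambda>x. Y x \<omega>)" by blast
        have "h x (\<lambda>x. Y x \<omega>) \<le> (\<Sum>x<m. h x (\<lambda>x. Y x \<omega>))" using x(1) h0 by (intro member_le_sum) auto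
        then show ?thesis using x(2) False by (simp add: F_def)
      qed (simp add: F01)
      have lo: "indicator (A \<times> E) w \<le> F (?R w)" for w
      proof (cases "w \<in> A \<times> E")
        case True
        then have w: "Y r (fst w) - Y s (fst w) \<le> - K - 1" "\<And>x. \<bar>Y x (snd w)\<bar> \<le> b" by (auto simp: A_def E_def)
        note defs = recombined_def[OF rs(1) rsm rs(2)] anti_part_def[OF rs(1) rsm rs(2)] sym_part_def[OF
            rs(1) rsm rs(2)]
        have "h x (?R w) = 0" for x
        proof -
          consider "x = r" | "x \<noteq> r" "x = s" | "x \<noteq> r" "x \<noteq> s" by blast
          then show ?thesis
          proof cases
            case 1
            have "?R w r - ?R w s = Y r (fst w) - Y s (fst w)" using rs(1) by (simp add: defs field_simps)
            then show ?thesis using 1 w(1) by (simp add: h_def)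
          next
            case 2
            have "?R w r + ?R w s = Y r (snd w) + Y s (snd w)" using rs(1) by (simp add: defs field_simps)
            then show ?thesis using 2 w(2)[of r] w(2)[of s] by (simp add: h_def)
          next
            case 3
            have "?R w x = Y x (snd w)" using 3 by (simp add: defs)
            then show ?thesis using 3 w(2)[of x] b(1) by (simp add: h_def)
          qed
        qed
        then show ?thesis by (simp add: F_def indicator_def)
      qed (simp add: F01)
      have "prob A * prob E = P.prob (A \<times> E)"
        using AE by (simp add: measure_def emeasure_pair_measure_Times enn2real_mult)
      also have "\<dots> = (\<integral>w. indicator (A \<times> E) w \<partial>(N \<Otimes>\<^sub>M N))"
        using AE by (simp add: pair_measureI)
      also have "\<dots> \<le> (\<integral>w. F (?R w) \<partial>(N \<Otimes>\<^sub>M N))"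
      proof (rule integral_mono[OF _ _ lo])
        show "integrable (N \<Otimes>\<^sub>M N) (\<lambda>w. indicator (A \<times> E) w :: real)"
          using AE by (intro P.P.integrable_const_bound[of _ 1]) (auto simp: indicator_def)
        show "integrable (N \<Otimes>\<^sub>M N) (\<lambda>w. F (?R w))"
          by (rule P.P.integrable_bounded[OF Fm(1) Fn])
      qed
      also have "\<dots> = (\<integral>\<omega>. F (\<lambda>x. Y x \<omega>) \<partial>N)" by (rule recombined_law[OF rs(1) rsm rs(2) F_lip])
      also have "\<dots> \<le> (\<integral>\<omega>. indicator (G m) \<omega> \<partial>N)"
      proof (rule integral_mono[OF _ _ up])
        show "integrable N (\<lambda>\<omega>. F (\<lambda>x. Y x \<omega>))" by (rule integrable_bounded[OF Fm(2) Fn])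
        show "integrable N (\<lambda>\<omega>. indicator (G m) \<omega> :: real)"
          using G by (intro integrable_const_bound[of _ 1]) (auto simp: indicator_def)
      qed
      also have "\<dots> = prob (G m)" using G by simp
      finally show ?thesis by (simp add: m_def)
    qed
    \<comment> \<open>The events decrease with the number of coordinates, so the uniform lower bound
      passes to their intersection.\<close>
    have "(\<lambda>i. prob (G (i + m0))) \<longlonglongrightarrow> prob (\<Inter>i. G (i + m0))"
      using G by (intro finite_Lim_measure_decseq) (auto simp: decseq_def G_def)
    then have "prob A * prob E \<le> prob (\<Inter>i. G (i + m0))"
      using le by (intro LIMSEQ_le_const) auto
    moreover have "(\<Inter>i. G (i + m0)) = {\<omega> \<in> space N. Y r \<omega> - Y s \<omega> < - K \<and> \<bar>Y r \<omega> + Y s \<omega>\<bar> \<le> c \<and>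
      (\<forall>x. x \<noteq> r \<longrightarrow> x \<noteq> s \<longrightarrow> \<bar>Y x \<omega>\<bar> \<le> c)}" (is "?I = ?E")
    proof (intro equalityI subsetI)
      fix \<omega> assume \<omega>: "\<omega> \<in> ?I"
      have "\<bar>Y x \<omega>\<bar> \<le> c" if "x \<noteq> r" "x \<noteq> s" for x
      proof -
        have "\<omega> \<in> G (Suc x + m0)" using \<omega> by blast
        then show ?thesis using that by (simp add: G_def)
      qed
      moreover have "\<omega> \<in> G (0 + m0)" using \<omega> by blast
      ultimately show "\<omega> \<in> ?E" by (simp add: G_def)
    qed (simp add: G_def)
    ultimately show ?thesis using pos by simp
  qed
  moreover have "0 < c" using b(1) by (simp add: c_def)
  ultimately show ?thesis by (intro that)
qed

end

context decreasing_pmf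
begin

text \<open>If the first entry of a flat block is very negative and the last one compensates it, then every
  proper initial segment averages below the whole block, so the block is pooled completely.\<close>

lemma block_pooled:
  assumes f: "flat_block p r s" and c: "0 < c"
    and D: "y r - y s < - ((4 * real (s + 1 - r) + 1) * c)" and S: "\<bar>y r + y s\<bar> \<le> c"
    and o: "\<And>x. x \<noteq> r \<Longrightarrow> x \<noteq> s \<Longrightarrow> \<bar>y x\<bar> \<le> c"
  shows "\<bar>gp y x\<bar> \<le> c" and "real (s + 1 - r) * c < \<bar>y r\<bar>"
proof -
  define n where "n = real (s + 1 - r)"
  have rs: "r < s" using flat_blockD(1)[OF f] .
  have n: "2 \<le> n" "n = real s + 1 - real r" using rs by (auto simp: n_def)
  have nc: "0 < n * c" using n c by simp
  \<comment> \<open>Adding the bounds on \<open>y r - y s\<close> and \<open>y r + y s\<close> gives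
    \<open>2 * y r < - 4 * n * c\<close>; the extra \<open>c\<close> in the hypothesis absorbs the
    sum.\<close>
  have yr: "y r < - (2 * (n * c))"
  proof -
    have "y r - y s < - (4 * (n * c) + c)" using D by (simp add: n_def algebra_simps)
    then show ?thesis using S by linarith
  qed
  then show "real (s + 1 - r) * c < \<bar>y r\<bar>" using nc unfolding n_def by linarith
  have mid: "\<bar>sum y {Suc r..<j}\<bar> \<le> (real j - 1 - real r) * c" if "r < j" "j \<le> s" for j
  proof -
    have "\<bar>sum y {Suc r..<j}\<bar> \<le> (\<Sum>x\<in>{Suc r..<j}. c)"
      using that by (intro order_trans[OF sum_abs] sum_mono o) auto
    then show ?thesis using that by (simp add: of_nat_diff diff_diff_eq)
  qed
  have first: "sum y {r..<j} = y r + sum y {Suc r..<j}" if "r < j" for j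
    using that by (simp add: sum.atLeast_Suc_lessThan)
  have total: "sum y {r..<Suc s} = (y r + y s) + sum y {Suc r..<s}"
    using rs first[of s] by simp
  define \<alpha> where "\<alpha> = sum y {r..<Suc s} / n"
  have tot: "\<bar>sum y {r..<Suc s}\<bar> \<le> n * c"
  proof -
    have "\<bar>sum y {r..<Suc s}\<bar> \<le> c + (real s - 1 - real r) * c"
      unfolding total using S mid[of s] rs by linarith
    also have "\<dots> \<le> n * c" using c by (simp add: n(2) algebra_simps)
    finally show ?thesis .
  qed
  have \<alpha>: "\<bar>\<alpha>\<bar> \<le> c" using tot n by (simp add: \<alpha>_def abs_divide pos_divide_le_eq mult.commute)
  have sa: "sum (\<lambda>_. \<alpha>) {r..<j} = (real j - real r) * \<alpha>" if "r \<le> j" for j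
    using that by (simp add: of_nat_diff)
  \<comment> \<open>The constant overall average \<open>\<alpha>\<close> is the fit: a proper
    initial segment of the data sums to at most \<open>- n * c\<close>, whereas
    \<open>\<alpha>\<close>, bounded by \<open>c\<close>, contributes at least that.\<close>
  have "antitone_fit r (Suc s) y (\<lambda>_. \<alpha>)"
    unfolding antitone_fit_def pooled_def
  proof (intro conjI allI impI)
    have "n * \<alpha> = sum y {r..<Suc s}" using n by (simp add: \<alpha>_def)
    then show "sum y {r..<Suc s} = sum (\<lambda>_. \<alpha>) {r..<Suc s}"
      using rs n(2) by (simp only: sa[of "Suc s"] less_imp_le less_SucI) (simp add: algebra_simps)
    fix j assume j: "r < j \<and> j < Suc s"
    have jn: "real j - 1 - real r \<le> n" "0 \<le> real j - real r" "real j - real r \<le> n" using j n(2) by auto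
    have "sum y {r..<j} \<le> - (2 * (n * c)) + (real j - 1 - real r) * c"
      using first[of j] mid[of j] j yr by linarith
    also have "\<dots> \<le> - (n * c)" using mult_right_mono[OF jn(1), of c] c by linarith
    also have "\<dots> \<le> (real j - real r) * \<alpha>"
    proof -
      have "\<bar>(real j - real r) * \<alpha>\<bar> \<le> n * c"
        unfolding abs_mult using jn \<alpha> n by (intro mult_mono) auto
      then show ?thesis by linarith
    qed
    finally show "sum y {r..<j} \<le> sum (\<lambda>_. \<alpha>) {r..<j}" using sa[of j] j by simp
  qed simp_all
  then have block: "gp y x = \<alpha>" if "r \<le> x" "x \<le> s" for x
    using antitone_fit_unique[OF grenander_process_block[OF f]] that by simp
  \<comment> \<open>Away from the block all data are bounded by \<open>c\<close>, and fits between
    separators preserve bounds.\<close>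
  have outside: "\<bar>gp y x\<bar> \<le> c"
    if "weak_cut p a" "weak_cut p b" "a \<le> x" "x < b" "\<And>z. a \<le> z \<Longrightarrow> z < b \<Longrightarrow> \<bar>y z\<bar> \<le> c" for a b
  proof -
    have pl: "pooled a b y (gp y)" using that by (intro gp_pooled) auto
    have "y z \<le> c" "- c \<le> y z" if "a \<le> z" "z < b" for z
      using \<open>\<And>z. a \<le> z \<Longrightarrow> z < b \<Longrightarrow> \<bar>y z\<bar> \<le> c\<close>[OF that] by auto
    then have "gp y x \<le> c" "- c \<le> gp y x" using pooled_bounds[OF pl that(3,4)] by blast+
    then show ?thesis by auto
  qed
  have wc: "weak_cut p 0" "weak_cut p r" "weak_cut p (Suc s)"
    using flat_blockD(2,3)[OF f] by (auto simp: weak_cut_def cut_def)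
  consider "x < r" | "r \<le> x" "x \<le> s" | "s < x" by linarith
  then show "\<bar>gp y x\<bar> \<le> c"
  proof cases
    case 1
    show ?thesis
    proof (rule outside[OF wc(1,2) le0 1])
      show "\<bar>y z\<bar> \<le> c" if "z < r" for z using that rs by (intro o) auto
    qed
  next
    case 2 then show ?thesis using block \<alpha> by simp
  next
    case 3
    obtain b where b: "Suc x \<le> b" "weak_cut p b" using weak_cut_unbounded by blast
    show ?thesis
    proof (rule outside[OF wc(3) b(2)])
      show "\<bar>y z\<bar> \<le> c" if "Suc s \<le> z" for z using that rs by (intro o) auto
    qed (use 3 b in auto)
  qed
qed

lemma flat_block_exists:
  assumes "\<not> strictly_monotone p"
  obtains r s where "flat_block p r s"
proof -
  obtain x where x: "0 < pmf p x" "pmf p x \<le> pmf p (x + 1)"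
    using assms by (auto simp: strictly_monotone_def not_less)
  then have eq: "pmf p (x + 1) = pmf p x" using antimono[of x "x + 1"] by simp
  obtain r where r: "r \<le> x" "pmf p r = pmf p x" "cut p r" by (rule block_start)
  have "0 < pmf p (x + 1)" using x eq by simp
  then obtain s where s: "x + 1 \<le> s" "pmf p s = pmf p (x + 1)" "pmf p (s + 1) < pmf p s" by (rule block_end)
  have "pmf p r = pmf p s" using r(2) s(2) eq by simp
  then have "pmf p z = pmf p r" if "r \<le> z" "z \<le> s" for z using eq_between that by blast
  moreover have "r < s" using r(1) s(1) by simp
  ultimately have "flat_block p r s" using r(3) s(3) by (intro flat_blockI)
  then show ?thesis by (rule that)
qed

end

section \<open>The three estimators\<close>

lemma dominated_refl [simp]: "dominated A v v"
  by (simp add: dominated_def)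

lemma pooled_dominated_0: "pooled a b w g \<Longrightarrow> dominated {a..<b} g w"
  using pooled_dominated[of a b w g "\<lambda>_. 0"] by simp

lemma empirical_cong:
  assumes "\<And>i. 1 \<le> i \<Longrightarrow> i \<le> n \<Longrightarrow> xs i = ys i"
  shows "empirical n xs = empirical n ys" "empirical_vector n xs = empirical_vector n ys"
proof -
  have "{i \<in> {1..n}. xs i = x} = {i \<in> {1..n}. ys i = x}" for x using assms by auto
  then show 1: "empirical n xs = empirical n ys" by (simp add: empirical_def fun_eq_iff)
  have "xs ` {1..n} = ys ` {1..n}" using assms by (intro image_cong) auto
  then show "empirical_vector n xs = empirical_vector n ys" by (simp only: empirical_vector_def 1)
qed

context sampling
begin

definition scaled_error :: "(nat \<Rightarrow> (nat \<Rightarrow> nat) \<Rightarrow> nat \<Rightarrow> real) \<Rightarrow> nat \<Rightarrow> 'a \<Rightarrow> nat \<Rightarrow> real" where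
  "scaled_error est n \<omega> x = sqrt n * (est n (\<lambda>i. X i \<omega>) x - pmf p x)"

lemma scaled_error_empirical: "scaled_error empirical = V"
  by (simp add: scaled_error_def V_def fun_eq_iff)

lemma estimator_measurable:
  fixes est :: "nat \<Rightarrow> (nat \<Rightarrow> nat) \<Rightarrow> nat \<Rightarrow> real"
  assumes est: "\<And>xs ys. empirical_vector n xs = empirical_vector n ys \<Longrightarrow> est n xs = est n ys"
  shows "(\<lambda>\<omega>. est n (\<lambda>i. X i \<omega>) x) \<in> borel_measurable M"
proof (rule sample_measurable[of n "\<lambda>xs. est n xs x"])
  fix xs ys :: "nat \<Rightarrow> nat" assume "\<And>i. 1 \<le> i \<Longrightarrow> i \<le> n \<Longrightarrow> xs i = ys i"
  then have "est n xs = est n ys" by (intro est empirical_cong(2))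
  then show "est n xs x = est n ys x" by (rule fun_cong)
qed

lemma scaled_error_measurable:
  assumes "\<And>xs ys. empirical_vector n xs = empirical_vector n ys \<Longrightarrow> est n xs = est n ys"
  shows "(\<lambda>\<omega>. scaled_error est n \<omega> x) \<in> borel_measurable M"
  unfolding scaled_error_def
  by (intro borel_measurable_times borel_measurable_diff borel_measurable_const estimator_measurable assms)

end

section \<open>Limits for the three estimators and the strict comparison\<close>

context risk_functional
begin

lemma empirical_limit: "(\<lambda>n. \<integral>\<^sup>+\<omega>. \<Phi> (V n \<omega>) \<partial>M) \<longlonglongrightarrow> (\<integral>\<^sup>+\<omega>. \<Phi> (Yv \<omega>) \<partial>N)"
proof (rule risk_limit[where T = "\<lambda>y. y"])
  show "coord_lipschitz m (\<lambda>y. y x)" if "x < m" for m x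
    by (rule coord_lipschitz_coord[OF that, of "\<lambda>t. t" 1]) simp_all
qed auto

lemma error_bound:
  assumes "1 \<le> n" "\<And>x. \<bar>V n \<omega> x\<bar> \<le> sqrt n * d"
  shows "\<bar>empirical n (\<lambda>i. X i \<omega>) x - pmf p x\<bar> \<le> d"
  using assms(2)[of x] assms(1) by (simp add: V_def abs_mult)

lemma rearrangement_limit:
  "(\<lambda>n. \<integral>\<^sup>+\<omega>. \<Phi> (scaled_error rearrangement_estimator n \<omega>) \<partial>M) \<longlonglongrightarrow> (\<integral>\<^sup>+\<omega>. \<Phi> (Yv \<omega>) \<partial>N)"
proof (rule risk_limit[where T = "\<lambda>y. y"])
  show "(\<lambda>\<omega>. scaled_error rearrangement_estimator n \<omega> x) \<in> borel_measurable M" for n x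
    by (rule scaled_error_measurable) (simp add: rearrangement_estimator_def)
  show "coord_lipschitz m (\<lambda>y. y x)" if "x < m" for m x
    by (rule coord_lipschitz_coord[OF that, of "\<lambda>t. t" 1]) simp_all
  fix n :: nat and \<omega> :: 'a assume n: "1 \<le> n"
  let ?xs = "\<lambda>i. X i \<omega>" and ?R = "scaled_error rearrangement_estimator n \<omega>"
  let ?L = "Suc (Max (?xs ` {1..n}))"
  show "\<exists>L\<ge>L0. dominated {0..<L} ?R (V n \<omega>)" for L0
  proof (intro exI conjI)
    have "dominated {0..<max L0 ?L} (\<lambda>x. rearrangement_estimator n ?xs x - pmf p x) (\<lambda>x. empirical n ?xs
        x - pmf p x)"
      by (rule rearrangement_estimator_tail[OF n]) (auto intro: antimono)
    then show "dominated {0..<max L0 ?L} ?R (V n \<omega>)"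
      unfolding scaled_error_def[abs_def] V_def[abs_def] by (rule dominated_scale)
  qed simp
  fix m d assume m: "cut p m" and V: "\<And>x. \<bar>V n \<omega> x\<bar> \<le> sqrt n * d"
    and gap: "\<And>j. 0 < j \<Longrightarrow> j \<le> m \<Longrightarrow> cut p j \<Longrightarrow> 2 * d \<le> pmf p (j - 1) - pmf p j"
  note loc = rearrangement_localizes[OF n _ m _ error_bound[OF n V] gap]
  \<comment> \<open>Equality for every function, hence domination in both directions, although the
    head itself is only a permutation of that of \<open>V n\<close>.\<close>
  have eq: "(\<Sum>x<m. \<psi> (?R x)) = (\<Sum>x<m. \<psi> (V n \<omega> x))" for \<psi> :: "real \<Rightarrow> real"
    using loc(1)[of "max m ?L" "\<lambda>t. \<psi> (sqrt n * t)"] by (simp add: scaled_error_def V_def)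
  have "\<exists>L\<ge>L0. dominated {m..<L} ?R (V n \<omega>)" for L0
  proof (intro exI conjI)
    have "dominated {m..<max L0 (max m ?L)} (\<lambda>x. rearrangement_estimator n ?xs x - pmf p x) (\<lambda>x.
        empirical n ?xs x - pmf p x)"
      by (rule loc(2)) auto
    then show "dominated {m..<max L0 (max m ?L)} ?R (V n \<omega>)"
      unfolding scaled_error_def[abs_def] V_def[abs_def] by (rule dominated_scale)
  qed simp
  then show "dominated {0..<m} ?R (V n \<omega>) \<and> dominated {0..<m} (V n \<omega>) ?R \<and> (\<forall>L0. \<exists>L\<ge>L0. dominated
      {m..<L} ?R (V n \<omega>))"
    using eq by (simp add: dominated_def atLeast0LessThan)
qed auto

lemma gp_coord_lipschitz:
  assumes "weak_cut p m" "x < m"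
  shows "coord_lipschitz m (\<lambda>y. gp y x)"
  unfolding coord_lipschitz_def using gp_lipschitz[OF assms] by (intro exI[of _ 1]) simp

lemma gp_measurable: "(\<lambda>\<omega>. gp (Yv \<omega>) x) \<in> borel_measurable N"
proof -
  obtain m where "Suc x \<le> m" "weak_cut p m" using weak_cut_unbounded by blast
  then show ?thesis by (intro coord_measurable(2)[OF gp_coord_lipschitz[of m]]) auto
qed

lemma gp_tail_dominated:
  assumes "cut p m"
  shows "\<exists>L\<ge>L0. dominated {m..<L} (gp y) y"
proof -
  obtain L where L: "max L0 m \<le> L" "weak_cut p L" using weak_cut_unbounded by blast
  have "pooled m L y (gp y)" using L assms by (intro gp_pooled) (auto simp: weak_cut_def)
  then show ?thesis using L by (intro exI[of _ L]) (auto intro: pooled_dominated_0)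
qed

lemma cut_0 [simp]: "cut p 0" by (simp add: cut_def)

text \<open>The map is \<open>gp\<close>: outside the bad event the scaled error coincides with
  \<open>gp (V n \<omega>)\<close> below the cut.\<close>

lemma grenander_limit:
  "(\<lambda>n. \<integral>\<^sup>+\<omega>. \<Phi> (scaled_error grenander_estimator n \<omega>) \<partial>M) \<longlonglongrightarrow> (\<integral>\<^sup>+\<omega>. \<Phi> (gp (Yv \<omega>)) \<partial>N)"
proof (rule risk_limit[where T = gp])
  show "(\<lambda>\<omega>. scaled_error grenander_estimator n \<omega> x) \<in> borel_measurable M" for n x
    by (rule scaled_error_measurable) (simp add: grenander_estimator_def)
  show "coord_lipschitz m (\<lambda>y. gp y x)" if "cut p m" "x < m" for m x
    using that by (intro gp_coord_lipschitz) (auto simp: weak_cut_def)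
  show "(\<lambda>\<omega>. gp (Yv \<omega>) x) \<in> borel_measurable N" for x by (rule gp_measurable)
  show "dominated {0..<m} (gp y) y" if "cut p m" for m y
    using that by (intro pooled_dominated_0 gp_pooled) (auto simp: weak_cut_def)
  show "\<exists>L\<ge>L0. dominated {m..<L} (gp y) y" if "cut p m" for m y L0 using that by (rule gp_tail_dominated)
  fix n :: nat and \<omega> :: 'a assume n: "1 \<le> n"
  let ?xs = "\<lambda>i. X i \<omega>" and ?G = "scaled_error grenander_estimator n \<omega>"
  let ?L = "Suc (Max (?xs ` {1..n}))"
  have scale: "dominated {a..<b} ?G (V n \<omega>)" if "pooled a b (empirical n ?xs) (grenander_estimator n
      ?xs)" for a b
    unfolding scaled_error_def[abs_def] V_def[abs_def]
    by (intro dominated_scale pooled_dominated[OF that] antimono) simp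
  show "\<exists>L\<ge>L0. dominated {0..<L} ?G (V n \<omega>)" for L0
  proof (intro exI conjI)
    have "antitone_fit 0 (max L0 ?L) (empirical n ?xs) (grenander_estimator n ?xs)"
      by (rule grenander_estimator_antitone_fit[OF n]) simp
    then show "dominated {0..<max L0 ?L} ?G (V n \<omega>)" by (intro scale) (simp add: antitone_fit_def)
  qed simp
  fix m d assume m: "cut p m" and V: "\<And>x. \<bar>V n \<omega> x\<bar> \<le> sqrt n * d"
    and gap: "\<And>j. 0 < j \<Longrightarrow> j \<le> m \<Longrightarrow> cut p j \<Longrightarrow> 2 * d \<le> pmf p (j - 1) - pmf p j"
  have sn: "0 < sqrt n" using n by simp
  have antitone_fit: "antitone_fit 0 L (empirical n ?xs) (grenander_estimator n ?xs)" if "max m ?L \<le> L" for L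
    using that by (intro grenander_estimator_antitone_fit[OF n]) simp
  have eq: "?G x = gp (V n \<omega>) x" if "x < m" for x
    using antitone_fit_localizes(1)[OF antitone_fit[OF order_refl] m _ sn error_bound[OF n V] gap that]
    by (simp add: scaled_error_def V_def[abs_def])
  have "\<exists>L\<ge>L0. dominated {m..<L} ?G (V n \<omega>)" for L0
  proof (intro exI conjI)
    show "dominated {m..<max L0 (max m ?L)} ?G (V n \<omega>)"
      by (rule scale, rule antitone_fit_localizes(2)[OF antitone_fit m _ sn error_bound[OF n V] gap]) auto
  qed simp
  moreover have "dominated {0..<m} ?G (gp (V n \<omega>))" "dominated {0..<m} (gp (V n \<omega>)) ?G"
    by (subst dominated_cong[where u' = "gp (V n \<omega>)" and v' = "gp (V n \<omega>)"]; simp add: eq)+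
  ultimately show "dominated {0..<m} ?G (gp (V n \<omega>)) \<and> dominated {0..<m} (gp (V n \<omega>)) ?G \<and>
      (\<forall>L0. \<exists>L\<ge>L0. dominated {m..<L} ?G (V n \<omega>))" by blast
qed

lemma gp_le: "\<Phi> (gp y) \<le> \<Phi> y"
  using dom_tail[of 0 "gp y" y] gp_tail_dominated[of 0] by simp

lemma grenander_le: "(\<integral>\<^sup>+\<omega>. \<Phi> (gp (Yv \<omega>)) \<partial>N) \<le> (\<integral>\<^sup>+\<omega>. \<Phi> (Yv \<omega>) \<partial>N)"
  by (intro nn_integral_mono gp_le)

text \<open>The premise \<open>strict\<close> is deterministic and left to the individual loss. The
  fitted loss never exceeds the original one and its mean is finite, so it suffices that the event
  of a fully pooled block has positive probability.\<close>

lemma grenander_less: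
  assumes f: "flat_block p r s"
    and strict: "\<And>y c. 0 < c \<Longrightarrow> (\<And>x. \<bar>gp y x\<bar> \<le> c) \<Longrightarrow> real (s + 1 - r) * c < \<bar>y r\<bar> \<Longrightarrow> \<Phi> y < \<infinity> \<Longrightarrow> \<Phi> (gp y) < \<Phi> y"
  shows "(\<integral>\<^sup>+\<omega>. \<Phi> (gp (Yv \<omega>)) \<partial>N) < (\<integral>\<^sup>+\<omega>. \<Phi> (Yv \<omega>) \<partial>N)"
proof (rule nn_integral_less)
  show "(\<lambda>\<omega>. \<Phi> (gp (Yv \<omega>))) \<in> borel_measurable N" by (rule meas(2)) (rule gp_measurable)
  show Ym: "(\<lambda>\<omega>. \<Phi> (Yv \<omega>)) \<in> borel_measurable N" by (rule meas(2)) simp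
  have "(\<integral>\<^sup>+\<omega>. \<Phi> (gp (Yv \<omega>)) \<partial>N) < \<infinity>" using grenander_le finite_limit by (rule le_less_trans)
  then show "(\<integral>\<^sup>+\<omega>. \<Phi> (gp (Yv \<omega>)) \<partial>N) \<noteq> \<infinity>" by simp
  show "AE \<omega> in N. \<Phi> (gp (Yv \<omega>)) \<le> \<Phi> (Yv \<omega>)" by (simp add: gp_le)
  have rs: "r \<noteq> s" "pmf p r = pmf p s" "0 < pmf p r"
    using flat_blockD(1)[OF f] flat_block_const[OF f, of r s] flat_block_pos[OF f, of r] by auto
  obtain c where c: "0 < c" "\<And>K. 0 < N.prob {\<omega> \<in> space N. Y r \<omega> - Y s \<omega> < - K \<and> \<bar>Y r \<omega> + Y s \<omega>\<bar> \<le> c \<and>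
      (\<forall>x. x \<noteq> r \<longrightarrow> x \<noteq> s \<longrightarrow> \<bar>Y x \<omega>\<bar> \<le> c)}"
    by (rule N.separating_event_positive[OF rs], rule that)
  define E where "E = {\<omega> \<in> space N. Y r \<omega> - Y s \<omega> < - ((4 * real (s + 1 - r) + 1) * c) \<and> \<bar>Y r \<omega> + Y s \<omega>\<bar> \<le> c \<and>
      (\<forall>x. x \<noteq> r \<longrightarrow> x \<noteq> s \<longrightarrow> \<bar>Y x \<omega>\<bar> \<le> c)}"
  have E: "E \<in> sets N" unfolding E_def by measurable
  have fin: "AE \<omega> in N. \<Phi> (Yv \<omega>) \<noteq> \<infinity>"
    using finite_limit by (intro nn_integral_PInf_AE[OF Ym]) auto
  show "\<not> (AE \<omega> in N. \<Phi> (Yv \<omega>) \<le> \<Phi> (gp (Yv \<omega>)))"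
  proof
    assume "AE \<omega> in N. \<Phi> (Yv \<omega>) \<le> \<Phi> (gp (Yv \<omega>))"
    with fin have "AE \<omega> in N. \<omega> \<notin> E"
    proof eventually_elim
      case (elim \<omega>)
      show ?case
      proof
        assume "\<omega> \<in> E"
        then have e: "Y r \<omega> - Y s \<omega> < - ((4 * real (s + 1 - r) + 1) * c)" "\<bar>Y r \<omega> + Y s \<omega>\<bar> \<le> c"
          "\<And>x. x \<noteq> r \<Longrightarrow> x \<noteq> s \<Longrightarrow> \<bar>Y x \<omega>\<bar> \<le> c" by (auto simp: E_def)
        have "\<Phi> (gp (Yv \<omega>)) < \<Phi> (Yv \<omega>)"
        proof (rule strict[OF c(1)])
          show "\<bar>gp (Yv \<omega>) x\<bar> \<le> c" for x by (rule block_pooled(1)[OF f c(1) e])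
          show "real (s + 1 - r) * c < \<bar>Y r \<omega>\<bar>" by (rule block_pooled(2)[OF f c(1) e])
        qed (use elim in \<open>simp add: less_top\<close>)
        then show False using elim by simp
      qed
    qed
    then have "N.prob E = 0"
      using E by (subst (asm) AE_iff_measurable[OF E]) (auto simp: N.emeasure_eq_measure dest:
          sets.sets_into_space)
    then show False using c(2)[of "(4 * real (s + 1 - r) + 1) * c"] by (simp add: E_def)
  qed
qed

end

context estimation
begin

text \<open>One data entry outweighs the whole fitted block: the \<open>n\<close> fitted entries
  contribute at most \<open>n * c powr k \<le> (n * c) powr k\<close>, which is less than the term
  at \<open>r\<close>. The loss on either side of the block does not increase.\<close>

lemma power_loss_gp_less:
  assumes k: "1 \<le> k" and f: "flat_block p r s" and c: "0 < c" "\<And>x. \<bar>gp y x\<bar> \<le> c"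
    "real (s + 1 - r) * c < \<bar>y r\<bar>" and fin: "power_loss k y < \<infinity>"
  shows "power_loss k (gp y) < power_loss k y"
proof -
  define m where "m = Suc s"
  have m: "cut p m" "r < m" "cut p r" using flat_blockD[OF f] by (auto simp: m_def cut_def)
  have split: "power_loss k v = ennreal (\<Sum>x<m. \<bar>v x\<bar> powr k) + power_loss k (on {m..} v)" for v
  proof -
    have "power_loss k v = (\<Sum>x. ennreal (\<bar>v (x + m)\<bar> powr k)) + (\<Sum>x<m. ennreal (\<bar>v x\<bar> powr k))"
      unfolding power_loss_def by (rule suminf_offset) simp
    then show ?thesis by (simp add: power_loss_tail add.commute)
  qed
  have head: "(\<Sum>x<m. f x) = (\<Sum>x<r. f x) + (\<Sum>x\<in>{r..<m}. f x)" for f :: "nat \<Rightarrow> real"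
    using sum.atLeastLessThan_concat[of 0 r m f] m by (simp add: atLeast0LessThan)
  have "(\<Sum>x<r. \<bar>gp y x\<bar> powr k) \<le> (\<Sum>x<r. \<bar>y x\<bar> powr k)"
  proof -
    have "dominated {0..<r} (gp y) y"
      using m by (intro pooled_dominated_0 gp_pooled) (auto simp: weak_cut_def cut_def)
    then show ?thesis using convex_on_abs_powr[OF k] unfolding dominated_def atLeast0LessThan by blast
  qed
  moreover have "(\<Sum>x\<in>{r..<m}. \<bar>gp y x\<bar> powr k) < (\<Sum>x\<in>{r..<m}. \<bar>y x\<bar> powr k)"
  proof -
    define n where "n = real (s + 1 - r)"
    have n: "1 \<le> n" using flat_blockD(1)[OF f] by (simp add: n_def)
    have "(\<Sum>x\<in>{r..<m}. \<bar>gp y x\<bar> powr k) \<le> (\<Sum>x\<in>{r..<m}. c powr k)"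
      using c k by (intro sum_mono powr_mono2) auto
    also have "\<dots> = n * c powr k" using m by (simp add: n_def m_def)
    also have "\<dots> \<le> n powr k * c powr k"
      using powr_mono[of 1 k n] n k by (intro mult_right_mono) auto
    also have "\<dots> = (n * c) powr k" using n c by (simp add: powr_mult)
    also have "\<dots> < \<bar>y r\<bar> powr k" using c n k by (intro powr_less_mono2) (auto simp: n_def)
    also have "\<dots> \<le> (\<Sum>x\<in>{r..<m}. \<bar>y x\<bar> powr k)" using m by (intro member_le_sum) auto
    finally show ?thesis .
  qed
  ultimately have lt: "(\<Sum>x<m. \<bar>gp y x\<bar> powr k) < (\<Sum>x<m. \<bar>y x\<bar> powr k)" unfolding head by linarith
  have tail: "power_loss k (on {m..} (gp y)) \<le> power_loss k (on {m..} y)"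
  proof (rule power_loss_tail_mono[OF k])
    fix L0
    obtain L where L: "max L0 m \<le> L" "weak_cut p L" using weak_cut_unbounded by blast
    have "pooled m L y (gp y)" using L m by (intro gp_pooled) (auto simp: weak_cut_def)
    then show "\<exists>L\<ge>L0. dominated {m..<L} (gp y) y" using L by (intro exI[of _ L]) (auto intro:
        pooled_dominated_0)
  qed
  \<comment> \<open>A strict inequality between heads survives adding the tail only if the tail is
    finite.\<close>
  have fin': "power_loss k (on {m..} y) < \<top>" using le_less_trans[OF power_loss_on_le fin] by simp
  have "power_loss k (gp y) \<le> power_loss k (on {m..} y) + ennreal (\<Sum>x<m. \<bar>gp y x\<bar> powr k)"
    unfolding split[of "gp y"] using tail by (simp add: add.commute add_left_mono)
  also have "\<dots> < power_loss k (on {m..} y) + ennreal (\<Sum>x<m. \<bar>y x\<bar> powr k)"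
    using lt fin' by (simp add: ennreal_add_left_cancel_less ennreal_less_iff sum_nonneg)
  also have "\<dots> = power_loss k y" unfolding split[of y] by (rule add.commute)
  finally show ?thesis .
qed

lemma sup_norm_gp_less:
  assumes f: "flat_block p r s" and c: "0 < c" "\<And>x. \<bar>gp y x\<bar> \<le> c" "real (s + 1 - r) * c < \<bar>y r\<bar>"
  shows "sup_norm (gp y) < sup_norm y"
proof -
  have "1 \<le> real (s + 1 - r)" using flat_blockD(1)[OF f] by simp
  then have "1 * c \<le> real (s + 1 - r) * c" using c(1) by (intro mult_right_mono) auto
  then have lt: "c < \<bar>y r\<bar>" using c(3) by simp
  have "sup_norm (gp y) \<le> ennreal c" unfolding sup_norm_def by (intro SUP_least ennreal_leI c)
  also have "\<dots> < ennreal \<bar>y r\<bar>" using lt c(1) by (simp add: ennreal_less_iff)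
  also have "\<dots> \<le> sup_norm y" by (rule sup_norm_ge)
  finally show ?thesis .
qed

section \<open>From losses of scaled errors to scaled risks\<close>

lemma power_risk_scaled:
  assumes k: "0 < k" and est: "\<And>n xs ys. empirical_vector n xs = empirical_vector n ys \<Longrightarrow> est n xs = est n ys"
  shows "ennreal (real n powr (k / 2)) * risk k M p (\<lambda>\<omega>. est n (\<lambda>i. X i \<omega>)) = (\<integral>\<^sup>+\<omega>. power_loss k
      (scaled_error est n \<omega>) \<partial>M)"
proof -
  let ?e = "\<lambda>\<omega> x. est n (\<lambda>i. X i \<omega>) x - pmf p x"
  have em: "(\<lambda>\<omega>. ?e \<omega> x) \<in> borel_measurable M" for x
    by (intro borel_measurable_diff borel_measurable_const estimator_measurable est)
  have pw: "\<bar>sqrt n * t\<bar> powr k = real n powr (k / 2) * \<bar>t\<bar> powr k" for t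
    by (simp add: abs_mult powr_mult powr_half_sqrt[symmetric] powr_powr)
  have "power_loss k (scaled_error est n \<omega>) = ennreal (real n powr (k / 2)) * power_loss k (?e \<omega>)" for \<omega>
    unfolding power_loss_def scaled_error_def pw by (simp add: ennreal_mult)
  then show ?thesis
    unfolding risk_def power_loss_def[symmetric]
    by (simp add: nn_integral_cmult power_loss_measurable[OF em])
qed

lemma sup_risk_scaled:
  assumes est: "\<And>n xs ys. empirical_vector n xs = empirical_vector n ys \<Longrightarrow> est n xs = est n ys"
  shows "ennreal (real n powr (1 / 2)) * sup_risk M p (\<lambda>\<omega>. est n (\<lambda>i. X i \<omega>)) = (\<integral>\<^sup>+\<omega>. sup_norm
      (scaled_error est n \<omega>) \<partial>M)"
proof -
  let ?e = "\<lambda>\<omega> x. est n (\<lambda>i. X i \<omega>) x - pmf p x"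
  have em: "(\<lambda>\<omega>. ?e \<omega> x) \<in> borel_measurable M" for x
    by (intro borel_measurable_diff borel_measurable_const estimator_measurable est)
  have "sup_norm (scaled_error est n \<omega>) = ennreal (real n powr (1 / 2)) * sup_norm (?e \<omega>)" for \<omega>
    unfolding sup_norm_def scaled_error_def SUP_mult_left_ennreal
    by (simp add: abs_mult ennreal_mult powr_half_sqrt)
  then show ?thesis
    unfolding sup_risk_def sup_norm_def[symmetric]
    by (simp add: nn_integral_cmult sup_norm_measurable[OF em])
qed

end

lemma ennreal_powr_lk_norm:
  assumes "0 < k"
  shows "ennreal_powr (lk_norm k v) k = power_loss k v"
proof (cases "power_loss k v = \<infinity>")
  case True
  then show ?thesis by (simp add: lk_norm_def ennreal_powr_def power_loss_def)
next
  case False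
  then have "ennreal (enn2real (power_loss k v)) = power_loss k v" by (simp add: less_top)
  then show ?thesis using assms False
    by (simp add: lk_norm_def ennreal_powr_def power_loss_def[symmetric] powr_powr)
qed

text \<open>Presents the empirical estimator, like the other two, as a function of the empirical
  vector. For \<open>n = 0\<close> all frequencies are 0 by the convention for division by
  zero.\<close>

lemma empirical_eq_nth_default: "empirical n xs = nth_default 0 (empirical_vector n xs)"
proof
  fix x
  show "empirical n xs x = nth_default 0 (empirical_vector n xs) x"
  proof (cases "n = 0")
    case True
    then show ?thesis by (simp add: nth_default_def empirical_vector_def empirical_def del: upt_Suc)
  next
    case False
    then show ?thesis
      using empirical_eq_0[of n xs x] by (simp add: nth_default_def empirical_vector_def del: upt_Suc)
  qed
qed

theorem corollary4p7:
  fixes p :: "nat pmf"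
    and M :: "'a measure" and X :: "nat \<Rightarrow> 'a \<Rightarrow> nat"
    and N :: "'b measure" and Y :: "nat \<Rightarrow> 'b \<Rightarrow> real"
  assumes "decseq (pmf p)"
    and "prob_space M" and "iid_sample M p X"
    and "prob_space N" and "limit_process N p Y"
  defines "norm_Y \<equiv> \<lambda>k. \<integral>\<^sup>+\<omega>. ennreal_powr (lk_norm k (\<lambda>x. Y x \<omega>)) k \<partial>N"
    and "norm_YG \<equiv> \<lambda>k. \<integral>\<^sup>+\<omega>. ennreal_powr (lk_norm k (grenander_process p (\<lambda>x. Y x \<omega>))) k \<partial>N"
    and "sup_Y \<equiv> \<integral>\<^sup>+\<omega>. sup_norm (\<lambda>x. Y x \<omega>) \<partial>N"
    and "sup_YG \<equiv> \<integral>\<^sup>+\<omega>. sup_norm (grenander_process p (\<lambda>x. Y x \<omega>)) \<partial>N"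
  shows
    "(\<forall>k::real. 2 \<le> k \<or> k = 1 \<and> summable (\<lambda>x. sqrt (pmf p x)) \<longrightarrow>
        norm_Y k < \<infinity> \<and>
        (\<lambda>n. ennreal (real n powr (k / 2)) * risk k M p (\<lambda>\<omega>. empirical n (\<lambda>i. X i \<omega>)))
          \<longlonglongrightarrow> norm_Y k \<and>
        (\<lambda>n. ennreal (real n powr (k / 2)) * risk k M p (\<lambda>\<omega>. rearrangement_estimator n (\<lambda>i. X i \<omega>)))
          \<longlonglongrightarrow> norm_Y k \<and>
        (\<lambda>n. ennreal (real n powr (k / 2)) * risk k M p (\<lambda>\<omega>. grenander_estimator n (\<lambda>i. X i \<omega>)))
          \<longlonglongrightarrow> norm_YG k \<and>
        norm_YG k \<le> norm_Y k \<and>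
        (\<not> strictly_monotone p \<longrightarrow> norm_YG k < norm_Y k))
     \<and> sup_Y < \<infinity>
     \<and> (\<lambda>n. ennreal (real n powr (1 / 2)) * sup_risk M p (\<lambda>\<omega>. empirical n (\<lambda>i. X i \<omega>)))
          \<longlonglongrightarrow> sup_Y
     \<and> (\<lambda>n. ennreal (real n powr (1 / 2)) * sup_risk M p (\<lambda>\<omega>. rearrangement_estimator n (\<lambda>i. X i \<omega>)))
          \<longlonglongrightarrow> sup_Y
     \<and> (\<lambda>n. ennreal (real n powr (1 / 2)) * sup_risk M p (\<lambda>\<omega>. grenander_estimator n (\<lambda>i. X i \<omega>)))
          \<longlonglongrightarrow> sup_YG
     \<and> sup_YG \<le> sup_Y
     \<and> (\<not> strictly_monotone p \<longrightarrow> sup_YG < sup_Y)"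
proof -
  have "estimation M p X N Y"
    using assms(1-5)
    by (simp add: estimation_def sampling_limit_def sampling_def sampling_axioms_def
        gaussian_limit_def gaussian_limit_axioms_def decreasing_pmf_def)
  then interpret estimation M p X N Y .
  have est: "empirical n xs = empirical n ys" "rearrangement_estimator n xs = rearrangement_estimator n ys"
    "grenander_estimator n xs = grenander_estimator n ys"
    if "empirical_vector n xs = empirical_vector n ys" for n xs ys
    using that by (simp_all only: empirical_eq_nth_default rearrangement_estimator_def grenander_estimator_def)
  show ?thesis
  proof (intro conjI allI impI)
    fix k :: real assume k: "2 \<le> k \<or> k = 1 \<and> summable (\<lambda>x. sqrt (pmf p x))"
    then have k0: "0 < k" "1 \<le> k" by auto
    interpret power: risk_functional M p X N Y "power_loss k" "\<lambda>m v. \<Sum>x<m. \<bar>v x\<bar> powr k"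
      by (rule power_risk_functional[OF k])
    have Y: "norm_Y k = (\<integral>\<^sup>+\<omega>. power_loss k (Yv \<omega>) \<partial>N)"
      and YG: "norm_YG k = (\<integral>\<^sup>+\<omega>. power_loss k (gp (Yv \<omega>)) \<partial>N)"
      unfolding norm_Y_def norm_YG_def by (simp_all only: ennreal_powr_lk_norm[OF k0(1)])
    show "norm_Y k < \<infinity>" unfolding Y by (rule power.finite_limit)
    show "(\<lambda>n. ennreal (real n powr (k / 2)) * risk k M p (\<lambda>\<omega>. empirical n (\<lambda>i. X i \<omega>))) \<longlonglongrightarrow> norm_Y k"
      using power.empirical_limit power_risk_scaled[where est = empirical, OF k0(1) est(1)]
      by (simp only: Y scaled_error_empirical)
    show "(\<lambda>n. ennreal (real n powr (k / 2)) * risk k M p (\<lambda>\<omega>. rearrangement_estimator n (\<lambda>i. X i \<omega>))) \<longlonglongrightarrow>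
        norm_Y k"
      using power.rearrangement_limit power_risk_scaled[where est = rearrangement_estimator, OF k0(1) est(2)]
      by (simp only: Y)
    show "(\<lambda>n. ennreal (real n powr (k / 2)) * risk k M p (\<lambda>\<omega>. grenander_estimator n (\<lambda>i. X i \<omega>))) \<longlonglongrightarrow> norm_YG k"
      using power.grenander_limit power_risk_scaled[where est = grenander_estimator, OF k0(1) est(3)]
      by (simp only: YG)
    show "norm_YG k \<le> norm_Y k" unfolding Y YG by (rule power.grenander_le)
    assume "\<not> strictly_monotone p"
    then obtain r s where f: "flat_block p r s" by (rule flat_block_exists)
    show "norm_YG k < norm_Y k" unfolding Y YG
      using f power_loss_gp_less[OF k0(2) f] by (rule power.grenander_less)
  next
    interpret sup: risk_functional M p X N Y sup_norm sup_head by (rule sup_risk_functional)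
    show "sup_Y < \<infinity>" unfolding sup_Y_def by (rule sup.finite_limit)
    show "(\<lambda>n. ennreal (real n powr (1 / 2)) * sup_risk M p (\<lambda>\<omega>. empirical n (\<lambda>i. X i \<omega>))) \<longlonglongrightarrow> sup_Y"
      using sup.empirical_limit sup_risk_scaled[where est = empirical, OF est(1)]
      by (simp only: sup_Y_def scaled_error_empirical)
    show "(\<lambda>n. ennreal (real n powr (1 / 2)) * sup_risk M p (\<lambda>\<omega>. rearrangement_estimator n (\<lambda>i. X i \<omega>)))
        \<longlonglongrightarrow> sup_Y"
      using sup.rearrangement_limit sup_risk_scaled[where est = rearrangement_estimator, OF est(2)]
      by (simp only: sup_Y_def)
    show "(\<lambda>n. ennreal (real n powr (1 / 2)) * sup_risk M p (\<lambda>\<omega>. grenander_estimator n (\<lambda>i. X i \<omega>))) \<longlonglongrightarrow> sup_YG"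
      using sup.grenander_limit sup_risk_scaled[where est = grenander_estimator, OF est(3)]
      by (simp only: sup_YG_def)
    show "sup_YG \<le> sup_Y" unfolding sup_Y_def sup_YG_def by (rule sup.grenander_le)
    assume "\<not> strictly_monotone p"
    then obtain r s where f: "flat_block p r s" by (rule flat_block_exists)
    show "sup_YG < sup_Y" unfolding sup_Y_def sup_YG_def
      using f sup_norm_gp_less[OF f] by (rule sup.grenander_less)
  qed
qed

end
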